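(* Let $\sigma\in\mathrm{Irr}_\epsilon(\overline T)$ be an irreducible genuine representation of $\overline T$ with a $\overline T_0$-constituent $\sigma_0$ (i.e. $\sigma_0$ is an irreducible constituent of $\sigma|_{\overline T_0}$). Then the pair $(\overline T_0,\sigma_0)$ is a type for the inertial class $[\overline T,\sigma]_{\overline T}$ in the sense of Bushnell–Kutzko.
   Context: $p$ is a prime, $F$ a finite extension of $\mathbb Q_p$ with ring of integers $\mathcal O$; $n\ge1$ is an integer such that the group $\mu_n$ of $n$-th roots of unity in $F$ has order $n$; $(\cdot,\cdot)_n:F^\times\times F^\times\to\mu_n$ is the $n$-th order Hilbert symbol. $\mathbb T$ is a split torus over $F$ with cocharacter lattice $Y$; $T=\mathbb T(F)=Y\otimes_{\mathbb Z}F^\times$, with $y(u)$ denoting $y\otimes u$; $T_0=Y\otimes\mathcal O^\times$ is the maximal compact subgroup. $D:Y\times Y\to\mathbb Z$ is a (not necessarily symmetric) bilinear form. The Brylinski–Deligne cover $\overline T$ attached to $D$ is the central extension $1\to\mu_n\to\overline T\xrightarrow{\mathrm{pr}}T\to1$ given by $\overline T=\mu_n\times T$ (product topology) with multiplication $(\zeta,t)(\zeta',t')=(\zeta\zeta'c(t,t'),tt')$, where $c:T\times T\to\mu_n$ is the bimultiplicative map with $c(y(u),z(v))=(u,v)_n^{D(y,z)}$. $\overline T_0=\mathrm{pr}^{-1}(T_0)$. Representations are smooth and complex. Fix a faithful character $\epsilon:\mu_n\to\mathbb C^\times$; genuine means $\mu_n$ acts through $\epsilon$; $\mathrm{Irr}_\epsilon(\cdot)$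 denotes isomorphism classes of irreducible genuine representations. The inertial class $[\overline T,\sigma]_{\overline T}$ consists of the irreducible representations of $\overline T$ isomorphic to $\sigma\otimes(\nu\circ\mathrm{pr})$ for some unramified character $\nu$ of $T$ (a character trivial on $T_0$). The pair $(\overline T_0,\sigma_0)$ is a type for this class if, for every irreducible representation $\pi$ of $\overline T$, the restriction $\pi|_{\overline T_0}$ contains $\sigma_0$ if and only if $\pi$ belongs to $[\overline T,\sigma]_{\overline T}$. *)

theory Defs
  imports
    "HOL-Analysis.Analysis"
    "HOL-Algebra.Algebraic_Closure_Type"
    "HOL-Algebra.Free_Abelian_Groups"
    "HOL-Algebra.Bij"
begin

hide_const (open) Divisibility.prime

section \<open>Finite extensions of the p-adic numbers\<close>

definition absv :: "'f::{field_char_0,complete_space} \<Rightarrow> real" where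
  "absv x = dist x 0"

text \<open>
  The type \<open>'f\<close> is a finite extension of \<open>\<rat>\<^sub>p\<close>.  Its metric is the one of the unique absolute value
  extending the p-adic one.  An ultrametric absolute value with \<open>\<bar>p\<bar> = 1/p\<close> restricts to the
  p-adic absolute value on \<open>\<rat>\<close>, and \<open>'f\<close> is complete, so the closure of \<open>\<rat>\<close> in \<open>'f\<close> is
  the completion \<open>\<rat>\<^sub>p\<close>.  The last clause says that \<open>'f\<close> has finite degree over it.
\<close>
definition padic_field :: "'f::{field_char_0,complete_space} itself \<Rightarrow> nat \<Rightarrow> bool" where
  "padic_field TYPE('f) p \<longleftrightarrow>
     prime p \<and>
     (\<forall>x y::'f. dist x y = absv (x - y)) \<and>
     (\<forall>x y::'f. absv (x * y) = absv x * absv y) \<and>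
     (\<forall>x y::'f. absv (x + y) \<le> max (absv x) (absv y)) \<and>
     absv (of_nat p :: 'f) = 1 / real p \<and>
     (\<exists>B::'f set. finite B \<and>
        (\<forall>x. \<exists>a. (\<forall>b\<in>B. a b \<in> closure (\<rat> :: 'f set)) \<and> x = (\<Sum>b\<in>B. a b * b)))"

definition int_ring :: "'f::{field_char_0,complete_space} set" where
  "int_ring = {x. absv x \<le> 1}"

definition int_units :: "'f::{field_char_0,complete_space} set" where
  "int_units = {x. absv x = 1}"

definition uniformizer :: "'f::{field_char_0,complete_space} \<Rightarrow> bool" where
  "uniformizer \<pi> \<longleftrightarrow> \<pi> \<noteq> 0 \<and> {x. absv x < 1} = {\<pi> * y | y. y \<in> int_ring}"

definition residue_card :: "'f::{field_char_0,complete_space} itself \<Rightarrow> nat" where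
  "residue_card TYPE('f) =
     card ((int_ring :: 'f set) // {(x, y). x \<in> int_ring \<and> y \<in> int_ring \<and> absv (x - y) < 1})"

definition mult_group :: "'a::field monoid" where
  "mult_group = \<lparr>carrier = {x. x \<noteq> 0}, monoid.mult = (*), one = 1\<rparr>"

definition roots_of_unity :: "nat \<Rightarrow> 'f::field set" where
  "roots_of_unity n = {z. z ^ n = 1}"


section \<open>The local Artin map\<close>

text \<open>Extensions of \<open>'f\<close> are taken inside its algebraic closure, into which \<^const>\<open>to_ac\<close> embeds it.\<close>

definition intermediate_field :: "'f::field alg_closure set \<Rightarrow> bool" where
  "intermediate_field L \<longleftrightarrow> subfield L ring_of_type_algebra \<and> range to_ac \<subseteq> L"

definition finite_ext :: "'f::field alg_closure set \<Rightarrow> bool" where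
  "finite_ext L \<longleftrightarrow> intermediate_field L \<and>
     (\<exists>B. finite B \<and> L = module.span (\<lambda>a x. to_ac a * x) B)"

definition gal :: "'f::field alg_closure set \<Rightarrow> ('f alg_closure \<Rightarrow> 'f alg_closure) monoid" where
  "gal L = (BijGroup L) \<lparr>carrier :=
     {s \<in> Bij L. (\<forall>x\<in>L. \<forall>y\<in>L. s (x + y) = s x + s y \<and> s (x * y) = s x * s y) \<and>
                 (\<forall>a. s (to_ac a) = to_ac a)}\<rparr>"

definition finite_abelian_ext :: "'f::field alg_closure set \<Rightarrow> bool" where
  "finite_abelian_ext L \<longleftrightarrow> finite_ext L \<and>
     {x \<in> L. \<forall>s\<in>carrier (gal L). s x = x} = range to_ac \<and> comm_group (gal L)"

text \<open>The maximal abelian extension, as the fixed field of the commutator subgroup of the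
  absolute Galois group (characteristic 0, so the algebraic closure is separable).\<close>
definition max_abelian_ext :: "'f::field_char_0 alg_closure set" where
  "max_abelian_ext = {x. \<forall>s\<in>derived (gal UNIV) (carrier (gal UNIV)). s x = x}"

definition ext_int_ring ::
  "'f::{field_char_0,complete_space} alg_closure set \<Rightarrow> 'f alg_closure set" where
  "ext_int_ring L =
     {x \<in> L. \<exists>P::'f poly. Polynomial.lead_coeff P = 1 \<and>
        (\<forall>i. Polynomial.coeff P i \<in> int_ring) \<and> Polynomial.poly (map_poly to_ac P) x = 0}"

definition ext_max_ideal ::
  "'f::{field_char_0,complete_space} alg_closure set \<Rightarrow> 'f alg_closure set" where
  "ext_max_ideal L = {x \<in> ext_int_ring L. x = 0 \<or> inverse x \<notin> ext_int_ring L}"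

text \<open>Residue fields are finite, hence perfect, so unramified means ramification index 1.\<close>
definition unramified_ext :: "'f::{field_char_0,complete_space} alg_closure set \<Rightarrow> bool" where
  "unramified_ext L \<longleftrightarrow> finite_ext L \<and>
     (\<forall>\<pi>::'f. uniformizer \<pi> \<longrightarrow> ext_max_ideal L = {to_ac \<pi> * y | y. y \<in> ext_int_ring L})"

text \<open>
  The main theorem of local class field theory: there is exactly one homomorphism
  \<open>art\<close> from the multiplicative group of \<open>'f\<close> to the Galois group of its maximal abelian extension
  such that uniformizers act as the (arithmetic) Frobenius on finite unramified extensions,
  and norms from a finite abelian extension act trivially on that extension.
\<close>
definition local_artin_map ::
  "('f::{field_char_0,complete_space} \<Rightarrow> 'f alg_closure \<Rightarrow> 'f alg_closure) \<Rightarrow> bool" where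
  "local_artin_map art \<longleftrightarrow>
     art \<in> hom mult_group (gal max_abelian_ext) \<and>
     (\<forall>\<pi> L. uniformizer \<pi> \<longrightarrow> unramified_ext L \<longrightarrow>
        (\<forall>x\<in>ext_int_ring L. art \<pi> x - x ^ residue_card TYPE('f) \<in> ext_max_ideal L)) \<and>
     (\<forall>L. finite_abelian_ext L \<longrightarrow>
        (\<forall>x\<in>L. \<forall>a. x \<noteq> 0 \<longrightarrow> to_ac a = (\<Prod>s\<in>carrier (gal L). s x) \<longrightarrow>
           (\<forall>y\<in>L. art a y = y)))"

text \<open>\<open>(u, v)\<^sub>n = art(u)(\<beta>) / \<beta>\<close> for any n-th root \<open>\<beta>\<close> of \<open>v\<close>, with \<open>u, v\<close> nonzero and all n-th roots
  of unity in \<open>'f\<close>.  The other common conventions (exchanging \<open>u\<close> and \<open>v\<close>, or the geometric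
  Frobenius) give the inverse symbol.\<close>
definition hilbert_symbol ::
  "nat \<Rightarrow> ('f::field \<Rightarrow> 'f alg_closure \<Rightarrow> 'f alg_closure) \<Rightarrow> 'f \<Rightarrow> 'f \<Rightarrow> 'f" where
  "hilbert_symbol n art u v = (THE z. \<forall>\<beta>. \<beta> ^ n = to_ac v \<longrightarrow> art u \<beta> = to_ac z * \<beta>)"


section \<open>Tensor products of abelian groups, and the torus\<close>

definition tensor_relations ::
  "'a monoid \<Rightarrow> 'b monoid \<Rightarrow> ('a \<times> 'b \<Rightarrow>\<^sub>0 int) set" where
  "tensor_relations A B = generate (free_Abelian_group (carrier A \<times> carrier B))
     ({frag_of (a \<otimes>\<^bsub>A\<^esub> a', b) - frag_of (a, b) - frag_of (a', b) | a a' b.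
         a \<in> carrier A \<and> a' \<in> carrier A \<and> b \<in> carrier B} \<union>
      {frag_of (a, b \<otimes>\<^bsub>B\<^esub> b') - frag_of (a, b) - frag_of (a, b') | a b b'.
         a \<in> carrier A \<and> b \<in> carrier B \<and> b' \<in> carrier B})"

definition tensor_group :: "'a monoid \<Rightarrow> 'b monoid \<Rightarrow> ('a \<times> 'b \<Rightarrow>\<^sub>0 int) set monoid" where
  "tensor_group A B = free_Abelian_group (carrier A \<times> carrier B) Mod tensor_relations A B"

definition pure_tensor :: "'a monoid \<Rightarrow> 'b monoid \<Rightarrow> 'a \<Rightarrow> 'b \<Rightarrow> ('a \<times> 'b \<Rightarrow>\<^sub>0 int) set" where
  "pure_tensor A B a b =
     tensor_relations A B #>\<^bsub>free_Abelian_group (carrier A \<times> carrier B)\<^esub> frag_of (a, b)"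

text \<open>Free abelian groups of finite rank (the rank may be 0), written multiplicatively.\<close>
definition lattice_group :: "'y monoid \<Rightarrow> bool" where
  "lattice_group Y \<longleftrightarrow> comm_group Y \<and> (\<exists>r::nat. Y \<cong> free_Abelian_group {..<r})"

definition bilinear_form :: "'y monoid \<Rightarrow> ('y \<Rightarrow> 'y \<Rightarrow> int) \<Rightarrow> bool" where
  "bilinear_form Y D \<longleftrightarrow>
     (\<forall>x\<in>carrier Y. \<forall>y\<in>carrier Y. \<forall>z\<in>carrier Y.
        D (x \<otimes>\<^bsub>Y\<^esub> y) z = D x z + D y z \<and> D z (x \<otimes>\<^bsub>Y\<^esub> y) = D z x + D z y)"

type_synonym ('y, 'f) torus_elt = "('y \<times> 'f \<Rightarrow>\<^sub>0 int) set"

definition torus :: "'y monoid \<Rightarrow> ('y, 'f::field) torus_elt monoid" where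
  "torus Y = tensor_group Y mult_group"

definition cochar :: "'y monoid \<Rightarrow> 'y \<Rightarrow> 'f::field \<Rightarrow> ('y, 'f) torus_elt" where
  "cochar Y y u = pure_tensor Y mult_group y u"

definition torus0 :: "'y monoid \<Rightarrow> ('y, 'f::{field_char_0,complete_space}) torus_elt set" where
  "torus0 Y = generate (torus Y) {cochar Y y u | y u. y \<in> carrier Y \<and> u \<in> int_units}"

text \<open>
  The p-adic topology of the torus: the finest topology for which all the maps
  \<open>(u\<^sub>0, \<dots>, u\<^sub>k\<^sub>-\<^sub>1) \<mapsto> y\<^sub>0(u\<^sub>0) \<cdots> y\<^sub>k\<^sub>-\<^sub>1(u\<^sub>k\<^sub>-\<^sub>1)\<close> are continuous.
  If the \<open>y\<^sub>i\<close> form a basis of \<open>Y\<close>, this map is an isomorphism, and every other such map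
  factors through it by monomials, so it is a homeomorphism.
\<close>
definition torus_open :: "'y monoid \<Rightarrow> ('y, 'f::{field_char_0,complete_space}) torus_elt set \<Rightarrow> bool"
  where "torus_open Y U \<longleftrightarrow> U \<subseteq> carrier (torus Y) \<and>
     (\<forall>(k::nat) y. y \<in> {..<k} \<rightarrow> carrier Y \<longrightarrow>
        openin (product_topology (\<lambda>_. top_of_set (carrier mult_group)) {..<k})
          {u \<in> {..<k} \<rightarrow>\<^sub>E carrier mult_group.
             finprod (torus Y) (\<lambda>i. cochar Y (y i) (u i)) {..<k} \<in> U})"

definition torus_topology ::
  "'y monoid \<Rightarrow> ('y, 'f::{field_char_0,complete_space}) torus_elt topology" where
  "torus_topology Y = topology (torus_open Y)"

lemma istopology_torus_open:
  "istopology (torus_open Y :: ('y, 'f::{field_char_0,complete_space}) torus_elt set \<Rightarrow> bool)"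
  unfolding istopology_def
proof (intro conjI allI impI)
  fix S T :: "('y, 'f) torus_elt set" assume S: "torus_open Y S" and T: "torus_open Y T"
  have *: "{u \<in> A. f u \<in> S \<inter> T} = {u \<in> A. f u \<in> S} \<inter> {u \<in> A. f u \<in> T}" for A :: "'b set" and f
    by auto
  show "torus_open Y (S \<inter> T)"
    using S T unfolding torus_open_def * by (auto intro: openin_Int)
next
  fix K :: "('y, 'f) torus_elt set set" assume K: "\<forall>U\<in>K. torus_open Y U"
  have *: "{u \<in> A. f u \<in> \<Union>K} = (\<Union>U\<in>K. {u \<in> A. f u \<in> U})" for A :: "'b set" and f
    by auto
  show "torus_open Y (\<Union>K)"
    using K unfolding torus_open_def * by (auto intro!: openin_Union)
qed

lemma openin_torus_topology: "openin (torus_topology Y) = torus_open Y"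
  by (simp add: torus_topology_def istopology_torus_open)


section \<open>The Brylinski--Deligne cover\<close>

text \<open>The \<open>y(u)\<close> generate the torus, so the bimultiplicative map \<open>c\<close> is determined on it.\<close>
definition bd_cocycle ::
  "nat \<Rightarrow> ('f::{field_char_0,complete_space} \<Rightarrow> 'f alg_closure \<Rightarrow> 'f alg_closure) \<Rightarrow> 'y monoid
    \<Rightarrow> ('y \<Rightarrow> 'y \<Rightarrow> int) \<Rightarrow> (('y, 'f) torus_elt \<Rightarrow> ('y, 'f) torus_elt \<Rightarrow> 'f) \<Rightarrow> bool" where
  "bd_cocycle n art Y D c \<longleftrightarrow>
     (\<forall>s\<in>carrier (torus Y). \<forall>t\<in>carrier (torus Y). c s t \<in> roots_of_unity n) \<and>
     (\<forall>s\<in>carrier (torus Y). \<forall>s'\<in>carrier (torus Y). \<forall>t\<in>carrier (torus Y).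
        c (s \<otimes>\<^bsub>torus Y\<^esub> s') t = c s t * c s' t \<and> c t (s \<otimes>\<^bsub>torus Y\<^esub> s') = c t s * c t s') \<and>
     (\<forall>y\<in>carrier Y. \<forall>z\<in>carrier Y. \<forall>u v. u \<noteq> 0 \<longrightarrow> v \<noteq> 0 \<longrightarrow>
        c (cochar Y y u) (cochar Y z v) = hilbert_symbol n art u v powi D y z)"

definition cover ::
  "nat \<Rightarrow> 'y monoid \<Rightarrow> (('y, 'f::field) torus_elt \<Rightarrow> ('y, 'f) torus_elt \<Rightarrow> 'f)
    \<Rightarrow> ('f \<times> ('y, 'f) torus_elt) monoid" where
  "cover n Y c =
     \<lparr>carrier = roots_of_unity n \<times> carrier (torus Y),
      monoid.mult = (\<lambda>(\<zeta>, t) (\<zeta>', t'). (\<zeta> * \<zeta>' * c t t', t \<otimes>\<^bsub>torus Y\<^esub> t')),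
      one = (1, \<one>\<^bsub>torus Y\<^esub>)\<rparr>"

definition cover_topology ::
  "nat \<Rightarrow> 'y monoid \<Rightarrow> ('f::{field_char_0,complete_space} \<times> ('y, 'f) torus_elt) topology" where
  "cover_topology n Y = prod_topology (discrete_topology (roots_of_unity n)) (torus_topology Y)"

definition cover0_carrier ::
  "nat \<Rightarrow> 'y monoid \<Rightarrow> ('f::{field_char_0,complete_space} \<times> ('y, 'f) torus_elt) set" where
  "cover0_carrier n Y = roots_of_unity n \<times> torus0 Y"

definition cover0 ::
  "nat \<Rightarrow> 'y monoid \<Rightarrow> (('y, 'f::{field_char_0,complete_space}) torus_elt \<Rightarrow> ('y, 'f) torus_elt \<Rightarrow> 'f)
    \<Rightarrow> ('f \<times> ('y, 'f) torus_elt) monoid" where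
  "cover0 n Y c = (cover n Y c)\<lparr>carrier := cover0_carrier n Y\<rparr>"

definition cover0_topology ::
  "nat \<Rightarrow> 'y monoid \<Rightarrow> ('f::{field_char_0,complete_space} \<times> ('y, 'f) torus_elt) topology" where
  "cover0_topology n Y = subtopology (cover_topology n Y) (cover0_carrier n Y)"


section \<open>Smooth complex representations\<close>

text \<open>A representation on the complex vector space with underlying abelian group \<open>'v\<close>.  Restriction
  to a subgroup is the same record, considered over the smaller group.\<close>
record ('g, 'v) rep =
  scal :: "complex \<Rightarrow> 'v \<Rightarrow> 'v"
  act :: "'g \<Rightarrow> 'v \<Rightarrow> 'v"

definition smooth_rep :: "'g monoid \<Rightarrow> 'g topology \<Rightarrow> ('g, 'v::ab_group_add) rep \<Rightarrow> bool" where
  "smooth_rep G \<tau> \<rho> \<longleftrightarrow>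
     vector_space (scal \<rho>) \<and>
     (\<forall>g\<in>carrier G. Vector_Spaces.linear (scal \<rho>) (scal \<rho>) (act \<rho> g)) \<and>
     (\<forall>v. act \<rho> \<one>\<^bsub>G\<^esub> v = v) \<and>
     (\<forall>g\<in>carrier G. \<forall>h\<in>carrier G. \<forall>v. act \<rho> (g \<otimes>\<^bsub>G\<^esub> h) v = act \<rho> g (act \<rho> h v)) \<and>
     (\<forall>v. openin \<tau> {g \<in> carrier G. act \<rho> g v = v})"

definition invariant_subspace :: "'g monoid \<Rightarrow> ('g, 'v::ab_group_add) rep \<Rightarrow> 'v set \<Rightarrow> bool" where
  "invariant_subspace G \<rho> W \<longleftrightarrow>
     module.subspace (scal \<rho>) W \<and> (\<forall>g\<in>carrier G. \<forall>w\<in>W. act \<rho> g w \<in> W)"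

definition smooth_irrep :: "'g monoid \<Rightarrow> 'g topology \<Rightarrow> ('g, 'v::ab_group_add) rep \<Rightarrow> bool" where
  "smooth_irrep G \<tau> \<rho> \<longleftrightarrow> smooth_rep G \<tau> \<rho> \<and> (UNIV :: 'v set) \<noteq> {0} \<and>
     (\<forall>W. invariant_subspace G \<rho> W \<longrightarrow> W = {0} \<or> W = UNIV)"

definition intertwines_on ::
  "'g monoid \<Rightarrow> ('g, 'v::ab_group_add) rep \<Rightarrow> 'v set \<Rightarrow> ('g, 'w::ab_group_add) rep
    \<Rightarrow> ('v \<Rightarrow> 'w) \<Rightarrow> bool" where
  "intertwines_on G \<rho> W \<rho>' f \<longleftrightarrow>
     (\<forall>x\<in>W. \<forall>y\<in>W. f (x + y) = f x + f y) \<and>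
     (\<forall>a. \<forall>x\<in>W. f (scal \<rho> a x) = scal \<rho>' a (f x)) \<and>
     (\<forall>g\<in>carrier G. \<forall>x\<in>W. f (act \<rho> g x) = act \<rho>' g (f x))"

definition rep_iso ::
  "'g monoid \<Rightarrow> ('g, 'v::ab_group_add) rep \<Rightarrow> ('g, 'w::ab_group_add) rep \<Rightarrow> bool" where
  "rep_iso G \<rho> \<rho>' \<longleftrightarrow> (\<exists>f. intertwines_on G \<rho> UNIV \<rho>' f \<and> bij f)"

text \<open>\<open>\<rho>'\<close> is a subrepresentation of \<open>\<rho>\<close>, up to isomorphism.\<close>
definition contains_rep ::
  "'g monoid \<Rightarrow> ('g, 'v::ab_group_add) rep \<Rightarrow> ('g, 'w::ab_group_add) rep \<Rightarrow> bool" where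
  "contains_rep G \<rho> \<rho>' \<longleftrightarrow> (\<exists>f. intertwines_on G \<rho>' UNIV \<rho> f \<and> inj f)"

text \<open>\<open>\<rho>'\<close> is an irreducible subquotient of \<open>\<rho>\<close>: a quotient of the subrepresentation \<open>W\<close>.\<close>
definition irreducible_constituent ::
  "'g monoid \<Rightarrow> 'g topology \<Rightarrow> ('g, 'v::ab_group_add) rep \<Rightarrow> ('g, 'w::ab_group_add) rep \<Rightarrow> bool" where
  "irreducible_constituent G \<tau> \<rho> \<rho>' \<longleftrightarrow> smooth_irrep G \<tau> \<rho>' \<and>
     (\<exists>W f. invariant_subspace G \<rho> W \<and> intertwines_on G \<rho> W \<rho>' f \<and> f ` W = UNIV)"


section \<open>Genuine representations, inertial classes and types\<close>

definition faithful_character :: "nat \<Rightarrow> ('f::field \<Rightarrow> complex) \<Rightarrow> bool" where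
  "faithful_character n \<epsilon> \<longleftrightarrow>
     \<epsilon> \<in> hom (mult_group\<lparr>carrier := roots_of_unity n\<rparr>) mult_group \<and> inj_on \<epsilon> (roots_of_unity n)"

definition genuine ::
  "nat \<Rightarrow> 'y monoid \<Rightarrow> ('f::field \<Rightarrow> complex) \<Rightarrow> ('f \<times> ('y, 'f) torus_elt, 'v) rep \<Rightarrow> bool" where
  "genuine n Y \<epsilon> \<rho> \<longleftrightarrow>
     (\<forall>\<zeta>\<in>roots_of_unity n. \<forall>v. act \<rho> (\<zeta>, \<one>\<^bsub>torus Y\<^esub>) v = scal \<rho> (\<epsilon> \<zeta>) v)"

definition unramified_character ::
  "'y monoid \<Rightarrow> (('y, 'f::{field_char_0,complete_space}) torus_elt \<Rightarrow> complex) \<Rightarrow> bool" where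
  "unramified_character Y \<nu> \<longleftrightarrow> \<nu> \<in> hom (torus Y) mult_group \<and> (\<forall>t\<in>torus0 Y. \<nu> t = 1)"

definition twist ::
  "('f \<times> ('y, 'f) torus_elt, 'v) rep \<Rightarrow> (('y, 'f) torus_elt \<Rightarrow> complex)
    \<Rightarrow> ('f \<times> ('y, 'f) torus_elt, 'v) rep" where
  "twist \<sigma> \<nu> = \<sigma>\<lparr>act := (\<lambda>g v. scal \<sigma> (\<nu> (snd g)) (act \<sigma> g v))\<rparr>"

text \<open>The members, with underlying abelian group \<open>'w\<close>, of the inertial class of \<open>\<sigma>\<close>.\<close>
definition inertial_class ::
  "nat \<Rightarrow> 'y monoid \<Rightarrow> (('y, 'f::{field_char_0,complete_space}) torus_elt \<Rightarrow> ('y, 'f) torus_elt \<Rightarrow> 'f)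
    \<Rightarrow> ('f \<times> ('y, 'f) torus_elt, 'v::ab_group_add) rep
    \<Rightarrow> ('f \<times> ('y, 'f) torus_elt, 'w::ab_group_add) rep set" where
  "inertial_class n Y c \<sigma> =
     {\<pi>. smooth_irrep (cover n Y c) (cover_topology n Y) \<pi> \<and>
         (\<exists>\<nu>. unramified_character Y \<nu> \<and> rep_iso (cover n Y c) \<pi> (twist \<sigma> \<nu>))}"

text \<open>The type argument is the underlying abelian group of the test representations \<open>\<pi>\<close>; since HOL
  cannot quantify over it inside a definition, it is to be left arbitrary.\<close>
definition is_type ::
  "'w::ab_group_add itself \<Rightarrow> nat \<Rightarrow> 'y monoid
    \<Rightarrow> (('y, 'f::{field_char_0,complete_space}) torus_elt \<Rightarrow> ('y, 'f) torus_elt \<Rightarrow> 'f)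
    \<Rightarrow> ('f \<times> ('y, 'f) torus_elt, 'u::ab_group_add) rep
    \<Rightarrow> ('f \<times> ('y, 'f) torus_elt, 'v::ab_group_add) rep \<Rightarrow> bool" where
  "is_type TYPE('w) n Y c \<sigma>\<^sub>0 \<sigma> \<longleftrightarrow>
     (\<forall>\<pi> :: ('f \<times> ('y, 'f) torus_elt, 'w) rep.
        smooth_irrep (cover n Y c) (cover_topology n Y) \<pi> \<longrightarrow>
        (contains_rep (cover0 n Y c) \<pi> \<sigma>\<^sub>0 \<longleftrightarrow> \<pi> \<in> inertial_class n Y c \<sigma>))"

end

theory Submission
  imports Defs "HOL-Library.Function_Algebras"
begin

text \<open>
  The cover \<open>G\<close> is nilpotent of class two: commutators lie in \<open>\<mu>\<^sub>n \<subseteq> H = pr\<^sup>-\<^sup>1(T\<^sub>0)\<close> and n-th powers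
  are central.  Since \<open>F\<close> is locally compact, \<open>G\<close> is generated by \<open>H\<close> and finitely many elements
  and \<open>H\<close> has finite orbits on smooth representations.  Hence an irreducible representation of \<open>G\<close>
  has countable dimension, Schur's lemma makes n-th powers scalar, the dimension is finite, and
  by Clifford theory the restriction to \<open>H\<close> is semisimple.  In particular \<open>\<sigma>\<^sub>0\<close> is both a
  subrepresentation and a quotient of \<open>\<sigma>\<close>.

  If \<open>\<pi>\<close> contains \<open>\<sigma>\<^sub>0\<close>, then \<open>Hom\<^sub>H(\<sigma>, \<pi>) \<noteq> 0\<close>.  The abelian group \<open>G/H\<close> acts on this space by
  conjugation, its generators commute and have scalar n-th powers, so there is a common
  eigenvector.  It intertwines \<open>\<pi>\<close> with the twist of \<open>\<sigma>\<close> by its eigencharacter, which is unramified.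
\<close>

section \<open>Polynomials in a linear operator\<close>

text \<open>The restriction of \<sigma> to H may have several constituents, possibly of dimension
  above one. So Hom_H(\<sigma>, \<pi>) need not be a line, and a nonzero H-map from \<sigma> to
  \<pi> need not be equivariant up to a character: this is why an eigenvector has to be found. Its
  existence rests on one polynomial identity: x^n acts by scalars on \<sigma> and on \<pi>, so every
  generator x satisfies X^n = b on that space, and complex polynomials have roots. The n-th powers
  are central because the commutator of lifts of s and t is c(s, t) / c(t, s), which is
  bimultiplicative with values in \<mu>_n. Admissibility is not part of the definition of an
  irreducible representation, so Schur's lemma cannot start from finite-dimensional spaces of fixed
  vectors; it comes from countable dimension against the uncountability of the complex numbers.
  Semisimplicity bridges two notions: a constituent is a subquotient, while a type asks for a
  subrepresentation.\<close>

locale complex_vector_space = vector_space scale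
  for scale :: "complex \<Rightarrow> 'v::ab_group_add \<Rightarrow> 'v"
begin

text \<open>Evaluation of \<open>p\<close> at the operator \<open>f\<close>, applied to
  \<open>v\<close>, by Horner's scheme.\<close>

definition poly_op :: "('v \<Rightarrow> 'v) \<Rightarrow> complex poly \<Rightarrow> 'v \<Rightarrow> 'v" where
  "poly_op f p v = fold_coeffs (\<lambda>a w. scale a v + f w) p 0"

context
  fixes f :: "'v \<Rightarrow> 'v"
  assumes linear: "Vector_Spaces.linear scale scale f"
begin

interpretation f: Vector_Spaces.linear scale scale f
  by (fact linear)

lemma poly_op_0 [simp]: "poly_op f 0 v = 0"
  by (simp add: poly_op_def)

lemma poly_op_pCons [simp]: "poly_op f (pCons a p) v = scale a v + f (poly_op f p v)"
  by (cases "p = 0 \<and> a = 0") (auto simp: poly_op_def)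

lemma poly_op_add: "poly_op f (p + q) v = poly_op f p v + poly_op f q v"
  by (induction p q rule: poly_induct2) (simp_all add: algebra_simps f.add)

lemma poly_op_smult: "poly_op f (Polynomial.smult a p) v = scale a (poly_op f p v)"
  by (induction p) (simp_all add: algebra_simps f.scale)

lemma poly_op_sum: "poly_op f (\<Sum>i\<in>I. p i) v = (\<Sum>i\<in>I. poly_op f (p i) v)"
  by (induction I rule: infinite_finite_induct) (simp_all add: poly_op_add)

lemma poly_op_mult: "poly_op f (p * q) v = poly_op f p (poly_op f q v)"
  by (induction p) (simp_all add: poly_op_add poly_op_smult)

lemma poly_op_right: "poly_op f p (scale a v + w) = scale a (poly_op f p v) + poly_op f p w"
  by (induction p) (simp_all add: algebra_simps f.add f.scale)

lemma linear_poly_op: "Vector_Spaces.linear scale scale (poly_op f p)"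
proof (unfold_locales)
  show "poly_op f p (x + y) = poly_op f p x + poly_op f p y" for x y
    using poly_op_right[of p 1 x y] by simp
  have "poly_op f p 0 = 0"
    by (induction p) simp_all
  then show "poly_op f p (scale a x) = scale a (poly_op f p x)" for a x
    using poly_op_right[of p a x 0] by simp
qed

lemma poly_op_monom: "poly_op f (Polynomial.monom 1 n) v = (f ^^ n) v"
  by (induction n) (simp_all add: monom_Suc monom_0)

lemma poly_op_mem:
  assumes "subspace U" "\<And>u. u \<in> U \<Longrightarrow> f u \<in> U" "v \<in> U"
  shows "poly_op f p v \<in> U"
  by (induction p) (use assms in \<open>auto intro: subspace_0 subspace_add subspace_scale\<close>)

end

text \<open>Linear factors are stripped off a polynomial that annihilates \<open>v\<close> until the
  remaining factor no longer does; it sends \<open>v\<close> to an eigenvector for the root removed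
  last. The space may have infinite dimension. The eigenvector is given as a polynomial in
  \<open>f\<close> applied to \<open>v\<close>, so that it stays in every \<open>f\<close>-stable
  subspace containing \<open>v\<close>.\<close>

lemma eigenvector_in_cyclic_module:
  assumes f: "Vector_Spaces.linear scale scale f"
    and "p \<noteq> 0" "poly_op f p v = 0" "v \<noteq> 0"
  shows "\<exists>q a. poly_op f q v \<noteq> 0 \<and> f (poly_op f q v) = scale a (poly_op f q v)"
  using assms(2,3)
proof (induction "Polynomial.degree p" arbitrary: p)
  case 0
  then obtain c where "p = [:c:]" "c \<noteq> 0"
    by (metis degree_eq_zeroE pCons_0_0)
  with 0 \<open>v \<noteq> 0\<close> show ?case
    using f by (simp add: linear_iff_module_hom module_hom.zero)
next
  case (Suc d)
  then obtain a where "Polynomial.poly p a = 0"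
    using fundamental_theorem_of_algebra[of p] by (auto simp: constant_degree)
  then have "[:-a, 1:] dvd p"
    by (simp only: poly_eq_0_iff_dvd)
  then obtain q where q: "p = [:-a, 1:] * q"
    by (rule dvdE)
  have "q \<noteq> 0"
    using q Suc.hyps(2) by auto
  then have "Polynomial.degree p = Suc (Polynomial.degree q)"
    unfolding q by (subst degree_mult_eq) auto
  then have "Polynomial.degree q = d"
    using Suc.hyps(2) by simp
  have eigen: "f (poly_op f q v) = scale a (poly_op f q v)"
    using Suc.prems(2) f unfolding q poly_op_mult[OF f]
    by (simp add: linear_iff_module_hom module_hom.zero)
  show ?case
  proof (cases "poly_op f q v = 0")
    case True
    show ?thesis
      using Suc.hyps(1)[of q] \<open>Polynomial.degree q = d\<close> \<open>q \<noteq> 0\<close> True by simp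
  next
    case False
    with eigen show ?thesis
      by (intro exI[of _ q] exI[of _ a] conjI)
  qed
qed

text \<open>If \<open>f\<close> has no eigenvector, the resolvents \<open>(f - a)\<^sup>-\<^sup>1 v\<close> are linearly independent, and there are
  uncountably many of them.\<close>
lemma countable_dimension_eigenvalue:
  assumes f: "Vector_Spaces.linear scale scale f"
    and "countable C" "span C = UNIV" "v \<noteq> 0"
    and surj: "\<And>a. v \<in> range (\<lambda>w. f w - scale a w)"
  shows "\<exists>a w. w \<noteq> 0 \<and> f w = scale a w"
proof (rule ccontr)
  assume no_eigenvector: "\<nexists>a w. w \<noteq> 0 \<and> f w = scale a w"
  interpret f: Vector_Spaces.linear scale scale f
    by (fact f)
  have inj: "w = 0" if "p \<noteq> 0" "poly_op f p w = 0" for p w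
    using eigenvector_in_cyclic_module[OF f that] no_eigenvector by metis
  have "\<exists>w. f w - scale a w = v" for a
    using surj[of a] by auto
  then obtain R where R: "f (R a) - scale a (R a) = v" for a
    by metis
  \<comment> \<open>Pigeonhole: \<open>C\<close> has only countably many finite subsets, so the span
    of one of them contains \<open>R a\<close> for uncountably many \<open>a\<close>.\<close>
  have "(\<Union>S\<in>{S. finite S \<and> S \<subseteq> C}. {a. R a \<in> span S}) = UNIV"
  proof -
    have "R a \<in> span C" for a
      using assms(3) by simp
    then have "\<exists>S. finite S \<and> S \<subseteq> C \<and> R a \<in> span S" for a
    proof -
      obtain S r where "finite S" "S \<subseteq> C" "R a = (\<Sum>w\<in>S. scale (r w) w)"
        using \<open>R a \<in> span C\<close> unfolding span_explicit by auto
      moreover from this have "R a \<in> span S"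
        by (simp add: span_sum span_scale span_base)
      ultimately show ?thesis
        by blast
    qed
    then show ?thesis
      by blast
  qed
  moreover have "countable {S. finite S \<and> S \<subseteq> C}"
    using countable_Collect_finite_subset[OF \<open>countable C\<close>] .
  ultimately obtain S where S: "finite S" "S \<subseteq> C" "uncountable {a. R a \<in> span S}"
    using uncountable_UNIV_complex countable_UN by (metis (no_types, lifting) mem_Collect_eq)
  then have "infinite {a. R a \<in> span S}"
    using countable_finite by blast
  then obtain A where A: "finite A" "card A = Suc (card S)" "A \<subseteq> {a. R a \<in> span S}"
    using infinite_arbitrarily_large by blast
  have "inj R"
  proof (rule injI)
    fix a b assume "R a = R b"
    then have "f (R a) - scale a (R a) = f (R a) - scale b (R a)"
      using R[of a] R[of b] by simp
    then have "scale (a - b) (R a) = 0"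
      by (simp only: scale_left_diff_distrib) simp
    moreover have "R a \<noteq> 0"
      using R[of a] \<open>v \<noteq> 0\<close> f.zero by auto
    ultimately have "a - b = 0"
      by (metis scale_eq_0_iff)
    then show "a = b"
      by simp
  qed
  then have inj_A: "inj_on R A"
    by (rule inj_on_subset) simp
  have "dependent (R ` A)"
    using independent_span_bound[of S "R ` A"] S(1) A inj_A by (auto simp: card_image)
  then obtain u where u: "\<exists>a\<in>A. u (R a) \<noteq> 0" "(\<Sum>a\<in>A. scale (u (R a)) (R a)) = 0"
    using A(1) inj_A by (auto simp: dependent_finite sum.reindex)
  \<comment> \<open>A relation between the resolvents (f - a)^-1 v is multiplied by the common
    denominator \<open>N A\<close>; \<open>Q\<close> is the numerator of the corresponding sum of
    fractions u(R a) / (X - a).\<close>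
  define N where "N = (\<lambda>B. \<Prod>b\<in>B. [:-b, 1:] :: complex poly)"
  define Q where "Q = (\<Sum>a\<in>A. Polynomial.smult (u (R a)) (N (A - {a})))"
  have v: "poly_op f (N (A - {a})) v = poly_op f (N A) (R a)" if "a \<in> A" for a
  proof -
    have "N A = N (A - {a}) * [:-a, 1:]"
      unfolding N_def using prod.remove[OF A(1) that, of "\<lambda>b. [:-b, 1:]"]
      by (simp only: mult.commute)
    moreover have "poly_op f [:-a, 1:] (R a) = v"
      using R[of a] f by (simp add: f.zero)
    ultimately show ?thesis
      by (metis poly_op_mult[OF f])
  qed
  interpret N: Vector_Spaces.linear scale scale "poly_op f (N A)"
    using f by (rule linear_poly_op)
  have "poly_op f Q v = (\<Sum>a\<in>A. scale (u (R a)) (poly_op f (N A) (R a)))"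
    unfolding Q_def by (simp add: poly_op_sum[OF f] poly_op_smult[OF f] v)
  also have "\<dots> = poly_op f (N A) (\<Sum>a\<in>A. scale (u (R a)) (R a))"
    by (simp add: N.sum N.scale)
  also have "\<dots> = 0"
    using u(2) by (simp add: N.zero)
  finally have "Q = 0"
    using inj \<open>v \<noteq> 0\<close> by blast
  obtain a where a: "a \<in> A" "u (R a) \<noteq> 0"
    using u(1) by blast
  \<comment> \<open>At \<open>a\<close> all summands of \<open>Q\<close> vanish except the one of
    index \<open>a\<close>, so \<open>Q\<close> cannot be zero.\<close>
  have "Polynomial.poly (N (A - {b})) a = 0" if "b \<in> A - {a}" for b
    using that A(1) a(1) by (auto simp: N_def poly_prod)
  then have "Polynomial.poly Q a = u (R a) * Polynomial.poly (N (A - {a})) a"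
    unfolding Q_def
    by (simp add: poly_sum sum.remove[OF A(1) a(1), of "\<lambda>b. u (R b) * Polynomial.poly (N (A - {b})) a"])
  moreover have "Polynomial.poly (N (A - {a})) a \<noteq> 0"
    using A(1) by (auto simp: N_def poly_prod)
  ultimately show False
    using a(2) \<open>Q = 0\<close> by simp
qed

end

section \<open>Irreducible representations of class-two groups\<close>

text \<open>The algebraic part of \<open>smooth_rep\<close>. Smoothness returns only as
  \<open>finite_orbit\<close> in \<open>class_two_representation\<close>.\<close>

locale representation = group G for G :: "'g monoid" (structure) +
  fixes \<rho> :: "('g, 'v::ab_group_add) rep"
  assumes vector_space_scal: "vector_space (scal \<rho>)"
    and linear_act: "g \<in> carrier G \<Longrightarrow> Vector_Spaces.linear (scal \<rho>) (scal \<rho>) (act \<rho> g)"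
    and act_one [simp]: "act \<rho> \<one> v = v"
    and act_mult: "g \<in> carrier G \<Longrightarrow> h \<in> carrier G \<Longrightarrow> act \<rho> (g \<otimes> h) v = act \<rho> g (act \<rho> h v)"

sublocale representation \<subseteq> complex_vector_space "scal \<rho>"
  by (simp add: complex_vector_space_def vector_space_scal)

context representation
begin

lemma
  assumes "g \<in> carrier G"
  shows act_add: "act \<rho> g (v + w) = act \<rho> g v + act \<rho> g w"
    and act_diff: "act \<rho> g (v - w) = act \<rho> g v - act \<rho> g w"
    and act_scal: "act \<rho> g (scal \<rho> a v) = scal \<rho> a (act \<rho> g v)"
    and act_zero [simp]: "act \<rho> g 0 = 0"
proof -
  interpret g: Vector_Spaces.linear "scal \<rho>" "scal \<rho>" "act \<rho> g"
    using assms by (rule linear_act)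
  show "act \<rho> g (v + w) = act \<rho> g v + act \<rho> g w" "act \<rho> g (v - w) = act \<rho> g v - act \<rho> g w"
    "act \<rho> g (scal \<rho> a v) = scal \<rho> a (act \<rho> g v)" "act \<rho> g 0 = 0"
    by (simp_all add: g.add g.diff g.scale g.zero)
qed

lemma
  assumes "g \<in> carrier G"
  shows act_inv_act [simp]: "act \<rho> (inv g) (act \<rho> g v) = v"
    and act_act_inv [simp]: "act \<rho> g (act \<rho> (inv g) v) = v"
  using assms by (simp_all flip: act_mult)

lemma act_eq_0_iff [simp]: "g \<in> carrier G \<Longrightarrow> act \<rho> g v = 0 \<longleftrightarrow> v = 0"
  by (metis act_inv_act act_zero inv_closed)

lemma act_pow: "g \<in> carrier G \<Longrightarrow> act \<rho> (g [^] (k::nat)) v = (act \<rho> g ^^ k) v"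
proof (induction k arbitrary: v)
  case (Suc k)
  then show ?case
    by (simp add: act_mult funpow_swap1)
qed simp

lemma subspace_act_image:
  assumes "g \<in> carrier G" "subspace W"
  shows "subspace (act \<rho> g ` W)"
proof -
  interpret g: Vector_Spaces.linear "scal \<rho>" "scal \<rho>" "act \<rho> g"
    using assms(1) by (rule linear_act)
  show ?thesis
    using assms(2) by (rule g.subspace_image)
qed

lemma act_span:
  assumes "g \<in> carrier G" "\<And>b. b \<in> B \<Longrightarrow> act \<rho> g b \<in> span B'" "w \<in> span B"
  shows "act \<rho> g w \<in> span B'"
proof -
  interpret g: Vector_Spaces.linear "scal \<rho>" "scal \<rho>" "act \<rho> g"
    using assms(1) by (rule linear_act)
  have "act \<rho> g ` span B = span (act \<rho> g ` B)"
    by (rule g.span_image[symmetric])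
  also have "\<dots> \<subseteq> span B'"
    using assms(2) by (intro span_minimal) auto
  finally show ?thesis
    using assms(3) by blast
qed

text \<open>Restriction replaces the carrier and keeps the operations, exactly as
  \<open>cover0\<close> does, so that the results below specialize by folding
  \<open>cover0_def\<close>.\<close>

abbreviation invariant :: "'g set \<Rightarrow> 'v set \<Rightarrow> bool" where
  "invariant S W \<equiv> invariant_subspace (G\<lparr>carrier := S\<rparr>) \<rho> W"

lemma invariant_iff: "invariant S W \<longleftrightarrow> subspace W \<and> (\<forall>g\<in>S. \<forall>w\<in>W. act \<rho> g w \<in> W)"
  by (simp add: invariant_subspace_def)

end

locale irreducible_representation = representation +
  assumes nontrivial: "\<exists>v::'b. v \<noteq> 0"
    and irreducible: "invariant_subspace G \<rho> W \<Longrightarrow> W = {0} \<or> W = UNIV"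
begin

lemma subspace_eq_UNIV:
  assumes "subspace W" "\<And>g w. g \<in> carrier G \<Longrightarrow> w \<in> W \<Longrightarrow> act \<rho> g w \<in> W" "w \<in> W" "w \<noteq> 0"
  shows "W = UNIV"
proof -
  have "invariant_subspace G \<rho> W"
    using assms(1,2) by (simp add: invariant_subspace_def)
  then show ?thesis
    using irreducible assms(3,4) by blast
qed

end

text \<open>\<open>commutator\<close> states without inverses that commutators lie in H; this makes
  H normal with abelian quotient, and E supplies generators of that quotient. For the cover, H is
  the preimage of T_0 and E consists of lifts of y(x) with y and x from finite sets.\<close>

locale class_two_pair = group G for G :: "'g monoid" (structure) +
  fixes H E :: "'g set" and n :: nat
  assumes subgroup: "subgroup H G"
    and commutator: "g \<in> carrier G \<Longrightarrow> h \<in> carrier G \<Longrightarrow> \<exists>k\<in>H. g \<otimes> h = h \<otimes> g \<otimes> k"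
    and power_central: "g \<in> carrier G \<Longrightarrow> h \<in> carrier G \<Longrightarrow> g [^] n \<otimes> h = h \<otimes> g [^] n"
    and n_pos: "n > 0"
    and finite_E: "finite E" and E_subset: "E \<subseteq> carrier G"
    and generated: "carrier G \<subseteq> generate G (H \<union> E)"
begin

lemma H_closed [simp]: "h \<in> H \<Longrightarrow> h \<in> carrier G"
  using subgroup by (rule subgroup.mem_carrier)

lemma H_inv: "h \<in> H \<Longrightarrow> inv h \<in> H"
  using subgroup by (rule subgroup.m_inv_closed)

lemma carrier_induct [consumes 1, case_names H E inv mult]:
  assumes "g \<in> carrier G"
    and "\<And>h. h \<in> H \<Longrightarrow> P h" "\<And>x. x \<in> E \<Longrightarrow> P x" "\<And>x. x \<in> E \<Longrightarrow> P (inv x)"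
    and "\<And>g h. g \<in> carrier G \<Longrightarrow> h \<in> carrier G \<Longrightarrow> P g \<Longrightarrow> P h \<Longrightarrow> P (g \<otimes> h)"
  shows "P g"
proof -
  have sub: "H \<union> E \<subseteq> carrier G"
    using E_subset by auto
  have "g \<in> generate G (H \<union> E)"
    using assms(1) generated by blast
  then show ?thesis
  proof (induction rule: generate.induct)
    case one
    then show ?case
      using assms(2) subgroup.one_closed[OF subgroup] by blast
  next
    case (incl h)
    then show ?case
      using assms(2,3) by blast
  next
    case (inv h)
    then show ?case
      using assms(2,4) H_inv by blast
  next
    case (eng h1 h2)
    then show ?case
      using assms(5) generate_in_carrier[OF sub] by blast
  qed
qed

text \<open>Normality of H: moving \<open>h\<close> past \<open>g\<close> multiplies it by a
  commutator, which already lies in H.\<close>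

lemma conj_H: "g \<in> carrier G \<Longrightarrow> h \<in> H \<Longrightarrow> \<exists>k\<in>H. h \<otimes> g = g \<otimes> k"
proof -
  assume g: "g \<in> carrier G" and h: "h \<in> H"
  then obtain k where k: "k \<in> H" "h \<otimes> g = g \<otimes> h \<otimes> k"
    using commutator[of h g] by auto
  then have "h \<otimes> k \<in> H" "h \<otimes> g = g \<otimes> (h \<otimes> k)"
    using g h subgroup.m_closed[OF subgroup] by (auto simp: m_assoc)
  then show ?thesis
    by blast
qed

end

text \<open>\<open>finite_orbit\<close> is what smoothness and compactness of T_0 give together: the
  open stabilizer of \<open>v\<close> has finite index in H.\<close>

locale class_two_representation =
  class_two_pair G H E n + irreducible_representation G \<rho>
  for G :: "'g monoid" (structure) and H E n and \<rho> :: "('g, 'v::ab_group_add) rep" +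
  assumes finite_orbit: "finite ((\<lambda>h. act \<rho> h v) ` H)"
begin

text \<open>Inverses of E are included because a set stable under an operator need not be stable
  under its inverse.\<close>

definition gens :: "'g set" where
  "gens = H \<union> (E \<union> m_inv G ` E)"

lemma act_closed_if_gens:
  assumes "\<And>g w. g \<in> gens \<Longrightarrow> w \<in> W \<Longrightarrow> act \<rho> g w \<in> W" "g \<in> carrier G" "w \<in> W"
  shows "act \<rho> g w \<in> W"
  using assms(2,3)
proof (induction g arbitrary: w rule: carrier_induct)
  case (mult g h)
  then show ?case
    by (simp add: act_mult)
qed (use assms(1) in \<open>auto simp: gens_def\<close>)

text \<open>\<open>step\<close> adds the images under all generators. Finite orbits keep every stage
  finite, so the union of the stages is countable; its span is stable under G, hence
  everything.\<close>

lemma countable_spanning: "\<exists>C. countable C \<and> span C = UNIV"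
proof -
  obtain v :: 'v where "v \<noteq> 0"
    using nontrivial by blast
  define step where "step D = D \<union> (\<Union>w\<in>D. (\<lambda>g. act \<rho> g w) ` gens)" for D
  have "finite ((\<lambda>g. act \<rho> g w) ` gens)" for w
    using finite_orbit[of w] finite_E by (simp add: gens_def image_Un)
  then have "finite ((step ^^ k) {v})" for k
    by (induction k) (auto simp: step_def)
  then have "countable (\<Union>k. (step ^^ k) {v})" (is "countable ?C")
    by (auto intro: countable_finite)
  have gens: "act \<rho> g w \<in> ?C" if g: "g \<in> gens" and w: "w \<in> ?C" for g w
  proof -
    obtain k where "w \<in> (step ^^ k) {v}"
      using w by blast
    then have "act \<rho> g w \<in> (step ^^ Suc k) {v}"
      using g by (auto simp: step_def)
    then show ?thesis
      by blast
  qed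
  have "v \<in> ?C"
    by (rule UN_I[of 0]) simp_all
  have "span ?C = UNIV"
  proof (rule subspace_eq_UNIV[of _ v])
    show "act \<rho> g w \<in> span ?C" if "g \<in> carrier G" "w \<in> span ?C" for g w
      using that(1) _ that(2)
      by (rule act_span) (use act_closed_if_gens[OF gens that(1)] in \<open>blast intro: span_base\<close>)
    show "v \<in> span ?C"
      using \<open>v \<in> ?C\<close> by (rule span_base)
  qed (use \<open>v \<noteq> 0\<close> in auto)
  then show ?thesis
    using \<open>countable ?C\<close> by blast
qed

text \<open>Schur's lemma, by a dichotomy on a fixed nonzero vector \<open>v\<close>. If
  \<open>v\<close> is in the range of z - a for every a, countable dimension yields an eigenvalue,
  and its eigenspace is invariant. Otherwise the range of some z - a misses \<open>v\<close>; being
  invariant, it is zero.\<close>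

lemma central_scalar:
  assumes z: "z \<in> carrier G" and central: "\<And>g. g \<in> carrier G \<Longrightarrow> z \<otimes> g = g \<otimes> z"
  shows "\<exists>a. \<forall>v. act \<rho> z v = scal \<rho> a v"
proof -
  have comm: "act \<rho> z (act \<rho> g w) = act \<rho> g (act \<rho> z w)" if "g \<in> carrier G" for g w
    using central[OF that] z that by (metis act_mult)
  obtain C where C: "countable C" "span C = UNIV"
    using countable_spanning by blast
  obtain v :: 'v where v: "v \<noteq> 0"
    using nontrivial by blast
  show ?thesis
  proof (cases "\<forall>a. v \<in> range (\<lambda>w. act \<rho> z w - scal \<rho> a w)")
    case True
    then obtain a w where w: "w \<noteq> 0" "act \<rho> z w = scal \<rho> a w"
      using countable_dimension_eigenvalue[OF linear_act[OF z] C v] by blast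
    have "{w. act \<rho> z w = scal \<rho> a w} = UNIV"
    proof (rule subspace_eq_UNIV)
      show "subspace {w. act \<rho> z w = scal \<rho> a w}"
        using z by (auto intro!: subspaceI simp: act_add act_scal algebra_simps)
    qed (use w in \<open>auto simp: comm act_scal\<close>)
    then show ?thesis
      by blast
  next
    case False
    then obtain a where a: "v \<notin> range (\<lambda>w. act \<rho> z w - scal \<rho> a w)"
      by blast
    have "act \<rho> z w - scal \<rho> a w = 0" for w
    proof (rule ccontr)
      assume "act \<rho> z w - scal \<rho> a w \<noteq> 0"
      then have "range (\<lambda>w. act \<rho> z w - scal \<rho> a w) = UNIV"
      proof (rule subspace_eq_UNIV[rotated 3])
        show "subspace (range (\<lambda>w. act \<rho> z w - scal \<rho> a w))"
        proof (rule subspaceI)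
          show "0 \<in> range (\<lambda>w. act \<rho> z w - scal \<rho> a w)"
            using z by (auto intro!: range_eqI[of _ _ 0])
        next
          fix x y assume "x \<in> range (\<lambda>w. act \<rho> z w - scal \<rho> a w)"
            "y \<in> range (\<lambda>w. act \<rho> z w - scal \<rho> a w)"
          then obtain u w where xy: "x = act \<rho> z u - scal \<rho> a u" "y = act \<rho> z w - scal \<rho> a w"
            by blast
          then show "x + y \<in> range (\<lambda>w. act \<rho> z w - scal \<rho> a w)"
            unfolding xy using z by (intro range_eqI[of _ _ "u + w"]) (simp add: act_add algebra_simps)
        next
          fix b x assume "x \<in> range (\<lambda>w. act \<rho> z w - scal \<rho> a w)"
          then obtain u where x: "x = act \<rho> z u - scal \<rho> a u"
            by blast
          show "scal \<rho> b x \<in> range (\<lambda>w. act \<rho> z w - scal \<rho> a w)"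
            unfolding x using z by (intro range_eqI[of _ _ "scal \<rho> b u"]) (simp add: act_scal algebra_simps)
        qed
        fix g x assume g: "g \<in> carrier G" and "x \<in> range (\<lambda>w. act \<rho> z w - scal \<rho> a w)"
        then obtain u where x: "x = act \<rho> z u - scal \<rho> a u"
          by blast
        show "act \<rho> g x \<in> range (\<lambda>w. act \<rho> z w - scal \<rho> a w)"
          unfolding x using g by (intro range_eqI[of _ _ "act \<rho> g u"]) (simp add: act_diff act_scal comm)
      qed simp
      then show False
        using a by blast
    qed
    then show ?thesis
      by auto
  qed
qed

lemma power_scalar: "x \<in> carrier G \<Longrightarrow> \<exists>a. \<forall>v. act \<rho> (x [^] n) v = scal \<rho> a v"
  using central_scalar[of "x [^] n"] power_central by simp

text \<open>A finite-dimensional H-stable space containing \<open>v\<close> is enlarged by one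
  generator x at a time, keeping the stability already reached. As x^n acts by a scalar, the
  translates by x^j with j < n are enough.\<close>

lemma finite_spanning: "\<exists>B. finite B \<and> span B = UNIV"
proof -
  obtain v :: 'v where "v \<noteq> 0"
    using nontrivial by blast
  have extend: "\<exists>B. finite B \<and> v \<in> span B \<and> (\<forall>g\<in>H \<union> Z. \<forall>w\<in>span B. act \<rho> g w \<in> span B)"
    if "finite Z" "Z \<subseteq> carrier G" for Z
    using that
  proof (induction Z rule: finite_induct)
    case empty
    let ?B = "(\<lambda>h. act \<rho> h v) ` H"
    have orbit: "act \<rho> h b \<in> ?B" if h: "h \<in> H" and b: "b \<in> ?B" for h b
    proof -
      obtain k where "k \<in> H" "b = act \<rho> k v"
        using b by blast
      then have "act \<rho> h b = act \<rho> (h \<otimes> k) v" "h \<otimes> k \<in> H"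
        using h subgroup.m_closed[OF subgroup] by (simp_all add: act_mult)
      then show ?thesis
        by blast
    qed
    have "act \<rho> h w \<in> span ?B" if "h \<in> H" "w \<in> span ?B" for h w
      using act_span[OF H_closed[OF that(1)] span_base[OF orbit[OF that(1)]] that(2)] .
    moreover have "v \<in> ?B"
      by (rule image_eqI[of _ _ \<one>]) (use subgroup.one_closed[OF subgroup] in auto)
    ultimately show ?case
      using finite_orbit by (intro exI[of _ ?B]) (auto intro: span_base)
  next
    case (insert x Z)
    then have x: "x \<in> carrier G"
      by simp
    obtain B where B: "finite B" "v \<in> span B"
      and B_inv: "\<And>g w. g \<in> H \<union> Z \<Longrightarrow> w \<in> span B \<Longrightarrow> act \<rho> g w \<in> span B"
      using insert by auto
    define B' where "B' = (\<Union>j<n. act \<rho> (x [^] j) ` B)"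
    have span_B': "act \<rho> (x [^] j) w \<in> span B'" if "j < n" "w \<in> span B" for j w
      using nat_pow_closed[OF x] _ that(2)
      by (rule act_span) (use that(1) in \<open>auto simp: B'_def intro: span_base\<close>)
    have "v \<in> span B'"
      using span_B'[of 0 v] n_pos B(2) by simp
    moreover have "act \<rho> g w \<in> span B'" if g: "g \<in> H \<union> insert x Z" and w: "w \<in> span B'" for g w
    proof -
      have g': "g \<in> carrier G"
        using g insert.prems by auto
      have "act \<rho> g b' \<in> span B'" if b': "b' \<in> B'" for b'
      proof -
        obtain j b where j: "j < n" and b: "b \<in> B" "b' = act \<rho> (x [^] j) b"
          using b' by (auto simp: B'_def)
        consider "g = x" "Suc j < n" | "g = x" "Suc j = n" | "g \<in> H \<union> Z"
          using g j by force
        then show ?thesis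
        proof cases
          case 1
          then have "act \<rho> g b' = act \<rho> (x [^] Suc j) b"
            using b x by (metis act_pow funpow.simps(2) o_apply)
          then show ?thesis
            using span_B'[of "Suc j" b] 1 b(1) by (simp add: span_base)
        next
          \<comment> \<open>The exponent wraps around: x^n acts by a scalar, and \<open>b\<close>
            itself is in \<open>B'\<close> as its translate for j = 0.\<close>
          case 2
          then have "act \<rho> g b' = act \<rho> (x [^] n) b"
            using b x by (metis act_pow funpow.simps(2) o_apply)
          moreover obtain a where "\<forall>v. act \<rho> (x [^] n) v = scal \<rho> a v"
            using power_scalar[OF x] by blast
          moreover have "b \<in> span B'"
            using span_B'[of 0 b] n_pos b(1) by (simp add: span_base)
          ultimately show ?thesis
            by (simp add: span_scale)
        next
          \<comment> \<open>Moving \<open>g\<close> past x^j costs an element \<open>k\<close> of H,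
            and \<open>span B\<close> is stable under both.\<close>
          case 3
          obtain k where k: "k \<in> H" "g \<otimes> x [^] j = x [^] j \<otimes> g \<otimes> k"
            using commutator[OF g' nat_pow_closed[OF x]] by blast
          have "act \<rho> g b' = act \<rho> (g \<otimes> x [^] j) b"
            using b(2) g' x by (simp add: act_mult)
          also have "\<dots> = act \<rho> (x [^] j) (act \<rho> g (act \<rho> k b))"
            using k g' x by (simp add: act_mult)
          finally have "act \<rho> g b' = act \<rho> (x [^] j) (act \<rho> g (act \<rho> k b))" .
          moreover have "act \<rho> g (act \<rho> k b) \<in> span B"
            using 3 k(1) b(1) by (intro B_inv) (auto intro: span_base)
          ultimately show ?thesis
            using span_B'[OF j] by simp
        qed
      qed
      then show ?thesis
        using g' w by (blast intro: act_span)
    qed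
    moreover have "finite B'"
      using B(1) by (simp add: B'_def)
    ultimately show ?case
      by blast
  qed
  have "finite (E \<union> m_inv G ` E)" "E \<union> m_inv G ` E \<subseteq> carrier G"
    using finite_E E_subset by auto
  from extend[OF this] obtain B where B: "finite B" "v \<in> span B"
    and "\<And>g w. g \<in> gens \<Longrightarrow> w \<in> span B \<Longrightarrow> act \<rho> g w \<in> span B"
    unfolding gens_def by metis
  then have "span B = UNIV"
    using \<open>v \<noteq> 0\<close> act_closed_if_gens[of "span B"] by (intro subspace_eq_UNIV[of _ v]) auto
  with B(1) show ?thesis
    by blast
qed

end

section \<open>Clifford theory: the restriction to H is semisimple\<close>

context class_two_representation
begin

text \<open>Clifford theory: for an irreducible \<open>H\<close>-submodule \<open>L\<close> the translates \<open>gL\<close> are irreducible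
  \<open>H\<close>-submodules with sum the whole space.\<close>
lemma H_complement:
  assumes W: "invariant H W"
  shows "\<exists>C. invariant H C \<and> W \<inter> C = {0} \<and> (\<forall>v. \<exists>w\<in>W. \<exists>c\<in>C. v = w + c)"
proof -
  obtain B0 where "finite B0" "span B0 = UNIV"
    using finite_spanning by metis
  moreover obtain B where B: "independent B" "UNIV \<subseteq> span B"
    by (rule basis_exists[of UNIV])
  ultimately have "finite B"
    using independent_span_bound[of B0 B] by simp
  interpret fd: finite_dimensional_vector_space "scal \<rho>" B
    by standard (use \<open>finite B\<close> B in auto)
  have grow: "S = T" if "subspace S" "subspace T" "S \<subseteq> T" "dim T \<le> dim S" for S T
    using that by (rule fd.subspace_dim_equal)
  define P where "P W \<longleftrightarrow> invariant H W \<and> W \<noteq> {0}" for W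
  have "P UNIV"
    using nontrivial by (auto simp: P_def invariant_iff)
  \<comment> \<open>Minimal dimension among the nonzero H-stable subspaces makes \<open>L\<close>
    irreducible.\<close>
  then obtain L where L: "P L" "\<And>U. P U \<Longrightarrow> dim L \<le> dim U"
    using ex_has_least_nat[of P UNIV dim] by blast
  have L_irreducible: "U = {0} \<or> U = L" if "invariant H U" "U \<subseteq> L" for U
    using grow[of U L] L that by (auto simp: P_def invariant_iff)
  define gL where "gL g = act \<rho> g ` L" for g
  have gL: "invariant H (gL g)" if g: "g \<in> carrier G" for g
    unfolding invariant_iff
  proof (intro conjI ballI)
    show "subspace (gL g)"
      using g L(1) by (auto simp: gL_def P_def invariant_iff intro: subspace_act_image)
    fix h w assume h: "h \<in> H" and "w \<in> gL g"
    then obtain u where u: "u \<in> L" "w = act \<rho> g u"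
      by (auto simp: gL_def)
    obtain k where k: "k \<in> H" "h \<otimes> g = g \<otimes> k"
      using conj_H[OF g h] by blast
    have "act \<rho> h w = act \<rho> (h \<otimes> g) u"
      using u g h by (simp add: act_mult)
    also have "\<dots> = act \<rho> g (act \<rho> k u)"
      using k g by (simp add: act_mult)
    finally show "act \<rho> h w \<in> gL g"
      using L(1) k(1) u(1) by (auto simp: gL_def P_def invariant_iff)
  qed
  have gL_irreducible: "U = {0} \<or> U = gL g"
    if g: "g \<in> carrier G" and U: "invariant H U" "U \<subseteq> gL g" for U g
  proof -
    \<comment> \<open>Since H is normal, pulling \<open>U\<close> back by g^-1 gives an H-stable
      subspace of \<open>L\<close>.\<close>
    let ?U = "act \<rho> (inv g) ` U"
    have "invariant H ?U"
      unfolding invariant_iff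
    proof (intro conjI ballI)
      show "subspace ?U"
        using g U(1) by (auto simp: invariant_iff intro: subspace_act_image)
      fix h w assume h: "h \<in> H" and "w \<in> ?U"
      then obtain u where u: "u \<in> U" "w = act \<rho> (inv g) u"
        by auto
      obtain k where k: "k \<in> H" "h \<otimes> inv g = inv g \<otimes> k"
        using conj_H[OF inv_closed[OF g] h] by blast
      have "act \<rho> h w = act \<rho> (h \<otimes> inv g) u"
        using u g h by (simp add: act_mult)
      also have "\<dots> = act \<rho> (inv g) (act \<rho> k u)"
        using k g by (simp add: act_mult)
      finally show "act \<rho> h w \<in> ?U"
        using U(1) k(1) u(1) by (auto simp: invariant_iff)
    qed
    moreover have "?U \<subseteq> L"
      using U(2) g by (auto simp: gL_def)
    ultimately have "?U = {0} \<or> ?U = L"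
      by (rule L_irreducible)
    moreover have "U = act \<rho> g ` ?U"
      using g by (auto simp: image_image)
    ultimately show ?thesis
      using g by (metis act_zero gL_def image_empty image_insert)
  qed
  define Q where "Q C \<longleftrightarrow> invariant H C \<and> W \<inter> C = {0}" for C
  have "Q {0}"
    using W by (auto simp: Q_def invariant_iff subspace_0)
  moreover have "dim C \<le> dim UNIV" for C
    by (rule fd.dim_subset) simp
  \<comment> \<open>\<open>C\<close> has maximal dimension among the H-stable subspaces meeting
    \<open>W\<close> trivially; what remains is that W + C is everything.\<close>
  ultimately obtain C where C: "Q C" "\<And>C'. Q C' \<Longrightarrow> dim C' \<le> dim C"
    using ex_has_greatest_nat[of Q "{0}" dim "Suc (dim UNIV)"] by (auto simp: less_Suc_eq_le)
  define M where "M = {w + c | w c. w \<in> W \<and> c \<in> C}"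
  have sub: "subspace W" "subspace C"
    using W C(1) by (auto simp: Q_def invariant_iff)
  have M_sub: "subspace M"
    unfolding M_def by (rule subspace_sums[OF sub])
  have M: "invariant H M"
    unfolding invariant_iff
  proof (intro conjI ballI M_sub)
    fix h m assume h: "h \<in> H" and "m \<in> M"
    then obtain w c where "w \<in> W" "c \<in> C" "m = w + c"
      by (auto simp: M_def)
    moreover from this have "act \<rho> h w \<in> W" "act \<rho> h c \<in> C"
      using W C(1) h by (auto simp: Q_def invariant_iff)
    ultimately show "act \<rho> h m \<in> M"
      using h by (auto simp: M_def act_add)
  qed
  have C_M: "C \<subseteq> M"
    using subspace_0[OF sub(1)] by (force simp: M_def)
  have W_M: "W \<subseteq> M"
    using subspace_0[OF sub(2)] by (force simp: M_def)
  \<comment> \<open>Otherwise irreducibility makes gL meet \<open>M\<close> trivially, and then C +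
    gL still meets \<open>W\<close> trivially: if x = c + u is in \<open>W\<close>, then u = x - c
    is in \<open>M\<close>, so u = 0. This contradicts the maximality of \<open>C\<close>.\<close>
  have gL_M: "gL g \<subseteq> M" if g: "g \<in> carrier G" for g
  proof (rule ccontr)
    assume not: "\<not> gL g \<subseteq> M"
    have "invariant H (gL g \<inter> M)"
      using gL[OF g] M by (auto simp: invariant_iff intro: subspace_inter)
    then have Int: "gL g \<inter> M = {0}"
      using gL_irreducible[OF g, of "gL g \<inter> M"] not by blast
    define C' where "C' = {c + u | c u. c \<in> C \<and> u \<in> gL g}"
    have sub_gL: "subspace (gL g)"
      using gL[OF g] by (simp add: invariant_iff)
    have C'_sub: "subspace C'"
      unfolding C'_def by (rule subspace_sums[OF sub(2) sub_gL])
    have "invariant H C'"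
      unfolding invariant_iff
    proof (intro conjI ballI C'_sub)
      fix h m assume h: "h \<in> H" and "m \<in> C'"
      then obtain c u where "c \<in> C" "u \<in> gL g" "m = c + u"
        by (auto simp: C'_def)
      moreover from this have "act \<rho> h c \<in> C" "act \<rho> h u \<in> gL g"
        using gL[OF g] C(1) h by (auto simp: Q_def invariant_iff)
      ultimately show "act \<rho> h m \<in> C'"
        using h by (auto simp: C'_def act_add)
    qed
    moreover have "x = 0" if "x \<in> W" "x \<in> C'" for x
    proof -
      obtain c u where cu: "c \<in> C" "u \<in> gL g" "x = c + u"
        using \<open>x \<in> C'\<close> by (auto simp: C'_def)
      then have "u = x - c"
        by simp
      then have "u \<in> M"
        using cu \<open>x \<in> W\<close> C_M W_M M_sub subspace_diff by blast
      then have "u = 0"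
        using cu(2) Int by blast
      then have "x \<in> W \<inter> C"
        using cu \<open>x \<in> W\<close> by simp
      then show "x = 0"
        using C(1) by (auto simp: Q_def)
    qed
    moreover have "0 \<in> W \<inter> C'"
      using sub(1) C'_sub by (simp add: subspace_0)
    ultimately have "Q C'"
      unfolding Q_def by blast
    moreover have "C \<subseteq> C'"
      using subspace_0[OF sub_gL] by (force simp: C'_def)
    ultimately have "C' = C"
      using grow[OF sub(2) C'_sub] C(2) by blast
    moreover have "gL g \<subseteq> C'"
      using subspace_0[OF sub(2)] by (force simp: C'_def)
    ultimately show False
      using C_M not by blast
  qed
  let ?N = "span (\<Union>g\<in>carrier G. gL g)"
  obtain u where u: "u \<in> L" "u \<noteq> 0"
    using L(1) by (auto simp: P_def invariant_iff dest: subspace_0)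
  have "?N = UNIV"
  proof (rule subspace_eq_UNIV)
    show "act \<rho> g w \<in> ?N" if g: "g \<in> carrier G" and w: "w \<in> ?N" for g w
    proof (rule act_span[OF g _ w])
      fix b assume "b \<in> (\<Union>g\<in>carrier G. gL g)"
      then obtain h l where hl: "h \<in> carrier G" "l \<in> L" "b = act \<rho> h l"
        by (auto simp: gL_def)
      then have "act \<rho> g b = act \<rho> (g \<otimes> h) l" "g \<otimes> h \<in> carrier G"
        using g by (simp_all add: act_mult)
      then have "act \<rho> g b \<in> (\<Union>g\<in>carrier G. gL g)"
        using hl(2) by (auto simp: gL_def)
      then show "act \<rho> g b \<in> ?N"
        by (rule span_base)
    qed
    have "u \<in> gL \<one>"
      using u(1) by (auto simp: gL_def)
    then show "u \<in> ?N"
      by (intro span_base) blast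
  qed (use u in auto)
  moreover have "?N \<subseteq> M"
    using gL_M M_sub by (intro span_minimal) auto
  ultimately have "M = UNIV"
    by blast
  then have "\<forall>v. \<exists>w\<in>W. \<exists>c\<in>C. v = w + c"
    unfolding M_def by blast
  then show ?thesis
    using C(1) unfolding Q_def by blast
qed

end

context class_two_representation
begin

text \<open>The projection along an H-stable complement. Uniqueness of the decomposition, in the
  form \<open>pr_eq\<close>, makes the chosen function linear and H-equivariant.\<close>

lemma H_projection:
  assumes W: "invariant H W"
  shows "\<exists>pr. intertwines_on (G\<lparr>carrier := H\<rparr>) \<rho> UNIV \<rho> pr \<and> (\<forall>v. pr v \<in> W) \<and> (\<forall>w\<in>W. pr w = w)"
proof -
  obtain C where C: "invariant H C" "W \<inter> C = {0}" and ex: "\<exists>w\<in>W. \<exists>c\<in>C. v = w + c" for v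
    using H_complement[OF W] by blast
  have sub: "subspace W" "subspace C"
    using W C(1) by (simp_all add: invariant_iff)
  from ex have "\<exists>w\<in>W. v - w \<in> C" for v
    by (metis add_diff_cancel_left')
  then obtain pr where pr: "pr v \<in> W" "v - pr v \<in> C" for v
    by metis
  have pr_eq: "pr v = w" if "w \<in> W" "v - w \<in> C" for v w
  proof -
    have "w - pr v = (v - pr v) - (v - w)"
      by simp
    then have "w - pr v \<in> W \<inter> C"
      using that pr[of v] sub by (metis IntI subspace_diff)
    then show ?thesis
      using C(2) by simp
  qed
  show ?thesis
  proof (intro exI[of _ pr] conjI allI ballI)
    have "pr (x + y) = pr x + pr y" for x y
      using pr[of x] pr[of y] sub subspace_add[OF sub(2) pr(2)[of x] pr(2)[of y]]
      by (intro pr_eq) (auto intro: subspace_add simp: algebra_simps)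
    moreover have "pr (scal \<rho> a x) = scal \<rho> a (pr x)" for a x
      using pr[of x] sub subspace_scale[OF sub(2) pr(2)[of x]]
      by (intro pr_eq) (auto intro: subspace_scale simp: algebra_simps)
    moreover have "pr (act \<rho> h x) = act \<rho> h (pr x)" if "h \<in> H" for h x
    proof (rule pr_eq)
      show "act \<rho> h (pr x) \<in> W"
        using W that pr(1) by (simp add: invariant_iff)
      have "act \<rho> h (x - pr x) \<in> C"
        using C(1) that pr(2) by (simp add: invariant_iff)
      then show "act \<rho> h x - act \<rho> h (pr x) \<in> C"
        using that by (simp add: act_diff)
    qed
    ultimately show "intertwines_on (G\<lparr>carrier := H\<rparr>) \<rho> UNIV \<rho> pr"
      by (simp add: intertwines_on_def)
    show "pr v \<in> W" for v
      by (rule pr)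
    show "pr w = w" if "w \<in> W" for w
      using that sub(2) by (intro pr_eq) (simp_all add: subspace_0)
  qed
qed

text \<open>Removing from a preimage under \<open>f\<close> its component in the kernel gives an
  equivariant section; composing \<open>f\<close> with a projection onto \<open>W\<close> extends it
  to the whole space. A subquotient thus becomes a subrepresentation and a quotient.\<close>

lemma H_constituent_splits:
  assumes W: "invariant H W" and f: "intertwines_on (G\<lparr>carrier := H\<rparr>) \<rho> W \<rho>\<^sub>0 f" "f ` W = UNIV"
  shows "contains_rep (G\<lparr>carrier := H\<rparr>) \<rho> \<rho>\<^sub>0"
    and "\<exists>q. intertwines_on (G\<lparr>carrier := H\<rparr>) \<rho> UNIV \<rho>\<^sub>0 q \<and> surj q"
proof -
  have sub: "subspace W"
    using W by (simp add: invariant_iff)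
  have W_act: "act \<rho> h x \<in> W" if "h \<in> H" "x \<in> W" for h x
    using W that by (simp add: invariant_iff)
  have f_add: "f (x + y) = f x + f y" if "x \<in> W" "y \<in> W" for x y
    using f(1) that by (simp add: intertwines_on_def)
  have f_scal: "f (scal \<rho> a x) = scal \<rho>\<^sub>0 a (f x)" if "x \<in> W" for a x
    using f(1) that by (simp add: intertwines_on_def)
  have f_act: "f (act \<rho> h x) = act \<rho>\<^sub>0 h (f x)" if "h \<in> H" "x \<in> W" for h x
    using f(1) that by (simp add: intertwines_on_def)
  have f_0: "f 0 = 0"
    using f_add[of 0 0] subspace_0[OF sub] by simp
  have f_diff: "f (x - y) = f x - f y" if "x \<in> W" "y \<in> W" for x y
    using f_add[of "x - y" y] that subspace_diff[OF sub that] by (simp add: algebra_simps)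
  define K where "K = {w \<in> W. f w = 0}"
  have "invariant H K"
    unfolding invariant_iff
  proof (intro conjI ballI subspaceI)
    show "0 \<in> K"
      using sub by (simp add: K_def f_0 subspace_0)
    show "x + y \<in> K" if "x \<in> K" "y \<in> K" for x y
      using that sub by (simp add: K_def f_add subspace_add)
    show "scal \<rho> a x \<in> K" if "x \<in> K" for a x
      using that sub f_scal[of x a] f_scal[OF subspace_0[OF sub], of a]
      by (simp add: K_def f_0 subspace_scale)
    show "act \<rho> h x \<in> K" if "h \<in> H" "x \<in> K" for h x
      using that W_act f_act[of h x] f_act[OF that(1) subspace_0[OF sub]]
      by (simp add: K_def f_0)
  qed
  then obtain pr where pr: "intertwines_on (G\<lparr>carrier := H\<rparr>) \<rho> UNIV \<rho> pr" "\<And>v. pr v \<in> K"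
    "\<And>v. v \<in> K \<Longrightarrow> pr v = v"
    using H_projection[of K] by blast
  have pr_add: "pr (x + y) = pr x + pr y" and pr_scal: "pr (scal \<rho> a x) = scal \<rho> a (pr x)"
    for a x y
    using pr(1) by (simp_all add: intertwines_on_def)
  have pr_act: "pr (act \<rho> h x) = act \<rho> h (pr x)" if "h \<in> H" for h x
    using pr(1) that by (simp add: intertwines_on_def)
  have pr_diff: "pr (x - y) = pr x - pr y" for x y
    using pr_add[of "x - y" y] by (simp add: algebra_simps)
  have "\<exists>w\<in>W. f w = x" for x
    using f(2) by (metis UNIV_I imageE)
  then obtain s where s: "s x \<in> W" "f (s x) = x" for x
    by metis
  define j where "j x = s x - pr (s x)" for x
  \<comment> \<open>Any preimage \<open>w\<close> may replace the chosen one, since the two differ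
    by an element of the kernel, which \<open>pr\<close> fixes. Linearity and equivariance of
    \<open>j\<close> follow by picking convenient preimages.\<close>
  have j_f: "j (f w) = w - pr w" if "w \<in> W" for w
  proof -
    have "s (f w) - w \<in> K"
      using s[of "f w"] that sub by (simp add: K_def f_diff subspace_diff)
    then have "pr (s (f w)) - pr w = s (f w) - w"
      using pr(3) by (metis pr_diff)
    then show ?thesis
      by (simp add: j_def algebra_simps)
  qed
  have "inj j"
  proof (rule injI)
    fix x y assume "j x = j y"
    moreover have "f (j z) = z" for z
      unfolding j_def using s[of z] pr(2)[of "s z"] by (simp add: K_def f_diff)
    ultimately show "x = y"
      by metis
  qed
  moreover have "intertwines_on (G\<lparr>carrier := H\<rparr>) \<rho>\<^sub>0 UNIV \<rho> j"
    unfolding intertwines_on_def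
  proof (intro conjI ballI allI)
    show "j (x + y) = j x + j y" for x y
      using j_f[of "s x + s y"] s[of x] s[of y] sub
      by (simp add: f_add pr_add subspace_add j_def)
    show "j (scal \<rho>\<^sub>0 a x) = scal \<rho> a (j x)" for a x
      using j_f[of "scal \<rho> a (s x)"] s[of x] sub
      by (simp add: f_scal pr_scal subspace_scale j_def algebra_simps)
    show "j (act \<rho>\<^sub>0 h x) = act \<rho> h (j x)" if "h \<in> carrier (G\<lparr>carrier := H\<rparr>)" for h x
      using j_f[of "act \<rho> h (s x)"] s[of x] sub that W_act
      by (simp add: f_act pr_act act_diff j_def)
  qed
  ultimately show "contains_rep (G\<lparr>carrier := H\<rparr>) \<rho> \<rho>\<^sub>0"
    unfolding contains_rep_def by (intro exI conjI)
  obtain prW where prW: "intertwines_on (G\<lparr>carrier := H\<rparr>) \<rho> UNIV \<rho> prW" "\<And>v. prW v \<in> W"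
    "\<And>v. v \<in> W \<Longrightarrow> prW v = v"
    using H_projection[OF W] by blast
  have "surj (f \<circ> prW)"
    using s prW(3) by (metis comp_apply surjI)
  moreover have "intertwines_on (G\<lparr>carrier := H\<rparr>) \<rho> UNIV \<rho>\<^sub>0 (f \<circ> prW)"
    using prW(1,2) by (simp add: intertwines_on_def f_add f_scal f_act)
  ultimately show "\<exists>q. intertwines_on (G\<lparr>carrier := H\<rparr>) \<rho> UNIV \<rho>\<^sub>0 q \<and> surj q"
    by (intro exI conjI)
qed

end

section \<open>H-intertwiners and the twisting character\<close>

locale class_two_representation_pair =
  \<sigma>: class_two_representation G H E n \<sigma> + \<pi>: class_two_representation G H E n \<pi>
  for G :: "'g monoid" (structure) and H E n
    and \<sigma> :: "('g, 'v::ab_group_add) rep" and \<pi> :: "('g, 'w::ab_group_add) rep"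
begin

text \<open>The ambient space is that of all functions with pointwise operations, and
  Hom_H(\<sigma>, \<pi>) is its subspace \<open>H_Hom\<close>. The operators
  \<open>conj_act g\<close> are then linear on a whole type, and the results on polynomials in an
  operator apply to them.\<close>

definition fun_scal :: "complex \<Rightarrow> ('v \<Rightarrow> 'w) \<Rightarrow> 'v \<Rightarrow> 'w" where
  "fun_scal a \<psi> = (\<lambda>v. scal \<pi> a (\<psi> v))"

sublocale Hom: complex_vector_space fun_scal
  by unfold_locales (auto simp: fun_scal_def fun_eq_iff algebra_simps)

definition conj_act :: "'g \<Rightarrow> ('v \<Rightarrow> 'w) \<Rightarrow> 'v \<Rightarrow> 'w" where
  "conj_act g \<psi> = (\<lambda>v. act \<pi> g (\<psi> (act \<sigma> (inv g) v)))"

lemma linear_conj_act: "g \<in> carrier G \<Longrightarrow> Vector_Spaces.linear fun_scal fun_scal (conj_act g)"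
  by unfold_locales (auto simp: conj_act_def fun_scal_def fun_eq_iff \<pi>.act_add \<pi>.act_scal)

lemma conj_act_fun_scal: "g \<in> carrier G \<Longrightarrow> conj_act g (fun_scal a \<psi>) = fun_scal a (conj_act g \<psi>)"
  by (simp add: conj_act_def fun_scal_def \<pi>.act_scal)

lemma conj_act_mult:
  "g \<in> carrier G \<Longrightarrow> h \<in> carrier G \<Longrightarrow> conj_act (g \<otimes> h) \<psi> = conj_act g (conj_act h \<psi>)"
  by (simp add: conj_act_def \<pi>.act_mult \<sigma>.act_mult \<sigma>.inv_mult_group)

lemma conj_act_one [simp]: "conj_act \<one> \<psi> = \<psi>"
  by (simp add: conj_act_def)

lemma conj_act_inv [simp]: "g \<in> carrier G \<Longrightarrow> conj_act (inv g) (conj_act g \<psi>) = \<psi>"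
  by (simp flip: conj_act_mult)

lemma conj_act_pow: "g \<in> carrier G \<Longrightarrow> conj_act (g [^] (k::nat)) \<psi> = (conj_act g ^^ k) \<psi>"
proof (induction k arbitrary: \<psi>)
  case (Suc k)
  then show ?case
    by (simp add: conj_act_mult funpow_swap1)
qed simp

text \<open>Equivariance under H is put as invariance under \<open>conj_act\<close>, so that H acts
  trivially by definition and G acts through the abelian quotient G/H.\<close>

definition H_Hom :: "('v \<Rightarrow> 'w) set" where
  "H_Hom = {\<psi>. Vector_Spaces.linear (scal \<sigma>) (scal \<pi>) \<psi> \<and> (\<forall>h\<in>H. conj_act h \<psi> = \<psi>)}"

lemma linear_iff:
  "Vector_Spaces.linear (scal \<sigma>) (scal \<pi>) \<psi> \<longleftrightarrow>
     (\<forall>x y. \<psi> (x + y) = \<psi> x + \<psi> y) \<and> (\<forall>a x. \<psi> (scal \<sigma> a x) = scal \<pi> a (\<psi> x))"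
  using \<sigma>.vector_space_axioms \<pi>.vector_space_axioms
  by (auto simp: linear_iff_module_hom module_hom_iff module_iff_vector_space)

lemma subspace_H_Hom: "Hom.subspace H_Hom"
proof (rule Hom.subspaceI)
  show "0 \<in> H_Hom"
    by (simp add: H_Hom_def linear_iff conj_act_def fun_eq_iff)
  show "\<phi> + \<psi> \<in> H_Hom" if "\<phi> \<in> H_Hom" "\<psi> \<in> H_Hom" for \<phi> \<psi>
    using that by (simp add: H_Hom_def linear_iff conj_act_def fun_eq_iff \<pi>.act_add algebra_simps)
  show "fun_scal a \<psi> \<in> H_Hom" if "\<psi> \<in> H_Hom" for a \<psi>
    using that by (simp add: H_Hom_def linear_iff conj_act_def fun_eq_iff fun_scal_def \<pi>.act_scal
        algebra_simps)
qed

text \<open>gh and hg differ by an element of H, which acts trivially on \<open>H_Hom\<close>. On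
  arbitrary functions the two operators need not commute.\<close>

lemma conj_act_commute:
  assumes "g \<in> carrier G" "h \<in> carrier G" "\<psi> \<in> H_Hom"
  shows "conj_act g (conj_act h \<psi>) = conj_act h (conj_act g \<psi>)"
proof -
  obtain k where k: "k \<in> H" "g \<otimes> h = h \<otimes> g \<otimes> k"
    using \<sigma>.commutator assms(1,2) by blast
  have "conj_act (g \<otimes> h) \<psi> = conj_act (h \<otimes> g) (conj_act k \<psi>)"
    unfolding k(2) using assms(1,2) k(1) by (intro conj_act_mult) auto
  then show ?thesis
    using assms k(1) by (simp add: conj_act_mult H_Hom_def)
qed

text \<open>For h in H, commutation gives h(g \<psi>) = g(h \<psi>) = g \<psi>.\<close>

lemma conj_act_H_Hom:
  assumes g: "g \<in> carrier G" and \<psi>: "\<psi> \<in> H_Hom"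
  shows "conj_act g \<psi> \<in> H_Hom"
proof -
  have "conj_act h (conj_act g \<psi>) = conj_act g \<psi>" if "h \<in> H" for h
    using conj_act_commute[OF _ g \<psi>, of h] that \<psi> by (simp add: H_Hom_def)
  moreover have "Vector_Spaces.linear (scal \<sigma>) (scal \<pi>) (conj_act g \<psi>)"
    using g \<psi> by (simp add: linear_iff H_Hom_def conj_act_def \<pi>.act_add \<sigma>.act_add \<pi>.act_scal \<sigma>.act_scal)
  ultimately show ?thesis
    by (simp add: H_Hom_def)
qed

text \<open>The scalar is a / b, where g^n acts by a on \<pi> and by b on \<sigma>: Schur's lemma
  enters on both sides.\<close>

lemma conj_act_power_scalar:
  assumes g: "g \<in> carrier G" and \<psi>: "\<psi> \<in> H_Hom"
  shows "\<exists>a. conj_act (g [^] n) \<psi> = fun_scal a \<psi>"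
proof -
  obtain a where a: "act \<pi> (g [^] n) v = scal \<pi> a v" for v
    using \<pi>.power_scalar[OF g] by blast
  obtain b where b: "act \<sigma> (g [^] n) v = scal \<sigma> b v" for v
    using \<sigma>.power_scalar[OF g] by blast
  obtain v0 :: 'v where "v0 \<noteq> 0"
    using \<sigma>.nontrivial by blast
  then have "b \<noteq> 0"
    using b[of v0] \<sigma>.act_eq_0_iff[of "g [^] n" v0] g by auto
  have "act \<sigma> (inv (g [^] n)) v = scal \<sigma> (1 / b) v" for v
  proof -
    have "v = scal \<sigma> b (act \<sigma> (inv (g [^] n)) v)"
      using b[of "act \<sigma> (inv (g [^] n)) v"] g by simp
    then have "scal \<sigma> (1 / b) v = scal \<sigma> (1 / b) (scal \<sigma> b (act \<sigma> (inv (g [^] n)) v))"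
      by simp
    then show ?thesis
      using \<open>b \<noteq> 0\<close> by simp
  qed
  then have "conj_act (g [^] n) \<psi> = fun_scal (a * (1 / b)) \<psi>"
    using \<psi> by (simp add: conj_act_def fun_scal_def a H_Hom_def linear_iff)
  then show ?thesis
    by blast
qed

text \<open>The simultaneous eigenspace \<open>U\<close> of the earlier operators is stable under
  the next one, which commutes with them on \<open>H_Hom\<close>. Since X^n - b annihilates \<psi>,
  the cyclic module of \<psi> contains an eigenvector of \<open>x\<close>, and it lies in
  \<open>U\<close>.\<close>

lemma common_eigenvector_generators:
  assumes "finite Z" "Z \<subseteq> carrier G" and \<phi>: "\<phi> \<in> H_Hom" "\<phi> \<noteq> 0"
  shows "\<exists>\<psi>\<in>H_Hom. \<psi> \<noteq> 0 \<and> (\<forall>z\<in>Z. \<exists>a. conj_act z \<psi> = fun_scal a \<psi>)"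
  using assms(1,2)
proof (induction Z rule: finite_induct)
  case empty
  show ?case
    by (intro bexI[of _ \<phi>] conjI ballI \<phi>) simp
next
  case (insert x Z)
  then have x: "x \<in> carrier G"
    by simp
  obtain \<psi> a where \<psi>: "\<psi> \<in> H_Hom" "\<psi> \<noteq> 0" and a: "\<And>z. z \<in> Z \<Longrightarrow> conj_act z \<psi> = fun_scal (a z) \<psi>"
    using insert by (metis insert_subset)
  define U where "U = {\<theta> \<in> H_Hom. \<forall>z\<in>Z. conj_act z \<theta> = fun_scal (a z) \<theta>}"
  have lin: "conj_act z (\<theta> + \<theta>') = conj_act z \<theta> + conj_act z \<theta>'"
    "conj_act z (fun_scal b \<theta>) = fun_scal b (conj_act z \<theta>)" "conj_act z 0 = 0"
    if "z \<in> carrier G" for z \<theta> \<theta>' b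
  proof -
    interpret z: Vector_Spaces.linear fun_scal fun_scal "conj_act z"
      using that by (rule linear_conj_act)
    show "conj_act z (\<theta> + \<theta>') = conj_act z \<theta> + conj_act z \<theta>'"
      "conj_act z (fun_scal b \<theta>) = fun_scal b (conj_act z \<theta>)" "conj_act z 0 = 0"
      by (simp_all only: z.add z.scale z.zero)
  qed
  have U: "Hom.subspace U"
  proof (rule Hom.subspaceI)
    show "0 \<in> U"
      using insert.prems lin(3) Hom.subspace_0[OF subspace_H_Hom] by (auto simp: U_def)
    show "\<theta> + \<theta>' \<in> U" if "\<theta> \<in> U" "\<theta>' \<in> U" for \<theta> \<theta>'
      using that insert.prems lin(1) Hom.subspace_add[OF subspace_H_Hom, of \<theta> \<theta>']
      by (auto simp: U_def Hom.scale_right_distrib)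
    show "fun_scal b \<theta> \<in> U" if "\<theta> \<in> U" for b \<theta>
      using that insert.prems lin(2) Hom.subspace_scale[OF subspace_H_Hom, of \<theta> b]
      by (auto simp: U_def mult.commute)
  qed
  have U_inv: "conj_act x \<theta> \<in> U" if "\<theta> \<in> U" for \<theta>
    using that x insert.prems conj_act_H_Hom[OF x, of \<theta>] conj_act_commute[OF _ x, of _ \<theta>] lin(2)[OF x]
    by (auto simp: U_def)
  obtain b where b: "conj_act (x [^] n) \<psi> = fun_scal b \<psi>"
    using conj_act_power_scalar[OF x \<psi>(1)] by blast
  define p where "p = Polynomial.monom 1 n + [:- b:]"
  \<comment> \<open>Here n > 0 matters: for n = 0 the constant -b could cancel the leading
    1.\<close>
  have "Polynomial.coeff p n \<noteq> 0"
    using \<sigma>.n_pos by (auto simp: p_def coeff_pCons gr0_conv_Suc)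
  then have "p \<noteq> 0"
    by auto
  moreover have "Hom.poly_op (conj_act x) p \<psi> = (conj_act x ^^ n) \<psi> + fun_scal (- b) \<psi>"
    by (simp only: p_def Hom.poly_op_add[OF linear_conj_act[OF x]] Hom.poly_op_monom[OF linear_conj_act[OF x]]
        Hom.poly_op_pCons[OF linear_conj_act[OF x]] Hom.poly_op_0[OF linear_conj_act[OF x]]
        lin(3)[OF x] add_0_right)
  then have "Hom.poly_op (conj_act x) p \<psi> = 0"
    using b by (simp only: conj_act_pow[OF x] Hom.scale_minus_left add.right_inverse)
  ultimately have "\<exists>q c. Hom.poly_op (conj_act x) q \<psi> \<noteq> 0 \<and>
      conj_act x (Hom.poly_op (conj_act x) q \<psi>) = fun_scal c (Hom.poly_op (conj_act x) q \<psi>)"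
    using \<psi>(2) by (rule Hom.eigenvector_in_cyclic_module[OF linear_conj_act[OF x]])
  then obtain q c where q: "Hom.poly_op (conj_act x) q \<psi> \<noteq> 0"
    "conj_act x (Hom.poly_op (conj_act x) q \<psi>) = fun_scal c (Hom.poly_op (conj_act x) q \<psi>)"
    by (elim exE conjE)
  have "\<psi> \<in> U"
    using \<psi>(1) a by (simp add: U_def)
  with U_inv have U_q: "Hom.poly_op (conj_act x) q \<psi> \<in> U"
    by (rule Hom.poly_op_mem[OF linear_conj_act[OF x] U])
  show ?case
  proof (intro bexI conjI ballI)
    show "\<exists>a. conj_act z (Hom.poly_op (conj_act x) q \<psi>) = fun_scal a (Hom.poly_op (conj_act x) q \<psi>)"
      if "z \<in> insert x Z" for z
      using that q(2) U_q by (auto simp: U_def)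
    show "Hom.poly_op (conj_act x) q \<psi> \<in> H_Hom"
      using U_q by (simp add: U_def)
  qed (fact q(1))
qed

text \<open>Being an eigenvector passes from the generators to G: H acts by 1, eigenvalues multiply,
  and those of elements of E are nonzero because \<open>conj_act x\<close> is invertible.\<close>

lemma common_eigenvector:
  assumes \<phi>: "\<phi> \<in> H_Hom" "\<phi> \<noteq> 0"
  shows "\<exists>\<psi>\<in>H_Hom. \<psi> \<noteq> 0 \<and> (\<forall>g\<in>carrier G. \<exists>a. conj_act g \<psi> = fun_scal a \<psi>)"
proof -
  obtain \<psi> where \<psi>: "\<psi> \<in> H_Hom" "\<psi> \<noteq> 0" "\<forall>x\<in>E. \<exists>a. conj_act x \<psi> = fun_scal a \<psi>"
    using common_eigenvector_generators[OF \<sigma>.finite_E \<sigma>.E_subset \<phi>] by (elim bexE conjE)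
  have lin: "conj_act g (fun_scal b \<psi>) = fun_scal b (conj_act g \<psi>)" if "g \<in> carrier G" for g b
    using that by (rule conj_act_fun_scal)
  have "\<exists>a. conj_act g \<psi> = fun_scal a \<psi>" if "g \<in> carrier G" for g
    using that
  proof (induction g rule: \<sigma>.carrier_induct)
    case (H h)
    then show ?case
      using \<psi>(1) by (intro exI[of _ 1]) (simp add: H_Hom_def)
  next
    case (E x)
    then show ?case
      using \<psi>(3) by (rule bspec[rotated])
  next
    case (inv x)
    then have x: "x \<in> carrier G"
      using \<sigma>.E_subset by blast
    obtain a where a: "conj_act x \<psi> = fun_scal a \<psi>"
      using bspec[OF \<psi>(3) inv] by (elim exE)
    have "\<psi> = fun_scal a (conj_act (inv x) \<psi>)"
      using a lin[of "inv x" a] conj_act_inv[OF x, of \<psi>] x by simp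
    moreover from this have "a \<noteq> 0"
      using \<psi>(2) by (metis Hom.scale_zero_left)
    ultimately have "conj_act (inv x) \<psi> = fun_scal (1 / a) \<psi>"
      by (metis Hom.scale_one Hom.scale_scale nonzero_eq_divide_eq)
    then show ?case
      by (intro exI)
  next
    case (mult g h)
    then obtain a b where "conj_act g \<psi> = fun_scal a \<psi>" "conj_act h \<psi> = fun_scal b \<psi>"
      by (elim exE)
    then show ?case
      using mult(1,2) lin[of g b] by (intro exI[of _ "b * a"]) (simp add: conj_act_mult)
  qed
  then show ?thesis
    using \<psi>(1,2) by (intro bexI[of _ \<psi>] conjI ballI)
qed

text \<open>A common eigenvector satisfies \<pi>(g) \<psi> = \<nu>(g) \<psi> \<sigma>(g), so its
  kernel and range are stable under G, and irreducibility of both representations makes it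
  bijective. As \<psi> is nonzero, eigenvalues are unique, which makes \<nu> multiplicative; H fixes
  \<psi>, so \<nu> is trivial there.\<close>

lemma isomorphic_up_to_character:
  assumes \<phi>: "intertwines_on (G\<lparr>carrier := H\<rparr>) \<sigma> UNIV \<pi> \<phi>" "\<phi> v \<noteq> 0"
  shows "\<exists>\<psi> \<nu>. bij \<psi> \<and> (\<forall>x y. \<psi> (x + y) = \<psi> x + \<psi> y) \<and> (\<forall>a x. \<psi> (scal \<sigma> a x) = scal \<pi> a (\<psi> x)) \<and>
      (\<forall>g\<in>carrier G. \<nu> g \<noteq> 0 \<and> (\<forall>x. act \<pi> g (\<psi> x) = \<psi> (scal \<sigma> (\<nu> g) (act \<sigma> g x)))) \<and>
      (\<forall>h\<in>H. \<nu> h = 1) \<and> (\<forall>g\<in>carrier G. \<forall>h\<in>carrier G. \<nu> (g \<otimes> h) = \<nu> g * \<nu> h)"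
proof -
  have "act \<pi> h (\<phi> (act \<sigma> (inv h) x)) = \<phi> x" if "h \<in> H" for h x
  proof -
    have "\<phi> (act \<sigma> h y) = act \<pi> h (\<phi> y)" for y
      using \<phi>(1) that by (simp add: intertwines_on_def)
    from this[of "act \<sigma> (inv h) x"] show ?thesis
      using that by simp
  qed
  then have "\<phi> \<in> H_Hom"
    using \<phi>(1) by (auto simp: H_Hom_def linear_iff intertwines_on_def conj_act_def fun_eq_iff)
  moreover have "\<phi> \<noteq> 0"
    using \<phi>(2) by auto
  ultimately have "\<exists>\<psi>\<in>H_Hom. \<psi> \<noteq> 0 \<and> (\<forall>g\<in>carrier G. \<exists>a. conj_act g \<psi> = fun_scal a \<psi>)"
    by (rule common_eigenvector)
  then obtain \<psi> where \<psi>: "\<psi> \<in> H_Hom" "\<psi> \<noteq> 0"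
    and "\<forall>g\<in>carrier G. \<exists>a. conj_act g \<psi> = fun_scal a \<psi>"
    by (elim bexE conjE)
  then obtain \<nu> where \<nu>: "\<And>g. g \<in> carrier G \<Longrightarrow> conj_act g \<psi> = fun_scal (\<nu> g) \<psi>"
    by (auto dest!: bchoice)
  have \<nu>_unique: "a = b" if "fun_scal a \<psi> = fun_scal b \<psi>" for a b
    using that \<psi>(2) by (metis Hom.scale_cancel_right)
  have add: "\<psi> (x + y) = \<psi> x + \<psi> y" and scale: "\<psi> (scal \<sigma> a x) = scal \<pi> a (\<psi> x)" for x y a
    using \<psi>(1) by (simp_all add: H_Hom_def linear_iff)
  have zero: "\<psi> 0 = 0"
    using add[of 0 0] by simp
  have \<nu>_mult: "\<nu> (g \<otimes> h) = \<nu> g * \<nu> h" if "g \<in> carrier G" "h \<in> carrier G" for g h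
  proof (rule \<nu>_unique)
    have "fun_scal (\<nu> (g \<otimes> h)) \<psi> = conj_act (g \<otimes> h) \<psi>"
      using that by (intro \<nu>[symmetric]) simp
    also have "\<dots> = fun_scal (\<nu> g * \<nu> h) \<psi>"
      using \<nu>[of g] \<nu>[of h] that conj_act_fun_scal[OF that(1), of "\<nu> h" \<psi>]
      by (simp add: conj_act_mult mult.commute)
    finally show "fun_scal (\<nu> (g \<otimes> h)) \<psi> = fun_scal (\<nu> g * \<nu> h) \<psi>" .
  qed
  have \<nu>_H: "\<nu> h = 1" if "h \<in> H" for h
    using \<nu>[of h] that \<psi>(1) by (intro \<nu>_unique) (simp add: H_Hom_def)
  have \<nu>_nz: "\<nu> g \<noteq> 0" if "g \<in> carrier G" for g
    using \<nu>_mult[of g "inv g"] \<nu>_H[of \<one>] that subgroup.one_closed[OF \<sigma>.subgroup] by auto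
  have act: "act \<pi> g (\<psi> x) = scal \<pi> (\<nu> g) (\<psi> (act \<sigma> g x))" if "g \<in> carrier G" for g x
    using fun_cong[OF \<nu>[OF that], of "act \<sigma> g x"] that by (simp add: conj_act_def fun_scal_def)
  obtain v0 where v0: "\<psi> v0 \<noteq> 0"
    using \<psi>(2) by (auto simp: fun_eq_iff)
  have "{x. \<psi> x = 0} = {0} \<or> {x. \<psi> x = 0} = UNIV"
  proof (rule \<sigma>.irreducible)
    have "\<psi> (act \<sigma> g x) = 0" if "g \<in> carrier G" "\<psi> x = 0" for g x
      using act[OF that(1), of x] that \<nu>_nz[OF that(1)] by simp
    then show "invariant_subspace G \<sigma> {x. \<psi> x = 0}"
      by (auto simp: invariant_subspace_def add scale zero intro!: \<sigma>.subspaceI)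
  qed
  then have ker: "\<psi> x = 0 \<Longrightarrow> x = 0" for x
    using v0 by auto
  have "inj \<psi>"
  proof (rule injI)
    fix x y assume "\<psi> x = \<psi> y"
    then have "\<psi> (x - y) = 0"
      using add[of "x - y" y] by simp
    then show "x = y"
      using ker[of "x - y"] by simp
  qed
  moreover have "range \<psi> = UNIV"
  proof (rule \<pi>.subspace_eq_UNIV[of _ "\<psi> v0"])
    show "\<pi>.subspace (range \<psi>)"
    proof (rule \<pi>.subspaceI)
      show "0 \<in> range \<psi>"
        using zero by (rule range_eqI[OF sym])
      show "x + y \<in> range \<psi>" if "x \<in> range \<psi>" "y \<in> range \<psi>" for x y
        using that by (auto simp flip: add)
      show "scal \<pi> a x \<in> range \<psi>" if "x \<in> range \<psi>" for a x
        using that by (auto simp flip: scale)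
    qed
    show "act \<pi> g w \<in> range \<psi>" if "g \<in> carrier G" "w \<in> range \<psi>" for g w
      using that act[OF that(1)] by (auto simp flip: scale)
  qed (use v0 in auto)
  ultimately have "bij \<psi>"
    by (simp add: bij_def)
  then show ?thesis
    using add scale act \<nu>_nz \<nu>_H \<nu>_mult by (intro exI[of _ \<psi>] exI[of _ \<nu>]) auto
qed

end

section \<open>Local compactness\<close>

lemma comm_group_mult_group: "comm_group (mult_group :: 'a::field monoid)"
proof (rule comm_groupI)
  show "\<exists>y\<in>carrier mult_group. y \<otimes>\<^bsub>mult_group\<^esub> x = \<one>\<^bsub>mult_group\<^esub>"
    if "x \<in> carrier mult_group" for x :: 'a
    using that by (intro bexI[of _ "inverse x"]) (auto simp: mult_group_def)
qed (auto simp: mult_group_def)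

interpretation mult_group: comm_group "mult_group :: 'a::field monoid"
  by (rule comm_group_mult_group)

lemma mult_group_simps [simp]:
  "carrier mult_group = {x. x \<noteq> 0}" "x \<otimes>\<^bsub>mult_group\<^esub> y = x * y" "\<one>\<^bsub>mult_group\<^esub> = 1"
  by (simp_all add: mult_group_def)

lemma inv_mult_group [simp]: "x \<noteq> 0 \<Longrightarrow> inv\<^bsub>mult_group\<^esub> x = inverse x"
  by (intro mult_group.inv_equality) auto

context
  fixes p :: nat and F :: "'f::{field_char_0,complete_space} itself"
  assumes padic: "padic_field TYPE('f) p"
begin

lemma padic_p_gt_1: "real p > 1"
  using padic prime_gt_1_nat by (auto simp: padic_field_def)

lemma dist_eq_absv: "dist x y = absv (x - y :: 'f)"
  using padic by (simp add: padic_field_def)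

lemma absv_mult: "absv (x * y) = absv x * absv (y :: 'f)"
  using padic by (simp add: padic_field_def)

lemma absv_add_le: "absv (x + y) \<le> max (absv x) (absv (y :: 'f))"
  using padic by (simp add: padic_field_def)

lemma absv_p: "absv (of_nat p :: 'f) = 1 / real p"
  using padic by (simp add: padic_field_def)

lemma absv_nonneg [simp]: "absv (x :: 'f) \<ge> 0"
  by (simp add: absv_def)

lemma absv_eq_0_iff [simp]: "absv (x :: 'f) = 0 \<longleftrightarrow> x = 0"
  by (simp add: absv_def)

lemma absv_0 [simp]: "absv (0 :: 'f) = 0"
  by (simp add: absv_def)

lemma absv_1 [simp]: "absv (1 :: 'f) = 1"
  using absv_mult[of 1 1] by simp

lemma absv_minus [simp]: "absv (- x) = absv (x :: 'f)"
  using dist_eq_absv[of 0 x] by (simp add: absv_def dist_commute)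

lemma absv_diff_le: "absv (x - y) \<le> max (absv x) (absv (y :: 'f))"
  using absv_add_le[of x "- y"] by simp

lemma absv_power: "absv (x ^ k) = absv (x :: 'f) ^ k"
  by (induction k) (simp_all add: absv_mult)

lemma absv_inverse: "absv (inverse x) = inverse (absv (x :: 'f))"
proof (cases "x = 0")
  case False
  then have "absv x * absv (inverse x) = 1"
    by (simp flip: absv_mult)
  then show ?thesis
    by (simp add: inverse_unique)
qed simp

lemma absv_divide: "absv (x / y) = absv x / absv (y :: 'f)"
  by (simp add: divide_inverse absv_mult absv_inverse)

lemma absv_of_nat_le_1: "absv (of_nat m :: 'f) \<le> 1"
proof (induction m)
  case (Suc m)
  then show ?case
    using absv_add_le[of 1 "of_nat m"] by (simp add: max_def split: if_splits)
qed simp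

lemma absv_of_int_le_1: "absv (of_int m :: 'f) \<le> 1"
proof -
  obtain k where "m = int k \<or> m = - int k"
    by (metis int_cases2)
  then show ?thesis
    using absv_of_nat_le_1[of k] by auto
qed

lemma absv_of_int_dvd_le:
  assumes "int p ^ k dvd m"
  shows "absv (of_int m :: 'f) \<le> 1 / real p ^ k"
proof -
  obtain l where "m = int p ^ k * l"
    using assms by (elim dvdE)
  then show ?thesis
    using mult_left_mono[OF absv_of_int_le_1[of l], of "(1 / real p) ^ k"]
    by (simp add: absv_mult absv_power absv_p power_divide)
qed

text \<open>By Bezout 1 = u m + v p; were m, like p, of absolute value below 1, the ultrametric
  inequality would give |1| < 1.\<close>

lemma absv_of_int_eq_1:
  assumes "\<not> int p dvd m"
  shows "absv (of_int m :: 'f) = 1"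
proof (rule ccontr)
  assume "absv (of_int m :: 'f) \<noteq> 1"
  then have less: "absv (of_int m :: 'f) < 1"
    using absv_of_int_le_1[of m] by simp
  have "prime (int p)"
    using padic by (simp add: padic_field_def)
  then have "coprime m (int p)"
    using assms by (metis prime_imp_coprime coprime_commute)
  then obtain u v where "u * m + v * int p = 1"
    using bezout_int[of m "int p"] by auto
  then have "1 = of_int u * of_int m + of_int v * (of_nat p :: 'f)"
    by (metis of_int_1 of_int_add of_int_mult of_int_of_nat_eq)
  then have "1 \<le> max (absv (of_int u :: 'f) * absv (of_int m :: 'f)) (absv (of_int v :: 'f) * (1 / real p))"
    using absv_add_le[of "of_int u * of_int m" "of_int v * (of_nat p :: 'f)"]
    by (simp add: absv_mult absv_p)
  moreover have "absv (of_int u :: 'f) * absv (of_int m :: 'f) \<le> absv (of_int m :: 'f)"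
    using absv_of_int_le_1 by (simp add: mult_left_le_one_le)
  moreover have "absv (of_int v :: 'f) * (1 / real p) \<le> 1 / real p"
    using absv_of_int_le_1 by (intro mult_left_le_one_le) auto
  moreover have "1 / real p < 1"
    using padic_p_gt_1 by simp
  ultimately show False
    using less by (simp add: max_def split: if_splits)
qed

text \<open>The denominator is prime to p, hence invertible modulo p^k, so q is congruent to one of
  the residues below p^k. These residues are the centres that make Z_p totally bounded.\<close>

lemma rational_approximation:
  fixes q :: 'f
  assumes "q \<in> \<rat>" "absv q \<le> 1"
  shows "\<exists>m<p ^ k. absv (q - of_nat m) \<le> 1 / real p ^ k"
proof -
  obtain a b where ab: "b > 0" "coprime a b" "q = of_int a / of_int b"
    using assms(1) by (rule Rats_cases')
  have "prime (int p)"
    using padic by (simp add: padic_field_def)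
  have b: "\<not> int p dvd b"
  proof
    assume dvd: "int p dvd b"
    then have "\<not> int p dvd a"
      using ab(2) \<open>prime (int p)\<close> by (meson coprime_common_divisor not_prime_unit)
    then have "absv q = 1 / absv (of_int b :: 'f)"
      using ab(3) by (simp add: absv_divide absv_of_int_eq_1)
    moreover have "absv (of_int b :: 'f) \<le> 1 / real p" "1 / real p < 1"
      using absv_of_int_dvd_le[of 1 b] dvd padic_p_gt_1 by simp_all
    moreover have "absv (of_int b :: 'f) > 0"
      using ab(1) by (simp add: less_le)
    ultimately show False
      using assms(2) by (simp add: le_divide_eq_1 divide_le_eq_1)
  qed
  then have "coprime b (int p)"
    using \<open>prime (int p)\<close> by (metis prime_imp_coprime coprime_commute)
  then have "coprime b (int p ^ k)"
    by simp
  then obtain u v where uv: "u * b + v * int p ^ k = 1"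
    using bezout_int[of b "int p ^ k"] by auto
  \<comment> \<open>\<open>u\<close> is an inverse of \<open>b\<close> modulo p^k.\<close>
  define m where "m = nat ((u * a) mod int p ^ k)"
  have p: "int p ^ k > 0"
    using padic_p_gt_1 by simp
  then have m: "int m = (u * a) mod int p ^ k" "m < p ^ k"
    by (simp_all add: m_def nat_less_iff)
  have "a - b * (u * a) = int p ^ k * (v * a)"
    using arg_cong[OF uv, of "\<lambda>x. a * x"] by (simp add: algebra_simps)
  moreover have "int p ^ k dvd b * (u * a - int m)"
    unfolding m(1) by (simp add: minus_mod_eq_mult_div)
  ultimately have "int p ^ k dvd (a - b * (u * a)) + b * (u * a - int m)"
    by (metis dvd_add dvd_triv_left)
  then have "int p ^ k dvd a - b * int m"
    by (simp add: algebra_simps)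
  then have "absv (of_int (a - b * int m) :: 'f) \<le> 1 / real p ^ k"
    by (rule absv_of_int_dvd_le)
  moreover have "q - of_nat m = of_int (a - b * int m) / of_int b"
    using ab(1,3) by (simp add: field_simps)
  then have "absv (q - of_nat m) = absv (of_int (a - b * int m) :: 'f)"
    using absv_of_int_eq_1[OF b] by (simp only: absv_divide div_by_1)
  ultimately show ?thesis
    using m(2) by auto
qed

section \<open>Compactness of the ring of integers\<close>

lemma int_ring_eq_cball: "int_ring = cball (0 :: 'f) 1"
  by (auto simp: int_ring_def absv_def dist_commute)

lemma inverse_p_power_less: "\<epsilon> > 0 \<Longrightarrow> \<exists>k. 1 / real p ^ k < \<epsilon>"
  using real_arch_pow_inv[of \<epsilon> "1 / real p"] padic_p_gt_1 by (simp add: power_divide)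

text \<open>The set is Z_p. It is complete because it is closed, and the integers below p^k form a
  finite net.\<close>

lemma compact_padic_integers: "compact (closure \<rat> \<inter> int_ring :: 'f set)"
  unfolding compact_eq_totally_bounded
proof (intro conjI allI impI)
  show "complete (closure \<rat> \<inter> int_ring :: 'f set)"
    unfolding complete_eq_closed int_ring_eq_cball by (intro closed_Int closed_closure closed_cball)
next
  fix \<epsilon> :: real assume "\<epsilon> > 0"
  then obtain k where k: "1 / real p ^ k < \<epsilon>"
    using inverse_p_power_less by blast
  have pos: "0 < 1 / real p ^ k" and le_1: "1 / real p ^ k \<le> 1"
    using padic_p_gt_1 by simp_all
  have "\<exists>m<p ^ k. dist (of_nat m) x < \<epsilon>" if x: "x \<in> closure \<rat> \<inter> int_ring" for x :: 'f
  proof -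
    obtain q where q: "q \<in> \<rat>" "dist q x < 1 / real p ^ k"
      using x pos by (meson IntD1 closure_approachable)
    have "absv q \<le> max (absv x) (absv (q - x))"
      using absv_add_le[of x "q - x"] by simp
    then have "absv q \<le> 1"
      using x q(2) le_1 by (simp add: dist_eq_absv int_ring_def max_def split: if_splits)
    then obtain m where m: "m < p ^ k" "absv (q - of_nat m) \<le> 1 / real p ^ k"
      using rational_approximation[OF q(1)] by blast
    have "absv (of_nat m - x) \<le> max (absv (q - x)) (absv (q - of_nat m))"
      using absv_diff_le[of "q - x" "q - of_nat m"] by simp
    then have "absv (of_nat m - x) < \<epsilon>"
      using m(2) q(2) k by (simp add: dist_eq_absv)
    then show ?thesis
      using m(1) by (auto simp: dist_eq_absv)
  qed
  then have "closure \<rat> \<inter> int_ring \<subseteq> (\<Union>x\<in>of_nat ` {..<p ^ k} :: 'f set. ball x \<epsilon>)"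
    by fastforce
  then show "\<exists>K. finite K \<and> closure \<rat> \<inter> int_ring \<subseteq> (\<Union>x\<in>K :: 'f set. ball x \<epsilon>)"
    by blast
qed

text \<open>The type class of the field does not tie its metric to the field operations; continuity,
  here and for sums in \<open>compact_sum_set\<close>, has to come from
  \<open>padic_field\<close>.\<close>

lemma continuous_on_affine: "continuous_on S (\<lambda>x :: 'f. c * x + d)"
proof (rule lipschitz_on_continuous_on)
  show "(absv c)-lipschitz_on S (\<lambda>x. c * x + d)"
    by (rule lipschitz_onI) (simp_all add: dist_eq_absv absv_mult flip: right_diff_distrib)
qed

lemma compact_sum_set:
  assumes "compact S" "compact (T :: 'f set)"
  shows "compact {x + y | x y. x \<in> S \<and> y \<in> T}"
proof -
  have "continuous_on (S \<times> T) (\<lambda>z. fst z + snd z)"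
    unfolding continuous_on_iff
  proof (intro ballI allI impI)
    fix z \<epsilon> assume "0 < (\<epsilon> :: real)"
    have "dist (fst z' + snd z') (fst z + snd z) < \<epsilon>" if "dist z' z < \<epsilon>" for z' :: "'f \<times> 'f"
    proof -
      have "absv ((fst z' - fst z) + (snd z' - snd z)) \<le> max (dist (fst z') (fst z)) (dist (snd z') (snd z))"
        unfolding dist_eq_absv by (rule absv_add_le)
      then show ?thesis
        using that dist_fst_le[of z' z] dist_snd_le[of z' z] by (simp add: dist_eq_absv algebra_simps)
    qed
    then show "\<exists>d>0. \<forall>z'\<in>S \<times> T. dist z' z < d \<longrightarrow> dist (fst z' + snd z') (fst z + snd z) < \<epsilon>"
      using \<open>0 < \<epsilon>\<close> by blast
  qed
  then have "compact ((\<lambda>z. fst z + snd z) ` (S \<times> T))"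
    using assms by (intro compact_continuous_image compact_Times)
  moreover have "(\<lambda>z. fst z + snd z) ` (S \<times> T) = {x + y | x y. x \<in> S \<and> y \<in> T}"
    by force
  ultimately show ?thesis
    by simp
qed

text \<open>Each element of \<open>B\<close> contributes one compact summand, the image of
  \<open>Z\<close> under multiplication by it.\<close>

lemma compact_span:
  assumes "compact Z" "finite (B :: 'f set)"
  shows "compact {x. \<exists>a. (\<forall>b\<in>B. a b \<in> Z) \<and> x = (\<Sum>b\<in>B. a b * b)}" (is "compact (?C B)")
  using assms(2)
proof (induction B rule: finite_induct)
  case empty
  then show ?case
    by simp
next
  case (insert b B)
  have "continuous_on Z (\<lambda>x. b * x)"
    using continuous_on_affine[of Z b 0] by simp
  then have "compact ((\<lambda>x. b * x) ` Z)"
    using assms(1) by (rule compact_continuous_image)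
  then have "compact {x + y | x y. x \<in> (\<lambda>x. b * x) ` Z \<and> y \<in> ?C B}"
    using insert.IH by (rule compact_sum_set)
  moreover have "{x + y | x y. x \<in> (\<lambda>x. b * x) ` Z \<and> y \<in> ?C B} = ?C (insert b B)"
  proof (intro equalityI subsetI)
    fix x assume "x \<in> {x + y | x y. x \<in> (\<lambda>x. b * x) ` Z \<and> y \<in> ?C B}"
    then obtain z a where a: "z \<in> Z" "\<forall>b\<in>B. a b \<in> Z" "x = b * z + (\<Sum>b\<in>B. a b * b)"
      by auto
    have "(\<Sum>c\<in>B. (a(b := z)) c * c) = (\<Sum>c\<in>B. a c * c)"
      using insert.hyps(2) by (intro sum.cong) auto
    then show "x \<in> ?C (insert b B)"
      using insert.hyps a by (intro CollectI exI[of _ "a(b := z)"]) (simp add: mult.commute)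
  next
    fix x assume "x \<in> ?C (insert b B)"
    then obtain a where a: "\<forall>c\<in>insert b B. a c \<in> Z" "x = (\<Sum>c\<in>insert b B. a c * c)"
      by blast
    have "x = b * a b + (\<Sum>c\<in>B. a c * c)"
      using a(2) insert.hyps by (simp add: mult.commute)
    moreover have "(\<Sum>c\<in>B. a c * c) \<in> ?C B"
      using a(1) by blast
    ultimately show "x \<in> {x + y | x y. x \<in> (\<lambda>x. b * x) ` Z \<and> y \<in> ?C B}"
      using a(1) by blast
  qed
  ultimately show ?case
    by simp
qed

text \<open>By Baire, one of the countably many compact lattices \<open>p\<^sup>-\<^sup>k \<Sum> \<int>\<^sub>p b\<close> that cover the field
  has an interior point, so the field is locally compact.\<close>
lemma compact_int_ring: "compact (int_ring :: 'f set)"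
proof -
  obtain B :: "'f set" where B: "finite B"
    and span: "\<And>x. \<exists>a. (\<forall>b\<in>B. a b \<in> closure \<rat>) \<and> x = (\<Sum>b\<in>B. a b * b)"
    using padic by (auto simp: padic_field_def)
  define Z where "Z = (closure \<rat> \<inter> int_ring :: 'f set)"
  define C where "C = {x. \<exists>a. (\<forall>b\<in>B. a b \<in> Z) \<and> x = (\<Sum>b\<in>B. a b * b)}"
  define D where "D k = (\<lambda>x. inverse (of_nat p ^ k) * x + 0) ` C" for k
  have p_nz: "of_nat p \<noteq> (0 :: 'f)"
    using padic_p_gt_1 by auto
  have "compact C"
    unfolding C_def Z_def using compact_padic_integers B by (rule compact_span)
  then have D_compact: "compact (D k)" for k
    unfolding D_def by (intro compact_continuous_image continuous_on_affine)
  have closure_scale: "of_nat p ^ k * x \<in> closure \<rat>" if x: "x \<in> closure \<rat>" for x :: 'f and k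
    unfolding closure_approachable
  proof (intro allI impI)
    fix \<epsilon> :: real assume "\<epsilon> > 0"
    then obtain y where y: "y \<in> \<rat>" "dist y x < \<epsilon>"
      using x by (meson closure_approachable)
    have "dist (of_nat p ^ k * y) (of_nat p ^ k * x) = absv (of_nat (p ^ k) :: 'f) * dist y x"
      by (simp add: dist_eq_absv flip: absv_mult right_diff_distrib)
    also have "\<dots> \<le> dist y x"
      using absv_of_nat_le_1[of "p ^ k"] by (intro mult_left_le_one_le) simp_all
    finally show "\<exists>y\<in>\<rat>. dist y (of_nat p ^ k * x) < \<epsilon>"
      using y by (intro bexI[of _ "of_nat p ^ k * y"]) auto
  qed
  have "x \<in> (\<Union>k. D k)" for x
  proof -
    obtain a where a: "\<forall>b\<in>B. a b \<in> closure \<rat>" "x = (\<Sum>b\<in>B. a b * b)"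
      using span by blast
    \<comment> \<open>p^k is large enough to bring all the coefficients into Z_p after
      multiplication.\<close>
    obtain k where k: "\<forall>b\<in>B. absv (a b) \<le> real p ^ k"
    proof -
      obtain k where "(\<Sum>b\<in>B. absv (a b)) < real p ^ k"
        using real_arch_pow[OF padic_p_gt_1] by blast
      moreover have "absv (a b) \<le> (\<Sum>b\<in>B. absv (a b))" if "b \<in> B" for b
        using B that by (intro member_le_sum) auto
      ultimately show ?thesis
        by (intro that[of k]) force
    qed
    have "of_nat p ^ k * a b \<in> Z" if "b \<in> B" for b
      using closure_scale[of "a b" k] a(1) k that padic_p_gt_1
      by (auto simp: Z_def int_ring_def absv_mult absv_power absv_p power_divide divide_simps)
    moreover have "of_nat p ^ k * x = (\<Sum>b\<in>B. (of_nat p ^ k * a b) * b)"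
      by (simp add: a(2) sum_distrib_left mult.assoc)
    ultimately have "of_nat p ^ k * x \<in> C"
      unfolding C_def by (intro CollectI exI[of _ "\<lambda>b. of_nat p ^ k * a b"]) auto
    then have "x \<in> D k"
      unfolding D_def using p_nz by (intro image_eqI[of _ _ "of_nat p ^ k * x"]) auto
    then show ?thesis
      by blast
  qed
  then have "(\<Union>k. D k) = UNIV"
    by blast
  \<comment> \<open>The union is the whole field, so not every \<open>D k\<close> can have empty
    interior.\<close>
  moreover have "euclidean interior_of \<Union>(range D) = {}" if "\<And>k. interior (D k) = {}"
  proof (rule Baire_category_alt)
    show "completely_metrizable_space (euclidean :: 'f topology) \<or>
        locally_compact_space (euclidean :: 'f topology) \<and> regular_space (euclidean :: 'f topology)"
      using completely_metrizable_space_euclidean by blast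
  qed (use that D_compact compact_imp_closed in auto)
  ultimately obtain k x where "x \<in> interior (D k)"
    by fastforce
  then obtain \<epsilon> where \<epsilon>: "\<epsilon> > 0" "cball x \<epsilon> \<subseteq> D k"
    by (auto simp: mem_interior_cball)
  obtain m where m: "1 / real p ^ m < \<epsilon>"
    using inverse_p_power_less[OF \<epsilon>(1)] by blast
  \<comment> \<open>Translation by -x followed by division by p^m: the ball of radius p^-m about
    \<open>x\<close> goes onto the unit ball.\<close>
  let ?g = "\<lambda>y. inverse (of_nat p ^ m) * y + (- inverse (of_nat p ^ m) * x)"
  have "compact (D k \<inter> cball x (1 / real p ^ m))"
    using D_compact by (intro compact_Int_closed) auto
  also have "D k \<inter> cball x (1 / real p ^ m) = cball x (1 / real p ^ m)"
    using \<epsilon>(2) m by (auto simp: subset_iff)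
  finally have "compact (?g ` cball x (1 / real p ^ m))"
    by (intro compact_continuous_image continuous_on_affine)
  moreover have "?g ` cball x (1 / real p ^ m) = int_ring"
  proof (intro equalityI subsetI)
    fix z assume "z \<in> ?g ` cball x (1 / real p ^ m)"
    then obtain y where y: "dist x y \<le> 1 / real p ^ m" "z = ?g y"
      by auto
    then have "z = inverse (of_nat p ^ m) * (y - x)"
      by (simp add: algebra_simps)
    then have "absv z = real p ^ m * dist y x"
      by (simp add: absv_mult absv_inverse absv_power absv_p dist_eq_absv power_divide)
    also have "\<dots> \<le> 1"
      using y(1) padic_p_gt_1 by (simp add: dist_commute field_simps)
    finally show "z \<in> int_ring"
      by (simp add: int_ring_def)
  next
    fix z :: 'f assume z: "z \<in> int_ring"
    have "z = ?g (x + of_nat p ^ m * z)"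
      using p_nz by (simp add: algebra_simps)
    moreover have "dist x (x + of_nat p ^ m * z) \<le> 1 / real p ^ m"
      using z padic_p_gt_1
      by (simp add: dist_eq_absv absv_mult absv_power absv_p power_divide int_ring_def divide_right_mono)
    ultimately show "z \<in> ?g ` cball x (1 / real p ^ m)"
      by (intro image_eqI[of _ _ "x + of_nat p ^ m * z"]) auto
  qed
  ultimately show ?thesis
    by simp
qed

lemma compact_int_units: "compact (int_units :: 'f set)"
proof -
  have "(int_units :: 'f set) = int_ring \<inter> - ball 0 1"
    by (auto simp: int_units_def int_ring_def absv_def dist_commute)
  moreover have "compact (int_ring \<inter> - ball (0 :: 'f) 1)"
    by (intro compact_Int_closed compact_int_ring) (simp add: closed_Compl)
  ultimately show ?thesis
    by simp
qed

text \<open>Powers of p move any x into the annulus 1/p < |z| \<le> 1. Total boundedness of the unit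
  ball provides finitely many centres e, one of them with |e - z| < 1/p; then |e| = |z|, so z / e is
  a unit. The nonzero centres and p form the finite set.\<close>

lemma mult_group_generated:
  "\<exists>E :: 'f set. finite E \<and> 0 \<notin> E \<and> carrier mult_group \<subseteq> generate mult_group (int_units \<union> E)"
proof -
  obtain E where E: "finite E" "int_ring \<subseteq> (\<Union>e\<in>E. ball (e :: 'f) (1 / real p))"
    using compact_int_ring padic_p_gt_1 unfolding compact_eq_totally_bounded
    by (meson divide_pos_pos less_trans zero_less_one)
  define E' where "E' = insert (of_nat p) (E - {0})"
  let ?G = "generate mult_group (int_units \<union> E')"
  have p_nz: "of_nat p \<noteq> (0 :: 'f)"
    using padic_p_gt_1 by auto
  have mult: "x * y \<in> ?G" if "x \<in> ?G" "y \<in> ?G" for x y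
    using generate.eng[OF that] by simp
  have p_power: "of_nat p ^ k \<in> ?G" "inverse (of_nat p ^ k) \<in> ?G" for k
  proof -
    have "of_nat p \<in> ?G"
      by (intro generate.incl) (simp add: E'_def)
    moreover have "inverse (of_nat p) \<in> ?G"
      using generate.inv[of "of_nat p" "int_units \<union> E'" mult_group] p_nz by (simp add: E'_def)
    moreover have "1 \<in> ?G"
      using generate.one[of mult_group] by simp
    ultimately show "of_nat p ^ k \<in> ?G" "inverse (of_nat p ^ k) \<in> ?G"
      by (induction k) (simp_all add: mult mult.commute)
  qed
  have "x \<in> ?G" if x: "x \<noteq> 0" for x
  proof -
    obtain M where "absv x < real p ^ M"
      using real_arch_pow[OF padic_p_gt_1] by blast
    define y where "y = x * of_nat p ^ M"
    have "absv y = absv x / real p ^ M"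
      by (simp add: y_def absv_mult absv_power absv_p power_divide)
    moreover have "absv x > 0"
      using x absv_eq_0_iff[of x] absv_nonneg[of x] by linarith
    ultimately have y: "absv y \<le> 1" "absv y > 0"
      using \<open>absv x < real p ^ M\<close> padic_p_gt_1 by simp_all
    have "\<exists>j. absv y > 1 / real p ^ Suc j"
    proof -
      obtain k where "1 / real p ^ k < absv y"
        using inverse_p_power_less[OF y(2)] by blast
      moreover have "1 / real p ^ Suc k \<le> 1 / real p ^ k"
        using padic_p_gt_1 by (intro divide_left_mono power_increasing) auto
      ultimately show ?thesis
        by (intro exI[of _ k]) linarith
    qed
    \<comment> \<open>The least such \<open>j\<close> gives p^-(j+1) < |y| \<le> p^-j; for j = 0 the
      upper bound is |y| \<le> 1.\<close>
    then obtain j where j: "absv y > 1 / real p ^ Suc j" "\<And>i. i < j \<Longrightarrow> absv y \<le> 1 / real p ^ Suc i"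
      using exists_least_iff[of "\<lambda>j. absv y > 1 / real p ^ Suc j"] by (metis not_less)
    have "absv y \<le> 1 / real p ^ j"
      using y(1) j(2)[of "j - 1"] by (cases j) auto
    define z where "z = y * inverse (of_nat p ^ j)"
    have absv_z: "absv z = absv y * real p ^ j"
      by (simp add: z_def absv_mult absv_inverse absv_power absv_p power_divide)
    then have "z \<in> int_ring" "absv z > 1 / real p"
      using \<open>absv y \<le> 1 / real p ^ j\<close> j(1) padic_p_gt_1
      by (auto simp: int_ring_def field_simps)
    then obtain e where e: "e \<in> E" "absv (e - z) < 1 / real p"
      using E(2) by (auto simp: dist_eq_absv)
    \<comment> \<open>In an ultrametric, a perturbation smaller than |z| does not change the
      absolute value.\<close>
    have "absv e = absv z"
      using e(2) \<open>absv z > 1 / real p\<close> absv_add_le[of "e - z" z] absv_diff_le[of e "e - z"]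
      by (simp add: max_def split: if_splits)
    moreover have "absv z > 0"
      using \<open>absv z > 1 / real p\<close> padic_p_gt_1 by (intro less_trans[of 0 "1 / real p" "absv z"]) auto
    ultimately have "z / e \<in> int_units" "e \<noteq> 0"
      by (auto simp: int_units_def absv_divide)
    have "z / e \<in> ?G" "e \<in> ?G"
      using \<open>z / e \<in> int_units\<close> \<open>e \<noteq> 0\<close> e(1) by (auto simp: E'_def intro: generate.incl)
    then have "z / e * e * of_nat p ^ j * inverse (of_nat p ^ M) \<in> ?G"
      using p_power by (intro mult)
    moreover have "z / e * e * of_nat p ^ j * inverse (of_nat p ^ M) = x"
      using \<open>e \<noteq> 0\<close> p_nz by (simp add: z_def y_def field_simps)
    ultimately show ?thesis
      by simp
  qed
  then show ?thesis
    using E(1) p_nz by (intro exI[of _ E']) (auto simp: E'_def)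
qed

end

section \<open>Tensor products and the torus\<close>

context
  fixes A :: "'a monoid" and B :: "'b monoid"
  assumes A: "group A" and B: "group B"
begin

interpretation A: group A by (fact A)
interpretation B: group B by (fact B)
interpretation F: comm_group "free_Abelian_group (carrier A \<times> carrier B)"
  by (rule abelian_free_Abelian_group)

lemma subgroup_tensor_relations:
  "subgroup (tensor_relations A B) (free_Abelian_group (carrier A \<times> carrier B))"
  unfolding tensor_relations_def
proof (rule F.generate_is_subgroup, intro subsetI)
  fix x
  assume "x \<in> {frag_of (a \<otimes>\<^bsub>A\<^esub> a', b) - frag_of (a, b) - frag_of (a', b) | a a' b.
         a \<in> carrier A \<and> a' \<in> carrier A \<and> b \<in> carrier B} \<union>
      {frag_of (a, b \<otimes>\<^bsub>B\<^esub> b') - frag_of (a, b) - frag_of (a, b') | a b b'.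
         a \<in> carrier A \<and> b \<in> carrier B \<and> b' \<in> carrier B}"
  then obtain r s t where "x = frag_of r - frag_of s - frag_of t"
    "r \<in> carrier A \<times> carrier B" "s \<in> carrier A \<times> carrier B" "t \<in> carrier A \<times> carrier B"
    by auto
  then show "x \<in> carrier (free_Abelian_group (carrier A \<times> carrier B))"
    using keys_diff[of "frag_of r - frag_of s" "frag_of t"] keys_diff[of "frag_of r" "frag_of s"]
    by auto
qed

interpretation R: normal "tensor_relations A B" "free_Abelian_group (carrier A \<times> carrier B)"
  using subgroup_tensor_relations by (simp add: F.normal_iff_subgroup)

lemma comm_group_tensor_group: "comm_group (tensor_group A B)"
  unfolding tensor_group_def using subgroup_tensor_relations by (rule F.abelian_FactGroup)

lemma pure_tensor_closed:
  "a \<in> carrier A \<Longrightarrow> b \<in> carrier B \<Longrightarrow> pure_tensor A B a b \<in> carrier (tensor_group A B)"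
  unfolding tensor_group_def pure_tensor_def carrier_FactGroup by (intro imageI) simp

lemma coset_mult:
  assumes "Poly_Mapping.keys x \<subseteq> carrier A \<times> carrier B" "Poly_Mapping.keys y \<subseteq> carrier A \<times> carrier B"
  shows "(tensor_relations A B #>\<^bsub>free_Abelian_group (carrier A \<times> carrier B)\<^esub> x) \<otimes>\<^bsub>tensor_group A B\<^esub>
      (tensor_relations A B #>\<^bsub>free_Abelian_group (carrier A \<times> carrier B)\<^esub> y) =
      tensor_relations A B #>\<^bsub>free_Abelian_group (carrier A \<times> carrier B)\<^esub> (x + y)"
  using R.rcos_sum[of x y] assms by (simp add: tensor_group_def)

lemma coset_eq:
  assumes "Poly_Mapping.keys x \<subseteq> carrier A \<times> carrier B" "y - x \<in> tensor_relations A B"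
  shows "tensor_relations A B #>\<^bsub>free_Abelian_group (carrier A \<times> carrier B)\<^esub> y =
      tensor_relations A B #>\<^bsub>free_Abelian_group (carrier A \<times> carrier B)\<^esub> x"
proof (rule F.repr_independence[OF _ _ subgroup_tensor_relations, symmetric])
  show "y \<in> tensor_relations A B #>\<^bsub>free_Abelian_group (carrier A \<times> carrier B)\<^esub> x"
    unfolding r_coset_def using assms(2) by (intro UN_I[of "y - x"]) auto
qed (use assms(1) in simp)

lemma pure_tensor_mult_left:
  assumes "a \<in> carrier A" "a' \<in> carrier A" "b \<in> carrier B"
  shows "pure_tensor A B (a \<otimes>\<^bsub>A\<^esub> a') b =
    pure_tensor A B a b \<otimes>\<^bsub>tensor_group A B\<^esub> pure_tensor A B a' b"
proof -
  have keys: "Poly_Mapping.keys (frag_of (a, b) + frag_of (a', b)) \<subseteq> carrier A \<times> carrier B"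
    using assms keys_add[of "frag_of (a, b)" "frag_of (a', b)"] by auto
  have "frag_of (a \<otimes>\<^bsub>A\<^esub> a', b) - frag_of (a, b) - frag_of (a', b) \<in> tensor_relations A B"
    unfolding tensor_relations_def using assms by (intro generate.incl) blast
  then have "frag_of (a \<otimes>\<^bsub>A\<^esub> a', b) - (frag_of (a, b) + frag_of (a', b)) \<in> tensor_relations A B"
    by (simp add: diff_diff_eq)
  from coset_eq[OF keys this] show ?thesis
    unfolding pure_tensor_def using assms by (subst coset_mult) auto
qed

lemma pure_tensor_mult_right:
  assumes "a \<in> carrier A" "b \<in> carrier B" "b' \<in> carrier B"
  shows "pure_tensor A B a (b \<otimes>\<^bsub>B\<^esub> b') =
    pure_tensor A B a b \<otimes>\<^bsub>tensor_group A B\<^esub> pure_tensor A B a b'"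
proof -
  have keys: "Poly_Mapping.keys (frag_of (a, b) + frag_of (a, b')) \<subseteq> carrier A \<times> carrier B"
    using assms keys_add[of "frag_of (a, b)" "frag_of (a, b')"] by auto
  have "frag_of (a, b \<otimes>\<^bsub>B\<^esub> b') - frag_of (a, b) - frag_of (a, b') \<in> tensor_relations A B"
    unfolding tensor_relations_def using assms by (intro generate.incl) blast
  then have "frag_of (a, b \<otimes>\<^bsub>B\<^esub> b') - (frag_of (a, b) + frag_of (a, b')) \<in> tensor_relations A B"
    by (simp add: diff_diff_eq)
  from coset_eq[OF keys this] show ?thesis
    unfolding pure_tensor_def using assms by (subst coset_mult) auto
qed

text \<open>Pure tensors are the cosets of the free generators, and the cosets with values in
  \<open>K\<close> are closed under differences; induction over the free abelian group
  finishes.\<close>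

lemma tensor_group_subgroup_eq_carrier:
  assumes K: "subgroup K (tensor_group A B)"
    and pure: "\<And>a b. a \<in> carrier A \<Longrightarrow> b \<in> carrier B \<Longrightarrow> pure_tensor A B a b \<in> K"
  shows "carrier (tensor_group A B) \<subseteq> K"
proof
  interpret T: comm_group "tensor_group A B"
    by (rule comm_group_tensor_group)
  let ?coset = "\<lambda>x. tensor_relations A B #>\<^bsub>free_Abelian_group (carrier A \<times> carrier B)\<^esub> x"
  fix t assume "t \<in> carrier (tensor_group A B)"
  then obtain x where x: "Poly_Mapping.keys x \<subseteq> carrier A \<times> carrier B" "t = ?coset x"
    by (auto simp: tensor_group_def carrier_FactGroup)
  have "?coset x \<in> K"
    using x(1)
  proof (induction x rule: free_Abelian_group_induct[consumes 1, case_names zero diff gen])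
    case zero
    have "?coset 0 = \<one>\<^bsub>tensor_group A B\<^esub>"
      using F.coset_mult_one[OF R.subset] by (simp add: tensor_group_def)
    then show ?case
      using K by (simp add: subgroup.one_closed)
  next
    case (diff x y)
    have keys: "Poly_Mapping.keys (x - y) \<subseteq> carrier A \<times> carrier B"
      using diff(1,2) by (meson Un_least order_trans keys_diff)
    have "?coset (x - y) \<otimes>\<^bsub>tensor_group A B\<^esub> ?coset y = ?coset x"
      using diff(2) keys by (subst coset_mult) auto
    moreover have "?coset (x - y) \<in> carrier (tensor_group A B)"
      unfolding tensor_group_def carrier_FactGroup using keys by (intro imageI) simp
    moreover have "?coset x \<in> carrier (tensor_group A B)" "?coset y \<in> carrier (tensor_group A B)"
      using diff(3,4) K subgroup.mem_carrier by metis+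
    ultimately have "?coset (x - y) = ?coset x \<otimes>\<^bsub>tensor_group A B\<^esub> inv\<^bsub>tensor_group A B\<^esub> ?coset y"
      by (metis T.inv_solve_right)
    then show ?case
      using diff(3,4) K by (simp add: subgroup.m_closed subgroup.m_inv_closed)
  next
    case (gen z)
    then show ?case
      using pure by (cases z) (auto simp: pure_tensor_def)
  qed
  with x(2) show "t \<in> K"
    by simp
qed

end

lemma (in group_hom) generate_subset_vimage:
  assumes "subgroup K H" "S \<subseteq> carrier G" "h ` S \<subseteq> K" "x \<in> generate G S"
  shows "h x \<in> K"
  using assms(4)
proof (induction rule: generate.induct)
  case one
  then show ?case
    using assms(1) by (simp add: subgroup.one_closed)
next
  case (incl s)
  then show ?case
    using assms(3) by blast
next
  case (inv s)
  then show ?case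
    using assms by (auto simp: subgroup.m_inv_closed image_subset_iff subset_iff)
next
  case (eng s t)
  then show ?case
    using assms(1) G.generate_in_carrier[OF assms(2)] by (simp add: subgroup.m_closed)
qed

lemma lattice_group_finitely_generated:
  assumes "lattice_group Y"
  shows "\<exists>S. finite S \<and> S \<subseteq> carrier Y \<and> carrier Y \<subseteq> generate Y S"
proof -
  interpret Y: comm_group Y
    using assms by (simp add: lattice_group_def)
  obtain r :: nat where "Y \<cong> free_Abelian_group {..<r}"
    using assms by (auto simp: lattice_group_def)
  then have "free_Abelian_group {..<r} \<cong> Y"
    using Y.iso_sym by blast
  then obtain \<phi> where \<phi>: "\<phi> \<in> iso (free_Abelian_group {..<r}) Y"
    by (auto simp: is_iso_def)
  then interpret \<phi>: group_hom "free_Abelian_group {..<r}" Y \<phi>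
    by (simp add: group_hom_def group_hom_axioms_def iso_def Y.is_group)
  define S where "S = (\<phi> \<circ> frag_of) ` {..<r}"
  have S: "S \<subseteq> carrier Y"
    using \<phi>.hom_closed by (auto simp: S_def)
  interpret S: subgroup "generate Y S" Y
    using S by (rule Y.generate_is_subgroup)
  have "\<phi> x \<in> generate Y S" if "Poly_Mapping.keys x \<subseteq> {..<r}" for x
    using that
  proof (induction x rule: free_Abelian_group_induct[consumes 1, case_names zero diff gen])
    case zero
    then show ?case
      using \<phi>.hom_one S.one_closed by simp
  next
    case (diff x y)
    have "Poly_Mapping.keys (- y) \<subseteq> {..<r}"
      using diff(2) by simp
    then have "\<phi> (x + - y) = \<phi> x \<otimes>\<^bsub>Y\<^esub> \<phi> (- y)"
      using diff(1) \<phi>.hom_mult[of x "- y"] by simp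
    also have "\<phi> (- y) = inv\<^bsub>Y\<^esub> \<phi> y"
      using diff(2) \<phi>.hom_inv[of y] by simp
    finally show ?case
      using diff(3,4) by simp
  next
    case (gen a)
    then show ?case
      by (auto simp: S_def intro: generate.incl)
  qed
  moreover have "\<phi> ` carrier (free_Abelian_group {..<r}) = carrier Y"
    using \<phi> by (auto simp: iso_def bij_betw_def)
  ultimately have "carrier Y \<subseteq> generate Y S"
    by (metis (no_types, lifting) carrier_free_Abelian_group_iff image_subset_iff)
  then show ?thesis
    using S by (auto simp: S_def)
qed

context
  fixes Y :: "'y monoid"
  assumes Y: "comm_group Y"
begin

interpretation Y: comm_group Y by (fact Y)

lemma comm_group_torus: "comm_group (torus Y :: ('y, 'f::field) torus_elt monoid)"
  unfolding torus_def by (intro comm_group_tensor_group) (use mult_group.is_group Y.is_group in auto)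

lemma cochar_closed [simp]: "y \<in> carrier Y \<Longrightarrow> u \<noteq> 0 \<Longrightarrow> cochar Y y u \<in> carrier (torus Y)"
  unfolding torus_def cochar_def
  by (intro pure_tensor_closed) (use mult_group.is_group Y.is_group in auto)

lemma cochar_mult:
  assumes "y \<in> carrier Y" "u \<noteq> 0" "v \<noteq> 0"
  shows "cochar Y y (u * v) = cochar Y y u \<otimes>\<^bsub>torus Y\<^esub> cochar Y y v"
  using pure_tensor_mult_right[OF Y.is_group mult_group.is_group, of y u v] assms
  by (simp add: torus_def cochar_def)

lemma cochar_mult_left:
  assumes "y \<in> carrier Y" "z \<in> carrier Y" "u \<noteq> 0"
  shows "cochar Y (y \<otimes>\<^bsub>Y\<^esub> z) u = cochar Y y u \<otimes>\<^bsub>torus Y\<^esub> cochar Y z u"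
  using pure_tensor_mult_left[OF Y.is_group mult_group.is_group, of y z u] assms
  by (simp add: torus_def cochar_def)

lemma group_hom_cochar:
  assumes "y \<in> carrier Y"
  shows "group_hom mult_group (torus Y) (cochar Y y :: 'f::field \<Rightarrow> _)"
proof -
  interpret T: comm_group "torus Y :: ('y, 'f) torus_elt monoid"
    by (rule comm_group_torus)
  show ?thesis
    using assms by unfold_locales (auto simp: hom_def cochar_mult)
qed

lemma group_hom_cochar_left:
  assumes "u \<noteq> 0"
  shows "group_hom Y (torus Y) (\<lambda>y. cochar Y y (u :: 'f::field))"
proof -
  interpret T: comm_group "torus Y :: ('y, 'f) torus_elt monoid"
    by (rule comm_group_torus)
  show ?thesis
    using assms by unfold_locales (auto simp: hom_def cochar_mult_left)
qed

lemma cochar_mem_subgroup: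
  assumes "subgroup K (torus Y)" "S \<subseteq> carrier Y" "carrier Y \<subseteq> generate Y S"
    and "\<And>y. y \<in> S \<Longrightarrow> cochar Y y u \<in> K" "y \<in> carrier Y" "(u :: 'f::field) \<noteq> 0"
  shows "cochar Y y u \<in> K"
proof -
  interpret group_hom Y "torus Y" "\<lambda>y. cochar Y y u"
    using assms(6) by (rule group_hom_cochar_left)
  show ?thesis
    using assms by (intro generate_subset_vimage[of K S]) auto
qed

text \<open>Bilinearity allows generators to be taken in each factor separately: for y in
  \<open>S\<close> the map u -> y(u) reduces to u in \<open>U\<close>, then for fixed u the map y ->
  y(u) reduces to y in \<open>S\<close>, and the pure tensors generate the torus.\<close>

lemma torus_subgroup_eq_carrier:
  assumes K: "subgroup K (torus Y)" and S: "S \<subseteq> carrier Y" "carrier Y \<subseteq> generate Y S"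
    and U: "0 \<notin> U" "carrier mult_group \<subseteq> generate mult_group (U :: 'f::field set)"
    and cochar: "\<And>y u. y \<in> S \<Longrightarrow> u \<in> U \<Longrightarrow> cochar Y y u \<in> K"
  shows "carrier (torus Y) \<subseteq> K"
  unfolding torus_def
proof (rule tensor_group_subgroup_eq_carrier)
  fix y u assume y: "y \<in> carrier Y" and "u \<in> carrier (mult_group :: 'f monoid)"
  then have u: "u \<noteq> 0"
    by simp
  have "cochar Y z u \<in> K" if "z \<in> S" for z
  proof -
    interpret group_hom mult_group "torus Y" "cochar Y z :: 'f \<Rightarrow> _"
      using that S(1) by (intro group_hom_cochar) blast
    show ?thesis
    proof (rule generate_subset_vimage[OF K])
      show "U \<subseteq> carrier mult_group"
        using U(1) by auto
      show "u \<in> generate mult_group U"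
        using U(2) u by auto
    qed (use cochar that in blast)
  qed
  then show "pure_tensor Y mult_group y u \<in> K"
    using cochar_mem_subgroup[OF K S _ y u] by (simp add: cochar_def)
qed (use K Y.is_group mult_group.is_group in \<open>auto simp: torus_def\<close>)

lemma subgroup_torus0: "subgroup (torus0 Y) (torus Y :: ('y, 'f::{field_char_0,complete_space}) torus_elt monoid)"
proof -
  interpret T: comm_group "torus Y :: ('y, 'f) torus_elt monoid"
    by (rule comm_group_torus)
  show ?thesis
    unfolding torus0_def
    by (intro T.generate_is_subgroup) (auto simp: int_units_def absv_def intro!: cochar_closed)
qed

text \<open>The case k = 1 of \<open>torus_open\<close>, pulled back along the map from F^x to its
  one-factor power. As F^x is open in F, relatively open sets are open.\<close>

lemma openin_cochar_vimage:
  fixes U :: "('y, 'f::{field_char_0,complete_space}) torus_elt set"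
  assumes U: "openin (torus_topology Y) U" and y: "y \<in> carrier Y"
  shows "open {u. u \<noteq> 0 \<and> cochar Y y u \<in> U}"
proof -
  interpret T: comm_group "torus Y :: ('y, 'f) torus_elt monoid"
    by (rule comm_group_torus)
  let ?X = "top_of_set (carrier (mult_group :: 'f monoid))"
  let ?P = "product_topology (\<lambda>_. ?X) {..<1 :: nat}"
  have "torus_open Y U"
    using U by (simp add: openin_torus_topology)
  then have "openin ?P {u \<in> {..<1} \<rightarrow>\<^sub>E carrier mult_group.
      finprod (torus Y) (\<lambda>i. cochar Y y (u i)) {..<1} \<in> U}" (is "openin _ ?V")
    unfolding torus_open_def using y by (elim conjE allE[of _ 1] allE[of _ "\<lambda>_. y"]) auto
  moreover have "continuous_map ?X ?P (\<lambda>x. \<lambda>i\<in>{..<1}. x)"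
    by (auto simp: continuous_map_componentwise)
  ultimately have "openin ?X {x \<in> topspace ?X. (\<lambda>i\<in>{..<1}. x) \<in> ?V}"
    by (intro openin_continuous_map_preimage)
  moreover have "{x \<in> topspace ?X. (\<lambda>i\<in>{..<1}. x) \<in> ?V} = {u. u \<noteq> 0 \<and> cochar Y y u \<in> U}"
    using y by (auto simp: lessThan_Suc PiE_iff)
  moreover have "open (carrier (mult_group :: 'f monoid))"
    using open_delete[OF open_UNIV, of "0 :: 'f"] by (simp add: Collect_neg_eq Compl_eq_Diff_UNIV)
  ultimately show ?thesis
    by (simp only: openin_open_eq)
qed

end

section \<open>The cover\<close>

locale torus_cover = Y: comm_group Y for Y :: "'y monoid" +
  fixes n :: nat
    and c :: "('y, 'f::{field_char_0,complete_space}) torus_elt \<Rightarrow> ('y, 'f) torus_elt \<Rightarrow> 'f"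
  assumes n_pos: "n > 0" and finite_roots: "finite (roots_of_unity n :: 'f set)"
    and c_root: "s \<in> carrier (torus Y) \<Longrightarrow> t \<in> carrier (torus Y) \<Longrightarrow> c s t \<in> roots_of_unity n"
    and c_mult_left: "s \<in> carrier (torus Y) \<Longrightarrow> s' \<in> carrier (torus Y) \<Longrightarrow> t \<in> carrier (torus Y) \<Longrightarrow>
      c (s \<otimes>\<^bsub>torus Y\<^esub> s') t = c s t * c s' t"
    and c_mult_right: "s \<in> carrier (torus Y) \<Longrightarrow> s' \<in> carrier (torus Y) \<Longrightarrow> t \<in> carrier (torus Y) \<Longrightarrow>
      c t (s \<otimes>\<^bsub>torus Y\<^esub> s') = c t s * c t s'"

sublocale torus_cover \<subseteq> T: comm_group "torus Y :: ('y, 'f) torus_elt monoid"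
  using Y.comm_group_axioms by (rule comm_group_torus)

context torus_cover
begin

lemma root_nonzero: "z \<in> roots_of_unity n \<Longrightarrow> z \<noteq> (0 :: 'f)"
  using n_pos by (auto simp: roots_of_unity_def power_0_left)

lemma root_mult: "z \<in> roots_of_unity n \<Longrightarrow> w \<in> roots_of_unity n \<Longrightarrow> z * w \<in> (roots_of_unity n :: 'f set)"
  by (simp add: roots_of_unity_def power_mult_distrib)

lemma root_inverse: "z \<in> roots_of_unity n \<Longrightarrow> inverse z \<in> (roots_of_unity n :: 'f set)"
  by (simp add: roots_of_unity_def power_inverse)

lemma root_one: "1 \<in> (roots_of_unity n :: 'f set)"
  by (simp add: roots_of_unity_def)

lemmas root_intros = root_mult root_inverse root_one c_root

lemma c_nonzero: "s \<in> carrier (torus Y) \<Longrightarrow> t \<in> carrier (torus Y) \<Longrightarrow> c s t \<noteq> 0"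
  by (intro root_nonzero c_root)

lemma c_one_left [simp]: "t \<in> carrier (torus Y) \<Longrightarrow> c \<one>\<^bsub>torus Y\<^esub> t = 1"
  using c_mult_left[of "\<one>\<^bsub>torus Y\<^esub>" "\<one>\<^bsub>torus Y\<^esub>" t] c_nonzero[of "\<one>\<^bsub>torus Y\<^esub>" t] by simp

lemma c_one_right [simp]: "t \<in> carrier (torus Y) \<Longrightarrow> c t \<one>\<^bsub>torus Y\<^esub> = 1"
  using c_mult_right[of "\<one>\<^bsub>torus Y\<^esub>" "\<one>\<^bsub>torus Y\<^esub>" t] c_nonzero[of t "\<one>\<^bsub>torus Y\<^esub>"] by simp

lemma c_power:
  assumes "s \<in> carrier (torus Y)" "t \<in> carrier (torus Y)"
  shows "c (s [^]\<^bsub>torus Y\<^esub> (k :: nat)) t = c s t ^ k" "c t (s [^]\<^bsub>torus Y\<^esub> k) = c t s ^ k"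
  by (induction k) (use assms in \<open>simp_all add: c_mult_left c_mult_right\<close>)

lemma cover_simps [simp]:
  "carrier (cover n Y c) = roots_of_unity n \<times> carrier (torus Y)"
  "(z, s) \<otimes>\<^bsub>cover n Y c\<^esub> (w, t) = (z * w * c s t, s \<otimes>\<^bsub>torus Y\<^esub> t)"
  "\<one>\<^bsub>cover n Y c\<^esub> = (1, \<one>\<^bsub>torus Y\<^esub>)"
  by (simp_all add: cover_def)

text \<open>Associativity is bimultiplicativity of \<open>c\<close>: both bracketings of lifts of s,
  t, r produce the factor c(s, t) c(s, r) c(t, r).\<close>

lemma group_cover: "group (cover n Y c)"
proof (rule groupI)
  fix g h k
  assume gh: "g \<in> carrier (cover n Y c)" "h \<in> carrier (cover n Y c)"
  then show "g \<otimes>\<^bsub>cover n Y c\<^esub> h \<in> carrier (cover n Y c)"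
    by (cases g; cases h) (simp add: root_intros)
  assume "k \<in> carrier (cover n Y c)"
  with gh show "g \<otimes>\<^bsub>cover n Y c\<^esub> h \<otimes>\<^bsub>cover n Y c\<^esub> k = g \<otimes>\<^bsub>cover n Y c\<^esub> (h \<otimes>\<^bsub>cover n Y c\<^esub> k)"
    by (cases g; cases h; cases k) (simp add: c_mult_left c_mult_right T.m_assoc mult_ac)
next
  fix g assume g: "g \<in> carrier (cover n Y c)"
  obtain z t where zt: "g = (z, t)" "z \<in> roots_of_unity n" "t \<in> carrier (torus Y)"
    using g by auto
  then show "\<one>\<^bsub>cover n Y c\<^esub> \<otimes>\<^bsub>cover n Y c\<^esub> g = g"
    by simp
  show "\<exists>h\<in>carrier (cover n Y c). h \<otimes>\<^bsub>cover n Y c\<^esub> g = \<one>\<^bsub>cover n Y c\<^esub>"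
  proof (intro bexI)
    show "(inverse (z * c (inv\<^bsub>torus Y\<^esub> t) t), inv\<^bsub>torus Y\<^esub> t) \<otimes>\<^bsub>cover n Y c\<^esub> g = \<one>\<^bsub>cover n Y c\<^esub>"
      using zt root_nonzero[of z] c_nonzero[of "inv\<^bsub>torus Y\<^esub> t" t] by (simp add: field_simps)
    show "(inverse (z * c (inv\<^bsub>torus Y\<^esub> t) t), inv\<^bsub>torus Y\<^esub> t) \<in> carrier (cover n Y c)"
      using zt root_intros by simp
  qed
qed (simp add: root_one)

sublocale G: group "cover n Y c"
  by (rule group_cover)

lemma cover_inv:
  assumes "z \<in> roots_of_unity n" "t \<in> carrier (torus Y)"
  shows "inv\<^bsub>cover n Y c\<^esub> (z, t) = (inverse (z * c (inv\<^bsub>torus Y\<^esub> t) t), inv\<^bsub>torus Y\<^esub> t)"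
proof (rule G.inv_equality)
  show "(inverse (z * c (inv\<^bsub>torus Y\<^esub> t) t), inv\<^bsub>torus Y\<^esub> t) \<otimes>\<^bsub>cover n Y c\<^esub> (z, t) = \<one>\<^bsub>cover n Y c\<^esub>"
    using assms root_nonzero[of z] c_nonzero[of "inv\<^bsub>torus Y\<^esub> t" t] by (simp add: field_simps)
qed (use assms root_intros in auto)

lemma cover_mult_split:
  assumes "s \<in> carrier (torus Y)" "t \<in> carrier (torus Y)"
  shows "(z, s \<otimes>\<^bsub>torus Y\<^esub> t) = (z * inverse (c s t), s) \<otimes>\<^bsub>cover n Y c\<^esub> (1, t)"
  using assms c_nonzero[of s t] by simp

lemma cover_power:
  assumes "g \<in> carrier (cover n Y c)"
  shows "snd (g [^]\<^bsub>cover n Y c\<^esub> (k :: nat)) = snd g [^]\<^bsub>torus Y\<^esub> k"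
proof (induction k)
  case (Suc k)
  then show ?case
    by (cases g; cases "g [^]\<^bsub>cover n Y c\<^esub> k") simp
qed simp

lemma subgroup_cover0: "subgroup (cover0_carrier n Y) (cover n Y c)"
proof -
  interpret T0: subgroup "torus0 Y" "torus Y :: ('y, 'f) torus_elt monoid"
    using Y.comm_group_axioms by (rule subgroup_torus0)
  show ?thesis
  proof (rule G.subgroupI)
    show "cover0_carrier n Y \<subseteq> carrier (cover n Y c)"
      using T0.subset by (auto simp: cover0_carrier_def)
    have "(1, \<one>\<^bsub>torus Y\<^esub>) \<in> (cover0_carrier n Y :: ('f \<times> ('y, 'f) torus_elt) set)"
      using root_one by (simp add: cover0_carrier_def)
    then show "cover0_carrier n Y \<noteq> ({} :: ('f \<times> ('y, 'f) torus_elt) set)"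
      by blast
    fix g :: "'f \<times> ('y, 'f) torus_elt" assume "g \<in> cover0_carrier n Y"
    then obtain z s where g: "g = (z, s)" "z \<in> roots_of_unity n" "s \<in> torus0 Y" "s \<in> carrier (torus Y)"
      using T0.mem_carrier by (auto simp: cover0_carrier_def)
    have "inverse (z * c (inv\<^bsub>torus Y\<^esub> s) s) \<in> roots_of_unity n"
      using g(2,4) by (intro root_intros) simp_all
    then show "inv\<^bsub>cover n Y c\<^esub> g \<in> cover0_carrier n Y"
      using g cover_inv[OF g(2,4)] by (simp add: cover0_carrier_def)
    fix h :: "'f \<times> ('y, 'f) torus_elt" assume "h \<in> cover0_carrier n Y"
    then obtain w t where h: "h = (w, t)" "w \<in> roots_of_unity n" "t \<in> torus0 Y" "t \<in> carrier (torus Y)"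
      using T0.mem_carrier by (auto simp: cover0_carrier_def)
    have "z * w * c s t \<in> roots_of_unity n"
      using g(2,4) h(2,4) by (intro root_intros)
    then show "g \<otimes>\<^bsub>cover n Y c\<^esub> h \<in> cover0_carrier n Y"
      using g(1,3) h(1,3) by (simp add: cover0_carrier_def)
  qed
qed

text \<open>The commutator of lifts of s and t is c(s, t) / c(t, s), a root of unity over the
  identity of the torus.\<close>

lemma cover_commutator:
  assumes "g \<in> carrier (cover n Y c)" "h \<in> carrier (cover n Y c)"
  shows "\<exists>k\<in>cover0_carrier n Y. g \<otimes>\<^bsub>cover n Y c\<^esub> h = h \<otimes>\<^bsub>cover n Y c\<^esub> g \<otimes>\<^bsub>cover n Y c\<^esub> k"
proof -
  interpret T0: subgroup "torus0 Y" "torus Y :: ('y, 'f) torus_elt monoid"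
    using Y.comm_group_axioms by (rule subgroup_torus0)
  obtain z s w t where g: "g = (z, s)" "s \<in> carrier (torus Y)" and h: "h = (w, t)" "t \<in> carrier (torus Y)"
    using assms by auto
  show ?thesis
  proof (intro bexI)
    show "g \<otimes>\<^bsub>cover n Y c\<^esub> h =
        h \<otimes>\<^bsub>cover n Y c\<^esub> g \<otimes>\<^bsub>cover n Y c\<^esub> (c s t * inverse (c t s), \<one>\<^bsub>torus Y\<^esub>)"
      using g h c_nonzero[of t s] by (simp add: T.m_comm mult_ac)
    show "(c s t * inverse (c t s), \<one>\<^bsub>torus Y\<^esub>) \<in> cover0_carrier n Y"
      using g h root_intros by (simp add: cover0_carrier_def)
  qed
qed

text \<open>The commutator of g^n with h is c(s, t)^n / c(t, s)^n = 1. Only the torus component of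
  g^n has to be known, because \<mu>_n is central.\<close>

lemma cover_power_central:
  assumes "g \<in> carrier (cover n Y c)" "h \<in> carrier (cover n Y c)"
  shows "g [^]\<^bsub>cover n Y c\<^esub> n \<otimes>\<^bsub>cover n Y c\<^esub> h = h \<otimes>\<^bsub>cover n Y c\<^esub> g [^]\<^bsub>cover n Y c\<^esub> n"
proof -
  obtain z s where g: "g = (z, s)" "s \<in> carrier (torus Y)"
    using assms(1) by auto
  obtain w t where h: "h = (w, t)" "t \<in> carrier (torus Y)"
    using assms(2) by auto
  obtain x where x: "g [^]\<^bsub>cover n Y c\<^esub> n = (x, s [^]\<^bsub>torus Y\<^esub> n)"
    using cover_power[OF assms(1), of n] g(1) by (cases "g [^]\<^bsub>cover n Y c\<^esub> n") auto
  have "c s t ^ n = 1" "c t s ^ n = 1"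
    using c_root[of s t] c_root[of t s] g(2) h(2) by (simp_all add: roots_of_unity_def)
  then show ?thesis
    unfolding x h(1) using g(2) h(2) by (simp add: c_power T.m_comm mult_ac)
qed

text \<open>Since \<mu>_n lies in \<open>cover0_carrier\<close>, it suffices to reach the lifts (1,
  t). The t for which this succeeds form a subgroup \<open>K\<close> of the torus, cocycle values
  being absorbed by \<mu>_n, and \<open>torus_subgroup_eq_carrier\<close> applies to it.\<close>

lemma cover_generated:
  assumes S: "S \<subseteq> carrier Y" "carrier Y \<subseteq> generate Y S"
    and E: "0 \<notin> E" "carrier mult_group \<subseteq> generate mult_group (int_units \<union> E)"
  shows "carrier (cover n Y c) \<subseteq>
    generate (cover n Y c) (cover0_carrier n Y \<union> (\<lambda>(y, x). (1, cochar Y y x)) ` (S \<times> E))"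
    (is "_ \<subseteq> ?gen")
proof -
  interpret T0: subgroup "torus0 Y" "torus Y :: ('y, 'f) torus_elt monoid"
    using Y.comm_group_axioms by (rule subgroup_torus0)
  have cochar: "cochar Y y x \<in> carrier (torus Y)" if "y \<in> S" "x \<in> E" for y x
    using that S(1) E(1) by (auto intro!: cochar_closed Y.comm_group_axioms)
  have "cover0_carrier n Y \<union> (\<lambda>(y, x). (1, cochar Y y x)) ` (S \<times> E) \<subseteq> carrier (cover n Y c)"
    using T0.subset cochar root_one by (auto simp: cover0_carrier_def)
  then interpret gen: subgroup ?gen "cover n Y c"
    by (rule G.generate_is_subgroup)
  have root_gen: "(z, \<one>\<^bsub>torus Y\<^esub>) \<in> ?gen" if "z \<in> roots_of_unity n" for z
    using that T0.one_closed by (intro generate.incl) (simp add: cover0_carrier_def)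
  define K where "K = {t \<in> carrier (torus Y). (1, t) \<in> ?gen}"
  have K_root: "(z, t) \<in> ?gen" if "t \<in> K" "z \<in> roots_of_unity n" for z t
    using gen.m_closed[OF root_gen[OF that(2)], of "(1, t)"] that(1) by (simp add: K_def)
  have "subgroup K (torus Y)"
  proof (rule T.subgroupI)
    show "K \<subseteq> carrier (torus Y)" "K \<noteq> {}"
      using root_gen[OF root_one] by (auto simp: K_def)
    show "inv\<^bsub>torus Y\<^esub> t \<in> K" if t: "t \<in> K" for t
    proof -
      have tc: "t \<in> carrier (torus Y)"
        using t by (simp add: K_def)
      \<comment> \<open>This root of unity makes the first component of the inverse of (?z, t) equal
        to 1.\<close>
      let ?z = "inverse (c (inv\<^bsub>torus Y\<^esub> t) t)"
      have "inv\<^bsub>cover n Y c\<^esub> (?z, t) \<in> ?gen"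
        using K_root[OF t, of ?z] tc by (intro gen.m_inv_closed) (simp add: root_intros)
      moreover have "inv\<^bsub>cover n Y c\<^esub> (?z, t) = (1, inv\<^bsub>torus Y\<^esub> t)"
        using tc c_nonzero[of "inv\<^bsub>torus Y\<^esub> t" t] by (subst cover_inv) (auto simp: root_intros)
      ultimately show ?thesis
        using tc by (simp add: K_def)
    qed
    show "s \<otimes>\<^bsub>torus Y\<^esub> t \<in> K" if st: "s \<in> K" "t \<in> K" for s t
    proof -
      have carrier: "s \<in> carrier (torus Y)" "t \<in> carrier (torus Y)"
        using st by (simp_all add: K_def)
      have "(1 * inverse (c s t), s) \<otimes>\<^bsub>cover n Y c\<^esub> (1, t) \<in> ?gen"
        using st carrier by (intro gen.m_closed K_root) (simp_all add: root_intros)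
      then show ?thesis
        unfolding K_def using carrier cover_mult_split[OF carrier, of 1] by simp
    qed
  qed
  then have "carrier (torus Y) \<subseteq> K"
  proof (rule torus_subgroup_eq_carrier[OF Y.comm_group_axioms _ S _ E(2)])
    show "0 \<notin> int_units \<union> E"
      using E(1) by (auto simp: int_units_def absv_def)
    fix y x assume y: "y \<in> S" and "x \<in> int_units \<union> E"
    then consider "x \<in> int_units" | "x \<in> E"
      by blast
    then show "cochar Y y x \<in> K"
    proof cases
      case 1
      then have "cochar Y y x \<in> torus0 Y"
        unfolding torus0_def using y S(1) by (intro generate.incl) blast
      then show ?thesis
        unfolding K_def using T0.subset root_one by (auto simp: cover0_carrier_def intro!: generate.incl)
    next
      case 2
      then show ?thesis
        unfolding K_def using y cochar by (auto intro!: generate.incl)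
    qed
  qed
  then show ?thesis
    using K_root by auto
qed

lemma class_two_pair_cover:
  assumes "lattice_group Y" "padic_field TYPE('f) p"
  shows "\<exists>E. class_two_pair (cover n Y c) (cover0_carrier n Y) E n"
proof -
  obtain S where S: "finite S" "S \<subseteq> carrier Y" "carrier Y \<subseteq> generate Y S"
    using lattice_group_finitely_generated[OF assms(1)] by blast
  obtain E :: "'f set" where E: "finite E" "0 \<notin> E"
    "carrier mult_group \<subseteq> generate mult_group (int_units \<union> E)"
    using mult_group_generated[OF assms(2)] by blast
  let ?E = "(\<lambda>(y, x). (1 :: 'f, cochar Y y x)) ` (S \<times> E)"
  have "finite ?E"
    using S(1) E(1) by simp
  moreover have "?E \<subseteq> carrier (cover n Y c)"
    using S(2) E(2) root_one by (auto intro!: cochar_closed Y.comm_group_axioms)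
  ultimately have "class_two_pair (cover n Y c) (cover0_carrier n Y) ?E n"
    by (intro class_two_pair.intro class_two_pair_axioms.intro group_cover subgroup_cover0
        cover_commutator cover_power_central n_pos cover_generated[OF S(2,3) E(2,3)])
  then show ?thesis
    by blast
qed

lemma openin_cover_slice:
  assumes "openin (cover_topology n Y) (U :: ('f \<times> ('y, 'f) torus_elt) set)"
  shows "openin (torus_topology Y) {t. (1, t) \<in> U}"
proof (subst openin_subopen, intro ballI)
  fix t assume "t \<in> {t. (1, t) \<in> U}"
  then have "(1, t) \<in> U"
    by simp
  then have "\<exists>V W. openin (discrete_topology (roots_of_unity n)) V \<and> openin (torus_topology Y) W \<and>
      1 \<in> V \<and> t \<in> W \<and> V \<times> W \<subseteq> U"
    using assms unfolding cover_topology_def openin_prod_topology_alt by (elim allE impE)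
  then obtain V W where "1 \<in> V" "openin (torus_topology Y) W" "t \<in> W" "V \<times> W \<subseteq> U"
    by (elim exE conjE)
  then show "\<exists>W. openin (torus_topology Y) W \<and> t \<in> W \<and> W \<subseteq> {t. (1, t) \<in> U}"
    by (intro exI[of _ W]) auto
qed

section \<open>Finite orbits of the preimage of T_0\<close>

context
  fixes p and \<rho> :: "('f \<times> ('y, 'f) torus_elt, 'v::ab_group_add) rep"
  assumes padic: "padic_field TYPE('f) p"
    and smooth: "smooth_rep (cover n Y c) (cover_topology n Y) \<rho>"
begin

interpretation representation "cover n Y c" \<rho>
  using smooth by (intro representation.intro representation_axioms.intro group_cover)
    (simp_all add: smooth_rep_def del: cover_simps)

lemma act_split_left:
  "z \<in> roots_of_unity n \<Longrightarrow> t \<in> carrier (torus Y) \<Longrightarrow>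
    act \<rho> (z, t) v = act \<rho> (z, \<one>\<^bsub>torus Y\<^esub>) (act \<rho> (1, t) v)"
  using act_mult[of "(z, \<one>\<^bsub>torus Y\<^esub>)" "(1, t)" v] by (simp add: root_one)

text \<open>The lift t -> (1, t) is multiplicative only up to c(s, t). The representation is not
  assumed genuine, so \<mu>_n is carried along as a group of operators instead of scalars; hence the
  unions over its finitely many elements in the orbits below.\<close>

lemma act_mult_torus:
  assumes "s \<in> carrier (torus Y)" "t \<in> carrier (torus Y)"
  shows "act \<rho> (1, s \<otimes>\<^bsub>torus Y\<^esub> t) v =
    act \<rho> (inverse (c s t), \<one>\<^bsub>torus Y\<^esub>) (act \<rho> (1, s) (act \<rho> (1, t) v))"
proof -
  have "act \<rho> (1, s \<otimes>\<^bsub>torus Y\<^esub> t) v = act \<rho> (inverse (c s t), s) (act \<rho> (1, t) v)"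
    using act_mult[of "(inverse (c s t), s)" "(1, t)" v] assms c_nonzero[of s t]
    by (simp add: root_intros)
  then show ?thesis
    using act_split_left[of "inverse (c s t)" s] assms by (simp add: root_intros)
qed

text \<open>By smoothness all u in a ball of radius \<epsilon> about 1 fix \<open>v\<close>. By
  compactness finitely many such balls about units w cover the units; writing u = w (u / w) with |1
  - u / w| < \<epsilon>, the elements u and w send \<open>v\<close> to the same vector up to a root
  of unity.\<close>

lemma finite_cochar_orbit:
  assumes y: "y \<in> carrier Y"
  shows "finite ((\<lambda>u. act \<rho> (1, cochar Y y u) v) ` int_units)"
proof -
  note Yc = Y.comm_group_axioms
  have "openin (cover_topology n Y) {g \<in> carrier (cover n Y c). act \<rho> g v = v}"
    using smooth by (simp add: smooth_rep_def del: cover_simps)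
  then have "open {u. u \<noteq> 0 \<and> cochar Y y u \<in> {t. (1, t) \<in> {g \<in> carrier (cover n Y c). act \<rho> g v = v}}}"
    by (intro openin_cochar_vimage[OF Yc _ y] openin_cover_slice)
  then have "open {u. u \<noteq> 0 \<and> act \<rho> (1, cochar Y y u) v = v}" (is "open ?V")
    using y root_one by (simp add: cochar_closed[OF Yc] cong: conj_cong)
  interpret y: group_hom mult_group "torus Y" "cochar Y y :: 'f \<Rightarrow> _"
    using Yc y by (rule group_hom_cochar)
  have "1 \<in> ?V"
    using y.hom_one act_one[of v] by simp
  then obtain \<epsilon> where \<epsilon>: "\<epsilon> > 0" "ball 1 \<epsilon> \<subseteq> ?V"
    using \<open>open ?V\<close> unfolding open_contains_ball by blast
  obtain C where C: "C \<subseteq> int_units" "finite C" "int_units \<subseteq> (\<Union>u\<in>C. ball (u :: 'f) \<epsilon>)"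
    using compactE_image[OF compact_int_units[OF padic], of int_units "\<lambda>u. ball u \<epsilon>"] \<epsilon>(1)
    by force
  have "act \<rho> (1, cochar Y y u) v \<in>
      (\<Union>w\<in>C. \<Union>z\<in>roots_of_unity n. {act \<rho> (z, \<one>\<^bsub>torus Y\<^esub>) (act \<rho> (1, cochar Y y w) v)})"
    if u: "u \<in> int_units" for u
  proof -
    obtain w where w: "w \<in> C" "dist w u < \<epsilon>"
      using C(3) u by auto
    have nz: "u \<noteq> 0" "w \<noteq> 0" and absv_w: "absv w = 1"
      using u w(1) C(1) by (auto simp: int_units_def absv_def)
    have "dist 1 (u / w) = absv ((w - u) / w)"
      using nz by (simp add: dist_eq_absv[OF padic] diff_divide_distrib)
    also have "\<dots> < \<epsilon>"
      using w(2) absv_w by (simp add: absv_divide[OF padic] dist_eq_absv[OF padic])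
    finally have fixed: "act \<rho> (1, cochar Y y (u / w)) v = v"
      using \<epsilon>(2) by auto
    have closed: "cochar Y y w \<in> carrier (torus Y)" "cochar Y y (u / w) \<in> carrier (torus Y)"
      using nz y by (simp_all add: cochar_closed[OF Yc])
    have "cochar Y y u = cochar Y y w \<otimes>\<^bsub>torus Y\<^esub> cochar Y y (u / w)"
      using cochar_mult[OF Yc y, of w "u / w"] nz by simp
    then have "act \<rho> (1, cochar Y y u) v =
        act \<rho> (inverse (c (cochar Y y w) (cochar Y y (u / w))), \<one>\<^bsub>torus Y\<^esub>) (act \<rho> (1, cochar Y y w) v)"
      using act_mult_torus[OF closed] fixed by simp
    then show ?thesis
      using w(1) closed root_inverse[OF c_root] by blast
  qed
  then have "(\<lambda>u. act \<rho> (1, cochar Y y u) v) ` int_units \<subseteq>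
      (\<Union>w\<in>C. \<Union>z\<in>roots_of_unity n. {act \<rho> (z, \<one>\<^bsub>torus Y\<^esub>) (act \<rho> (1, cochar Y y w) v)})"
    by blast
  then show ?thesis
    by (rule finite_subset) (use C(2) finite_roots in auto)
qed

text \<open>Every element is s y(u) with s generated by the earlier cocharacters, so up to \<mu>_n
  the orbit is a union of orbits of the finitely many vectors y(u) v. The induction hypothesis is
  applied to these, hence \<open>v\<close> arbitrary.\<close>

lemma finite_generated_orbit:
  assumes "finite S" "S \<subseteq> carrier Y"
  shows "finite ((\<lambda>t. act \<rho> (1, t) v) ` generate (torus Y) {cochar Y y u | y u. y \<in> S \<and> u \<in> int_units})"
  using assms
proof (induction S arbitrary: v rule: finite_induct)
  case empty
  have "generate (torus Y) {} = {\<one>\<^bsub>torus Y\<^esub> :: ('y, 'f) torus_elt}"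
    by (rule T.generate_empty)
  then show ?case
    by simp
next
  case (insert y S)
  note Yc = Y.comm_group_axioms
  let ?gen = "\<lambda>S. generate (torus Y) {cochar Y y u | y (u :: 'f). y \<in> S \<and> u \<in> int_units}"
  have nz: "u \<noteq> 0" if "u \<in> int_units" for u :: 'f
    using that by (auto simp: int_units_def absv_def)
  have y: "y \<in> carrier Y"
    using insert.prems by simp
  have sub: "subgroup (?gen S) (torus Y)"
    using insert.prems by (intro T.generate_is_subgroup) (auto intro!: cochar_closed[OF Yc] nz)
  interpret S: subgroup "?gen S" "torus Y"
    by (rule sub)
  interpret y: group_hom mult_group "torus Y" "cochar Y y :: 'f \<Rightarrow> _"
    using Yc y by (rule group_hom_cochar)
  have unit_mult: "u * w \<in> int_units" and unit_inverse: "inverse u \<in> int_units"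
    if "u \<in> int_units" "w \<in> int_units" for u w :: 'f
    using that by (simp_all add: int_units_def absv_mult[OF padic] absv_inverse[OF padic])
  have one_unit: "(1 :: 'f) \<in> int_units"
    using absv_1[OF padic] by (simp add: int_units_def)
  have decompose: "\<exists>s u. s \<in> ?gen S \<and> u \<in> int_units \<and> t = s \<otimes>\<^bsub>torus Y\<^esub> cochar Y y u"
    if "t \<in> ?gen (insert y S)" for t
    using that
  proof (induction rule: generate.induct)
    case one
    show ?case
      using one_unit y.hom_one by (intro exI[of _ "\<one>\<^bsub>torus Y\<^esub>"] exI[of _ 1]) auto
  next
    case (incl t)
    then consider u where "u \<in> int_units" "t = cochar Y y u" | "t \<in> {cochar Y y u | y u. y \<in> S \<and> u \<in> int_units}"
      by blast
    then show ?case
    proof cases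
      case 1
      then show ?thesis
        using y nz by (intro exI[of _ "\<one>\<^bsub>torus Y\<^esub>"] exI[of _ u]) (auto simp: cochar_closed[OF Yc])
    next
      case 2
      then have "t \<in> ?gen S"
        by (rule generate.incl)
      then show ?thesis
        using one_unit y.hom_one by (intro exI[of _ t] exI[of _ 1]) auto
    qed
  next
    case (inv t)
    then consider u where "u \<in> int_units" "t = cochar Y y u" | "t \<in> {cochar Y y u | y u. y \<in> S \<and> u \<in> int_units}"
      by blast
    then show ?case
    proof cases
      case 1
      then have "inv\<^bsub>torus Y\<^esub> t = cochar Y y (inverse u)"
        using y.hom_inv[of u] nz by simp
      then show ?thesis
        using 1 y nz unit_inverse
        by (intro exI[of _ "\<one>\<^bsub>torus Y\<^esub>"] exI[of _ "inverse u"]) (auto simp: cochar_closed[OF Yc])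
    next
      case 2
      then have "inv\<^bsub>torus Y\<^esub> t \<in> ?gen S"
        by (rule generate.inv)
      then show ?thesis
        using one_unit y.hom_one by (intro exI[of _ "inv\<^bsub>torus Y\<^esub> t"] exI[of _ 1]) auto
    qed
  next
    case (eng t t')
    then obtain s u s' u' where *: "s \<in> ?gen S" "u \<in> int_units" "t = s \<otimes>\<^bsub>torus Y\<^esub> cochar Y y u"
      "s' \<in> ?gen S" "u' \<in> int_units" "t' = s' \<otimes>\<^bsub>torus Y\<^esub> cochar Y y u'"
      by (elim exE conjE)
    then have "t \<otimes>\<^bsub>torus Y\<^esub> t' = (s \<otimes>\<^bsub>torus Y\<^esub> s') \<otimes>\<^bsub>torus Y\<^esub> cochar Y y (u * u')"
      using y nz S.mem_carrier by (simp add: cochar_mult[OF Yc] cochar_closed[OF Yc] T.m_ac)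
    then show ?case
      using * unit_mult S.m_closed by blast
  qed
  let ?D = "(\<lambda>u. act \<rho> (1, cochar Y y u) v) ` int_units"
  have "(\<lambda>t. act \<rho> (1, t) v) ` ?gen (insert y S) \<subseteq>
      (\<Union>w\<in>?D. \<Union>x\<in>(\<lambda>t. act \<rho> (1, t) w) ` ?gen S. (\<lambda>z. act \<rho> (z, \<one>\<^bsub>torus Y\<^esub>) x) ` roots_of_unity n)"
  proof (intro image_subsetI)
    fix t assume "t \<in> ?gen (insert y S)"
    then obtain s u where su: "s \<in> ?gen S" "u \<in> int_units" "t = s \<otimes>\<^bsub>torus Y\<^esub> cochar Y y u"
      using decompose by blast
    have closed: "s \<in> carrier (torus Y)" "cochar Y y u \<in> carrier (torus Y)"
      using su y nz S.mem_carrier by (auto simp: cochar_closed[OF Yc])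
    have "act \<rho> (1, t) v =
        act \<rho> (inverse (c s (cochar Y y u)), \<one>\<^bsub>torus Y\<^esub>) (act \<rho> (1, s) (act \<rho> (1, cochar Y y u) v))"
      unfolding su(3) by (rule act_mult_torus[OF closed])
    then show "act \<rho> (1, t) v \<in>
        (\<Union>w\<in>?D. \<Union>x\<in>(\<lambda>t. act \<rho> (1, t) w) ` ?gen S. (\<lambda>z. act \<rho> (z, \<one>\<^bsub>torus Y\<^esub>) x) ` roots_of_unity n)"
      using su(1,2) root_inverse[OF c_root[OF closed]] by (intro UN_I imageI) auto
  qed
  moreover have fin: "finite ((\<lambda>t. act \<rho> (1, t) w) ` ?gen S)" for w
    using insert.IH insert.prems by simp
  have "finite (\<Union>w\<in>?D. \<Union>x\<in>(\<lambda>t. act \<rho> (1, t) w) ` ?gen S.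
      (\<lambda>z. act \<rho> (z, \<one>\<^bsub>torus Y\<^esub>) x) ` roots_of_unity n)"
    by (rule finite_UN_I[OF finite_cochar_orbit[OF y]], rule finite_UN_I[OF fin],
        rule finite_imageI[OF finite_roots])
  ultimately show ?case
    by (rule finite_subset)
qed

text \<open>By additivity in y, the elements y(u) with y from a finite generating set of the lattice
  already generate T_0; passing from T_0 to its preimage enlarges the orbit at most by the finite
  group \<mu>_n.\<close>

lemma finite_cover0_orbit:
  assumes "lattice_group Y"
  shows "finite ((\<lambda>h. act \<rho> h v) ` cover0_carrier n Y)"
proof -
  note Yc = Y.comm_group_axioms
  obtain S where S: "finite S" "S \<subseteq> carrier Y" "carrier Y \<subseteq> generate Y S"
    using lattice_group_finitely_generated[OF assms] by blast
  let ?gen = "generate (torus Y) {cochar Y y u | y (u :: 'f). y \<in> S \<and> u \<in> int_units}"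
  have nz: "u \<noteq> 0" if "u \<in> int_units" for u :: 'f
    using that by (auto simp: int_units_def absv_def)
  have sub: "subgroup ?gen (torus Y)"
    using S(2) by (intro T.generate_is_subgroup) (auto intro!: cochar_closed[OF Yc] nz)
  have "{cochar Y y u | y (u :: 'f). y \<in> carrier Y \<and> u \<in> int_units} \<subseteq> ?gen"
  proof
    fix t assume "t \<in> {cochar Y y u | y (u :: 'f). y \<in> carrier Y \<and> u \<in> int_units}"
    then obtain y u where yu: "t = cochar Y y u" "y \<in> carrier Y" "u \<in> int_units"
      by blast
    have "cochar Y z u \<in> ?gen" if "z \<in> S" for z
      using that yu(3) by (intro generate.incl) blast
    then show "t \<in> ?gen"
      unfolding yu(1) using yu(2) nz[OF yu(3)] by (rule cochar_mem_subgroup[OF Yc sub S(2,3)])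
  qed
  then have torus0: "torus0 Y \<subseteq> ?gen"
    unfolding torus0_def using sub by (rule T.generate_subgroup_incl)
  have "(\<lambda>h. act \<rho> h v) ` cover0_carrier n Y \<subseteq>
      (\<Union>x\<in>(\<lambda>t. act \<rho> (1, t) v) ` ?gen. (\<lambda>z. act \<rho> (z, \<one>\<^bsub>torus Y\<^esub>) x) ` roots_of_unity n)"
  proof (rule image_subsetI)
    fix h :: "'f \<times> ('y, 'f) torus_elt" assume "h \<in> cover0_carrier n Y"
    then obtain z t where h: "h = (z, t)" "z \<in> roots_of_unity n" "t \<in> ?gen"
      using torus0 by (auto simp: cover0_carrier_def)
    have "act \<rho> h v = act \<rho> (z, \<one>\<^bsub>torus Y\<^esub>) (act \<rho> (1, t) v)"
      unfolding h(1) by (rule act_split_left[OF h(2) subgroup.mem_carrier[OF sub h(3)]])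
    then show "act \<rho> h v \<in>
      (\<Union>x\<in>(\<lambda>t. act \<rho> (1, t) v) ` ?gen. (\<lambda>z. act \<rho> (z, \<one>\<^bsub>torus Y\<^esub>) x) ` roots_of_unity n)"
      by (simp only:) (rule UN_I, rule imageI[OF h(3)], rule imageI[OF h(2)])
  qed
  moreover have "finite (\<Union>x\<in>(\<lambda>t. act \<rho> (1, t) v) ` ?gen. (\<lambda>z. act \<rho> (z, \<one>\<^bsub>torus Y\<^esub>) x) ` roots_of_unity n)"
    by (rule finite_UN_I[OF finite_generated_orbit[OF S(1,2)]], rule finite_imageI[OF finite_roots])
  ultimately show ?thesis
    by (rule finite_subset)
qed

end

lemma class_two_representation_cover:
  assumes pair: "class_two_pair (cover n Y c) (cover0_carrier n Y) E n"
    and "lattice_group Y" "padic_field TYPE('f) p"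
    and irrep: "smooth_irrep (cover n Y c) (cover_topology n Y) \<rho>"
  shows "class_two_representation (cover n Y c) (cover0_carrier n Y) E n \<rho>"
proof (intro class_two_representation.intro irreducible_representation.intro representation.intro
    representation_axioms.intro irreducible_representation_axioms.intro
    class_two_representation_axioms.intro pair group_cover)
  have smooth: "smooth_rep (cover n Y c) (cover_topology n Y) \<rho>"
    using irrep by (simp add: smooth_irrep_def del: cover_simps)
  then show "finite ((\<lambda>h. act \<rho> h v) ` cover0_carrier n Y)" for v
    using finite_cover0_orbit assms(2,3) by blast
  show "\<exists>v::'a. v \<noteq> 0"
    using irrep by (auto simp: smooth_irrep_def simp del: cover_simps)
qed (use irrep in \<open>simp_all add: smooth_irrep_def smooth_rep_def del: cover_simps\<close>)

end

lemma torus_cover_bd_cocycle: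
  assumes "lattice_group Y" "bd_cocycle n art Y D c" "n \<ge> 1" "card (roots_of_unity n :: 'f set) = n"
  shows "torus_cover Y n (c :: ('y, 'f::{field_char_0,complete_space}) torus_elt \<Rightarrow> _)"
proof (intro torus_cover.intro torus_cover_axioms.intro)
  \<comment> \<open>An infinite set has \<open>card\<close> 0, which n \<ge> 1 excludes.\<close>
  show "finite (roots_of_unity n :: 'f set)"
    using assms(3,4) by (intro card_ge_0_finite) simp
qed (use assms in \<open>simp_all add: lattice_group_def bd_cocycle_def\<close>)

section \<open>The two implications of the type property\<close>

context torus_cover
begin

text \<open>A surjection \<sigma> -> \<open>\<sigma>\<^sub>0\<close> followed by an injection
  \<open>\<sigma>\<^sub>0\<close> -> \<pi> is a nonzero H-map. The character supplied by
  \<open>isomorphic_up_to_character\<close> is trivial on H, so it descends to a character of T that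
  is trivial on T_0.\<close>

lemma contains_rep_imp_inertial_class:
  fixes \<sigma> :: "('f \<times> ('y, 'f) torus_elt, 'v::ab_group_add) rep"
    and \<pi> :: "('f \<times> ('y, 'f) torus_elt, 'w::ab_group_add) rep"
    and \<sigma>\<^sub>0 :: "('f \<times> ('y, 'f) torus_elt, 'u::ab_group_add) rep"
  assumes \<sigma>: "class_two_representation (cover n Y c) (cover0_carrier n Y) E n \<sigma>"
    and \<pi>: "class_two_representation (cover n Y c) (cover0_carrier n Y) E n \<pi>"
    and \<pi>_irrep: "smooth_irrep (cover n Y c) (cover_topology n Y) \<pi>"
    and q: "intertwines_on (cover0 n Y c) \<sigma> UNIV \<sigma>\<^sub>0 q" "surj q"
    and nontrivial: "(UNIV :: 'u set) \<noteq> {0}"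
    and contains: "contains_rep (cover0 n Y c) \<pi> \<sigma>\<^sub>0"
  shows "\<pi> \<in> inertial_class n Y c \<sigma>"
proof -
  interpret class_two_representation_pair "cover n Y c" "cover0_carrier n Y" E n \<sigma> \<pi>
    using \<sigma> \<pi> by (rule class_two_representation_pair.intro)
  obtain j where j: "intertwines_on (cover0 n Y c) \<sigma>\<^sub>0 UNIV \<pi> j" "inj j"
    using contains by (auto simp: contains_rep_def)
  have comp: "intertwines_on (cover n Y c\<lparr>carrier := cover0_carrier n Y\<rparr>) \<sigma> UNIV \<pi> (j \<circ> q)"
    using j(1) q(1) by (simp add: intertwines_on_def cover0_def)
  obtain x :: 'u where "x \<noteq> 0"
    using nontrivial by auto
  obtain v where "q v = x"
    using q(2) by (metis surjD)
  have "j 0 = 0"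
    using j(1) by (auto simp: intertwines_on_def) (metis add_cancel_right_right)
  then have "(j \<circ> q) v \<noteq> 0"
    using j(2) \<open>q v = x\<close> \<open>x \<noteq> 0\<close> by (metis comp_apply injD)
  from isomorphic_up_to_character[OF comp this] obtain \<psi> \<nu> where "bij \<psi>"
    and add: "\<forall>x y. \<psi> (x + y) = \<psi> x + \<psi> y"
    and scale: "\<forall>a x. \<psi> (scal \<sigma> a x) = scal \<pi> a (\<psi> x)"
    and \<nu>: "\<forall>g\<in>carrier (cover n Y c). \<nu> g \<noteq> 0 \<and> (\<forall>x. act \<pi> g (\<psi> x) = \<psi> (scal \<sigma> (\<nu> g) (act \<sigma> g x)))"
    and \<nu>_0: "\<forall>h\<in>cover0_carrier n Y. \<nu> h = 1"
    and \<nu>_mult: "\<forall>g\<in>carrier (cover n Y c). \<forall>h\<in>carrier (cover n Y c).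
      \<nu> (g \<otimes>\<^bsub>cover n Y c\<^esub> h) = \<nu> g * \<nu> h"
    by (elim exE conjE)
  interpret T0: subgroup "torus0 Y" "torus Y :: ('y, 'f) torus_elt monoid"
    using Y.comm_group_axioms by (rule subgroup_torus0)
  have \<nu>_root: "\<nu> (z, t) = \<nu> (1, t)" if "z \<in> roots_of_unity n" "t \<in> carrier (torus Y)" for z t
  proof -
    have "\<nu> ((z, \<one>\<^bsub>torus Y\<^esub>) \<otimes>\<^bsub>cover n Y c\<^esub> (1, t)) = \<nu> (z, \<one>\<^bsub>torus Y\<^esub>) * \<nu> (1, t)"
      using that root_one by (intro \<nu>_mult[rule_format]) simp_all
    moreover have "\<nu> (z, \<one>\<^bsub>torus Y\<^esub>) = 1"
      using that(1) by (intro \<nu>_0[rule_format]) (simp add: cover0_carrier_def)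
    ultimately show ?thesis
      using that(2) by simp
  qed
  \<comment> \<open>The lift t -> (1, t) is no homomorphism, but \<nu> is trivial on \<mu>_n and so
    does not see the cocycle.\<close>
  define \<mu> where "\<mu> t = \<nu> (1, t)" for t
  have "\<mu> (s \<otimes>\<^bsub>torus Y\<^esub> t) = \<mu> s * \<mu> t" if "s \<in> carrier (torus Y)" "t \<in> carrier (torus Y)" for s t
  proof -
    have "\<nu> ((1, s) \<otimes>\<^bsub>cover n Y c\<^esub> (1, t)) = \<nu> (1, s) * \<nu> (1, t)"
      using that root_one by (intro \<nu>_mult[rule_format]) simp_all
    then show ?thesis
      using \<nu>_root[OF c_root[OF that], of "s \<otimes>\<^bsub>torus Y\<^esub> t"] that by (simp add: \<mu>_def)
  qed
  moreover have "\<mu> t \<noteq> 0" if "t \<in> carrier (torus Y)" for t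
    using \<nu> root_one that by (simp add: \<mu>_def)
  moreover have "\<mu> t = 1" if "t \<in> torus0 Y" for t
    using \<nu>_0 root_one that by (simp add: \<mu>_def cover0_carrier_def)
  ultimately have "unramified_character Y \<mu>"
    by (auto simp: unramified_character_def hom_def)
  moreover have "rep_iso (cover n Y c) \<pi> (twist \<sigma> \<mu>)"
  proof -
    have inv: "inv_into UNIV \<psi> w = v" if "w = \<psi> v" for v w
      using \<open>bij \<psi>\<close> that by (simp add: bij_is_inj)
    have right: "\<psi> (inv_into UNIV \<psi> w) = w" for w
      using \<open>bij \<psi>\<close> by (simp add: bij_is_surj surj_f_inv_f)
    \<comment> \<open>\<psi> goes from \<sigma> to \<pi>, whereas the isomorphism asked for starts
      at \<pi>.\<close>
    have "intertwines_on (cover n Y c) \<pi> UNIV (twist \<sigma> \<mu>) (inv_into UNIV \<psi>)"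
      unfolding intertwines_on_def
    proof (intro conjI ballI allI)
      show "inv_into UNIV \<psi> (x + y) = inv_into UNIV \<psi> x + inv_into UNIV \<psi> y" for x y
        by (rule inv) (simp add: add right)
      show "inv_into UNIV \<psi> (scal \<pi> a x) = scal (twist \<sigma> \<mu>) a (inv_into UNIV \<psi> x)" for a x
        by (rule inv) (simp add: twist_def scale right)
      fix g x assume g: "g \<in> carrier (cover n Y c)"
      then have "\<nu> g = \<mu> (snd g)"
        using \<nu>_root by (auto simp: \<mu>_def)
      then have "act (twist \<sigma> \<mu>) g (inv_into UNIV \<psi> x) = scal \<sigma> (\<nu> g) (act \<sigma> g (inv_into UNIV \<psi> x))"
        by (simp add: twist_def)
      moreover have "act \<pi> g (\<psi> (inv_into UNIV \<psi> x)) =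
          \<psi> (scal \<sigma> (\<nu> g) (act \<sigma> g (inv_into UNIV \<psi> x)))"
        using \<nu> g by blast
      ultimately show "inv_into UNIV \<psi> (act \<pi> g x) = act (twist \<sigma> \<mu>) g (inv_into UNIV \<psi> x)"
        by (intro inv) (simp only: right)
    qed
    moreover have "bij (inv_into UNIV \<psi>)"
      using \<open>bij \<psi>\<close> by (rule bij_imp_bij_inv)
    ultimately show ?thesis
      unfolding rep_iso_def by blast
  qed
  ultimately show ?thesis
    using \<pi>_irrep unfolding inertial_class_def by blast
qed

text \<open>An unramified character is 1 on T_0, so twisting does not change the restriction to H;
  the embedding of \<open>\<sigma>\<^sub>0\<close> is carried over by the inverse of the
  isomorphism.\<close>

lemma inertial_class_imp_contains_rep:
  fixes \<sigma> :: "('f \<times> ('y, 'f) torus_elt, 'v::ab_group_add) rep"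
    and \<pi> :: "('f \<times> ('y, 'f) torus_elt, 'w::ab_group_add) rep"
    and \<sigma>\<^sub>0 :: "('f \<times> ('y, 'f) torus_elt, 'u::ab_group_add) rep"
  assumes "vector_space (scal \<sigma>)" "\<pi> \<in> inertial_class n Y c \<sigma>"
    and contains: "contains_rep (cover0 n Y c) \<sigma> \<sigma>\<^sub>0"
  shows "contains_rep (cover0 n Y c) \<pi> \<sigma>\<^sub>0"
proof -
  interpret \<sigma>: vector_space "scal \<sigma>"
    by (fact assms(1))
  interpret T0: subgroup "torus0 Y" "torus Y :: ('y, 'f) torus_elt monoid"
    using Y.comm_group_axioms by (rule subgroup_torus0)
  obtain \<nu> f where \<nu>: "unramified_character Y \<nu>"
    and f: "intertwines_on (cover n Y c) \<pi> UNIV (twist \<sigma> \<nu>) f" and "bij f"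
    using assms(2) by (auto simp: inertial_class_def rep_iso_def)
  obtain j where j: "intertwines_on (cover0 n Y c) \<sigma>\<^sub>0 UNIV \<sigma> j" "inj j"
    using contains by (auto simp: contains_rep_def)
  have inv: "inv_into UNIV f w = v" if "w = f v" for v w
    using \<open>bij f\<close> that by (simp add: bij_is_inj)
  have right: "f (inv_into UNIV f w) = w" for w
    using \<open>bij f\<close> by (simp add: bij_is_surj surj_f_inv_f)
  have "intertwines_on (cover0 n Y c) \<sigma>\<^sub>0 UNIV \<pi> (inv_into UNIV f \<circ> j)"
    unfolding intertwines_on_def
  proof (intro conjI ballI allI)
    show "(inv_into UNIV f \<circ> j) (x + y) = (inv_into UNIV f \<circ> j) x + (inv_into UNIV f \<circ> j) y" for x y
      unfolding comp_apply by (rule inv) (use f j(1) in \<open>simp add: intertwines_on_def right\<close>)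
    show "(inv_into UNIV f \<circ> j) (scal \<sigma>\<^sub>0 a x) = scal \<pi> a ((inv_into UNIV f \<circ> j) x)" for a x
      unfolding comp_apply by (rule inv) (use f j(1) in \<open>simp add: intertwines_on_def right twist_def\<close>)
    fix h x assume h: "h \<in> carrier (cover0 n Y c)"
    then have "\<nu> (snd h) = 1" and "h \<in> carrier (cover n Y c)"
      using \<nu> T0.subset by (auto simp: cover0_def cover0_carrier_def unramified_character_def)
    then have "f (act \<pi> h y) = act \<sigma> h (f y)" for y
      using f by (simp add: intertwines_on_def twist_def del: cover_simps)
    then show "(inv_into UNIV f \<circ> j) (act \<sigma>\<^sub>0 h x) = act \<pi> h ((inv_into UNIV f \<circ> j) x)"
      unfolding comp_apply by (intro inv) (use h j(1) in \<open>simp add: intertwines_on_def right\<close>)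
  qed
  moreover have "inj (inv_into UNIV f \<circ> j)"
    using \<open>bij f\<close> j(2) by (intro inj_compose) (simp add: bij_imp_bij_inv bij_is_inj)
  ultimately show ?thesis
    unfolding contains_rep_def by blast
qed

end

theorem corollary5p6:
  fixes p n :: nat
    and art :: "'f::{field_char_0,complete_space} \<Rightarrow> 'f alg_closure \<Rightarrow> 'f alg_closure"
    and Y :: "'y monoid"
    and D :: "'y \<Rightarrow> 'y \<Rightarrow> int"
    and c :: "('y, 'f) torus_elt \<Rightarrow> ('y, 'f) torus_elt \<Rightarrow> 'f"
    and \<epsilon> :: "'f \<Rightarrow> complex"
    and \<sigma> :: "('f \<times> ('y, 'f) torus_elt, 'v::ab_group_add) rep"
    and \<sigma>\<^sub>0 :: "('f \<times> ('y, 'f) torus_elt, 'u::ab_group_add) rep"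
  assumes "prime p"
    and "padic_field TYPE('f) p"
    and "n \<ge> 1"
    and "card (roots_of_unity n :: 'f set) = n"
    and "local_artin_map art"
    and "lattice_group Y"
    and "bilinear_form Y D"
    and "bd_cocycle n art Y D c"
    and "faithful_character n \<epsilon>"
    and "smooth_irrep (cover n Y c) (cover_topology n Y) \<sigma>"
    and "genuine n Y \<epsilon> \<sigma>"
    and "irreducible_constituent (cover0 n Y c) (cover0_topology n Y) \<sigma> \<sigma>\<^sub>0"
  shows "is_type TYPE('w::ab_group_add) n Y c \<sigma>\<^sub>0 \<sigma>"
proof -
  interpret torus_cover Y n c
    using assms by (intro torus_cover_bd_cocycle)
  obtain E where E: "class_two_pair (cover n Y c) (cover0_carrier n Y) E n"
    using class_two_pair_cover assms by blast
  interpret \<sigma>: class_two_representation "cover n Y c" "cover0_carrier n Y" E n \<sigma>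
    using assms(10) by (rule class_two_representation_cover[OF E assms(6,2)])
  obtain W f where W: "invariant_subspace (cover0 n Y c) \<sigma> W"
    and f: "intertwines_on (cover0 n Y c) \<sigma> W \<sigma>\<^sub>0 f" "f ` W = UNIV"
    using assms(12) by (auto simp: irreducible_constituent_def)
  \<comment> \<open>The quotient form yields membership in the inertial class from containment, the
    subrepresentation form yields the converse.\<close>
  note split = \<sigma>.H_constituent_splits[folded cover0_def, OF W f]
  obtain q where q: "intertwines_on (cover0 n Y c) \<sigma> UNIV \<sigma>\<^sub>0 q" "surj q"
    using split(2) by (elim exE conjE)
  have nontrivial: "(UNIV :: 'u set) \<noteq> {0}"
    using assms(12) by (simp add: irreducible_constituent_def smooth_irrep_def)
  show ?thesis
    unfolding is_type_def
  proof (intro allI impI iffI)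
    fix \<pi> :: "('f \<times> ('y, 'f) torus_elt, 'w) rep"
    assume \<pi>: "smooth_irrep (cover n Y c) (cover_topology n Y) \<pi>"
    show "\<pi> \<in> inertial_class n Y c \<sigma>" if "contains_rep (cover0 n Y c) \<pi> \<sigma>\<^sub>0"
      using \<sigma>.class_two_representation_axioms
        class_two_representation_cover[OF E assms(6,2) \<pi>] \<pi> q nontrivial that
      by (rule contains_rep_imp_inertial_class)
    show "contains_rep (cover0 n Y c) \<pi> \<sigma>\<^sub>0" if "\<pi> \<in> inertial_class n Y c \<sigma>"
      using \<sigma>.vector_space_scal that split(1) by (rule inertial_class_imp_contains_rep)
  qed
qed

end
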